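(* Let $A$ be a linear operator on a Banach space $X$ satisfying the resolvent condition and the forcing condition, and let $\{B(t)\}_{t\in\mathbb R}\subset\mathcal L(X_0,X)$ satisfy the perturbation condition with bound function $b$. Assume that $\sup_{t\in\mathbb R}b(t)<+\infty$ and that the evolution family $\{U_B(t,s)\}_{(t,s)\in\Delta}\subset\mathcal L(X_0)$ has an exponential dichotomy. Then there exists $\varepsilon>0$ such that for each strongly continuous family $\{C(t)\}_{t\in\mathbb R}\subset\mathcal L(X_0,X)$ satisfying $$\sup_{t\in\mathbb R}\|B(t)-C(t)\|_{\mathcal L(X_0,X)}\le\varepsilon,$$ the evolution family generated by $\frac{du(t)}{dt}=(A+C(t))u(t)$, $t\in\mathbb R$, has an exponential dichotomy.
   Context: $(X,\|\cdot\|)$ is a Banach space, $A:D(A)\subset X\to X$ is a linear operator (its domain need not be dense), $X_0:=\overline{D(A)}$ with the norm of $X$, $\rho(A)$ is the resolvent set, and $\Delta:=\{(t,s)\in\mathbb R^2:t\ge s\}$. A family $\{C(t)\}$ is strongly continuous if $t\mapsto C(t)x$ is continuous from $\mathbb R$ into $X$ for each $x\in X_0$. Resolvent condition: there are fixed $\omega\in\mathbb R$, $M\ge1$ with $(\omega,+\infty)\subset\rho(A)$, $\|(\lambda I-A)^{-k}\|_{\mathcal L(X_0)}\le M(\lambda-\omega)^{-k}$ for all $\lambda>\omega$, $k\ge1$, and $\lim_{\lambda\to+\infty}(\lambda I-A)^{-1}x=0$ for all $x\in X$. Forcing condition: for each $\tau>0$ and $f\in C([0,\tau],X)$ there is $u_f\in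 C([0,\tau],X_0)$ with $\int_0^tu_f(s)ds\in D(A)$ and $u_f(t)=A\int_0^tu_f(s)ds+\int_0^tf(s)ds$ for all $t\in[0,\tau]$; moreover there is a non decreasing $\delta:[0,+\infty)\to[0,+\infty)$ (independent of $f,\tau$) with $\delta(t)\to0$ as $t\to0^+$ and $\|u_f(t)\|\le\delta(t)\sup_{s\in[0,t]}\|f(s)\|$. Perturbation condition: $\{B(t)\}_{t\in\mathbb R}\subset\mathcal L(X_0,X)$ is strongly continuous and there is $b\in C(\mathbb R,\mathbb R_+)$ with $\|B(t)\|_{\mathcal L(X_0,X)}\le b(t)$ for all $t\in\mathbb R$. An evolution family on a Banach space $Z$ is $\{U(t,s)\}_{(t,s)\in\Delta}\subset\mathcal L(Z)$ with $U(t,t)=I$, $U(t,r)U(r,s)=U(t,s)$ for $t\ge r\ge s$, and $(t,s)\mapsto U(t,s)x$ continuous on $\Delta$ for each $x\in Z$. The evolution family $U_B$ on $X_0$ generated by $u'=(A+B(t))u$ is the one such that, for $x_0\in X_0$, $u(t)=U_B(t,t_0)x_0$ is the unique $u\in C([t_0,+\infty),X_0)$ with $\int_{t_0}^tu(r)dr\in D(A)$ and $u(t)=x_0+A\int_{t_0}^tu(r)dr+\int_{t_0}^tB(r)u(r)dr$ for all $t\ge t_0$; similarly with $C$ in place of $B$. Exponential dichotomy: an evolution family $U$ on $Z$ has an exponential dichotomy with constant $\kappa\ge1$ and exponent $\beta>0$ if: (i) there are families of bounded projections $\{\Pi^\pm(t)\}_{t\in\mathbb R}$ on $Z$, with $t\mapsto\Pi^\pm(t)x$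 continuous for each $x\in Z$ and $\Pi^+(t)+\Pi^-(t)=I$; put $U^\pm(t,s):=U(t,s)\Pi^\pm(s)$ for $t\ge s$; (ii) $\Pi^+(t)U(t,s)=U(t,s)\Pi^+(s)$ for $t\ge s$ (hence the same for $\Pi^-$); (iii) for $t\ge s$, $U(t,s)$ restricted to $\Pi^-(s)(Z)$ is invertible onto $\Pi^-(t)(Z)$, with inverse $\bar U^-(s,t)$; put $U^-(s,t):=\bar U^-(s,t)\Pi^-(t)$; (iv) $\|U^+(t,s)\|\le\kappa e^{-\beta(t-s)}$ and $\|U^-(s,t)\|\le\kappa e^{-\beta(t-s)}$ for all $t\ge s$. "Has an exponential dichotomy" means for some $\kappa\ge1$, $\beta>0$. *)

theory Defs
  imports "HOL-Analysis.Analysis"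
begin

text \<open>
  Closed subspaces of the Banach space \<open>'a\<close> are represented as sets. A bounded operator on such a
  subspace is a total function of which only the values on the subspace matter. An unbounded
  operator is a pair of a domain \<open>D\<close> and a total function \<open>A\<close> of which only the values on
  \<open>D\<close> matter.
\<close>

definition linear_on_set :: "'a::real_vector set \<Rightarrow> ('a \<Rightarrow> 'b::real_vector) \<Rightarrow> bool" where
  "linear_on_set S f \<longleftrightarrow> subspace S \<and>
     (\<forall>x\<in>S. \<forall>y\<in>S. f (x + y) = f x + f y) \<and> (\<forall>c. \<forall>x\<in>S. f (c *\<^sub>R x) = c *\<^sub>R f x)"

definition bounded_ops :: "'a::real_normed_vector set \<Rightarrow> 'b::real_normed_vector set \<Rightarrow> ('a \<Rightarrow> 'b) set" where
  "bounded_ops S T = {f. linear_on_set S f \<and> f ` S \<subseteq> T \<and> (\<exists>K. \<forall>x\<in>S. norm (f x) \<le> K * norm x)}"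

text \<open>The analogue of \<^const>\<open>onorm\<close> on a subspace. Being a real supremum, it is meaningful only
  for members of \<open>bounded_ops S UNIV\<close>.\<close>

definition onorm_on :: "'a::real_normed_vector set \<Rightarrow> ('a \<Rightarrow> 'b::real_normed_vector) \<Rightarrow> real" where
  "onorm_on S f = (SUP x\<in>S. norm (f x) / norm x)"

definition resolvent :: "'a::real_normed_vector set \<Rightarrow> ('a \<Rightarrow> 'a) \<Rightarrow> real \<Rightarrow> 'a \<Rightarrow> 'a" where
  "resolvent D A l = inv_into D (\<lambda>x. l *\<^sub>R x - A x)"

text \<open>Only real spectral parameters occur, so this is the real part of the resolvent set.\<close>

definition resolvent_set :: "'a::real_normed_vector set \<Rightarrow> ('a \<Rightarrow> 'a) \<Rightarrow> real set" where
  "resolvent_set D A =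
     {l. bij_betw (\<lambda>x. l *\<^sub>R x - A x) D UNIV \<and> bounded_linear (resolvent D A l)}"

definition resolvent_condition :: "'a::banach set \<Rightarrow> ('a \<Rightarrow> 'a) \<Rightarrow> bool" where
  "resolvent_condition D A \<longleftrightarrow>
     (\<exists>\<omega> M. M \<ge> 1 \<and> {\<omega><..} \<subseteq> resolvent_set D A \<and>
        (\<forall>l>\<omega>. \<forall>k\<ge>1. onorm_on (closure D) (resolvent D A l ^^ k) \<le> M / (l - \<omega>) ^ k) \<and>
        (\<forall>x. ((\<lambda>l. resolvent D A l x) \<longlongrightarrow> 0) at_top))"

definition forcing_condition :: "'a::banach set \<Rightarrow> ('a \<Rightarrow> 'a) \<Rightarrow> bool" where
  "forcing_condition D A \<longleftrightarrow>
     (\<exists>\<delta>::real \<Rightarrow> real. mono_on {0..} \<delta> \<and> (\<forall>t\<ge>0. \<delta> t \<ge> 0) \<and> (\<delta> \<longlongrightarrow> 0) (at_right 0) \<and>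
        (\<forall>\<tau>>0. \<forall>f. continuous_on {0..\<tau>} f \<longrightarrow>
           (\<exists>u. continuous_on {0..\<tau>} u \<and>
              (\<forall>t\<in>{0..\<tau>}. u t \<in> closure D \<and> integral {0..t} u \<in> D \<and>
                 u t = A (integral {0..t} u) + integral {0..t} f \<and>
                 norm (u t) \<le> \<delta> t * (SUP s\<in>{0..t}. norm (f s))))))"

definition strongly_continuous :: "'a::real_normed_vector set \<Rightarrow> (real \<Rightarrow> 'a \<Rightarrow> 'b::real_normed_vector) \<Rightarrow> bool" where
  "strongly_continuous S B \<longleftrightarrow> (\<forall>x\<in>S. continuous_on UNIV (\<lambda>t. B t x))"

definition perturbation_condition ::
  "'a::real_normed_vector set \<Rightarrow> (real \<Rightarrow> 'a \<Rightarrow> 'a) \<Rightarrow> (real \<Rightarrow> real) \<Rightarrow> bool" where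
  "perturbation_condition S B b \<longleftrightarrow>
     (\<forall>t. B t \<in> bounded_ops S UNIV) \<and> strongly_continuous S B \<and>
     continuous_on UNIV b \<and> (\<forall>t. b t \<ge> 0) \<and> (\<forall>t. onorm_on S (B t) \<le> b t)"

definition evolution_family :: "'a::real_normed_vector set \<Rightarrow> (real \<Rightarrow> real \<Rightarrow> 'a \<Rightarrow> 'a) \<Rightarrow> bool" where
  "evolution_family Z U \<longleftrightarrow>
     (\<forall>t s. s \<le> t \<longrightarrow> U t s \<in> bounded_ops Z Z) \<and>
     (\<forall>t. \<forall>x\<in>Z. U t t x = x) \<and>
     (\<forall>t r s. s \<le> r \<longrightarrow> r \<le> t \<longrightarrow> (\<forall>x\<in>Z. U t r (U r s x) = U t s x)) \<and>
     (\<forall>x\<in>Z. continuous_on {(t, s). s \<le> t} (\<lambda>(t, s). U t s x))"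

definition mild_solution ::
  "'a::banach set \<Rightarrow> ('a \<Rightarrow> 'a) \<Rightarrow> (real \<Rightarrow> 'a \<Rightarrow> 'a) \<Rightarrow> real \<Rightarrow> 'a \<Rightarrow> (real \<Rightarrow> 'a) \<Rightarrow> bool" where
  "mild_solution D A B t0 x0 u \<longleftrightarrow>
     continuous_on {t0..} u \<and>
     (\<forall>t\<ge>t0. u t \<in> closure D \<and> integral {t0..t} u \<in> D \<and>
        u t = x0 + A (integral {t0..t} u) + integral {t0..t} (\<lambda>r. B r (u r)))"

definition generates_evolution_family ::
  "'a::banach set \<Rightarrow> ('a \<Rightarrow> 'a) \<Rightarrow> (real \<Rightarrow> 'a \<Rightarrow> 'a) \<Rightarrow> (real \<Rightarrow> real \<Rightarrow> 'a \<Rightarrow> 'a) \<Rightarrow> bool" where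
  "generates_evolution_family D A B U \<longleftrightarrow>
     evolution_family (closure D) U \<and>
     (\<forall>t0. \<forall>x0\<in>closure D.
        mild_solution D A B t0 x0 (\<lambda>t. U t t0 x0) \<and>
        (\<forall>v. mild_solution D A B t0 x0 v \<longrightarrow> (\<forall>t\<ge>t0. v t = U t t0 x0)))"

definition bounded_projection :: "'a::real_normed_vector set \<Rightarrow> ('a \<Rightarrow> 'a) \<Rightarrow> bool" where
  "bounded_projection Z P \<longleftrightarrow> P \<in> bounded_ops Z Z \<and> (\<forall>x\<in>Z. P (P x) = P x)"

text \<open>For \<open>s \<le> t\<close>, with \<open>Q\<close> the projections onto the unstable subspaces: the inverse of
  \<open>U t s\<close> from \<open>Q s ` Z\<close> onto \<open>Q t ` Z\<close>, precomposed with \<open>Q t\<close>.\<close>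

definition backward_evolution ::
  "'a set \<Rightarrow> (real \<Rightarrow> real \<Rightarrow> 'a \<Rightarrow> 'a) \<Rightarrow> (real \<Rightarrow> 'a \<Rightarrow> 'a) \<Rightarrow> real \<Rightarrow> real \<Rightarrow> 'a \<Rightarrow> 'a" where
  "backward_evolution Z U Q s t x = inv_into (Q s ` Z) (U t s) (Q t x)"

text \<open>Boundedness of the inverse is automatic for a closed subspace \<open>Z\<close>; it is spelled out so that
  the last bound on \<^const>\<open>onorm_on\<close> is meaningful.\<close>

definition exponential_dichotomy_with ::
  "'a::real_normed_vector set \<Rightarrow> (real \<Rightarrow> real \<Rightarrow> 'a \<Rightarrow> 'a) \<Rightarrow> real \<Rightarrow> real \<Rightarrow> bool" where
  "exponential_dichotomy_with Z U \<kappa> \<beta> \<longleftrightarrow>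
     (\<exists>P Q.
        (\<forall>t. bounded_projection Z (P t) \<and> bounded_projection Z (Q t)) \<and>
        strongly_continuous Z P \<and> strongly_continuous Z Q \<and>
        (\<forall>t. \<forall>x\<in>Z. P t x + Q t x = x) \<and>
        (\<forall>t s. s \<le> t \<longrightarrow>
           (\<forall>x\<in>Z. P t (U t s x) = U t s (P s x)) \<and>
           bij_betw (U t s) (Q s ` Z) (Q t ` Z) \<and>
           backward_evolution Z U Q s t \<in> bounded_ops Z Z \<and>
           onorm_on Z (\<lambda>x. U t s (P s x)) \<le> \<kappa> * exp (- \<beta> * (t - s)) \<and>
           onorm_on Z (backward_evolution Z U Q s t) \<le> \<kappa> * exp (- \<beta> * (t - s))))"

definition exponential_dichotomy :: "'a::real_normed_vector set \<Rightarrow> (real \<Rightarrow> real \<Rightarrow> 'a \<Rightarrow> 'a) \<Rightarrow> bool" where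
  "exponential_dichotomy Z U \<longleftrightarrow> (\<exists>\<kappa>\<ge>1. \<exists>\<beta>>0. exponential_dichotomy_with Z U \<kappa> \<beta>)"

end

theory Submission
  imports Defs
begin

text \<open>
  Only short times and a discrete argument are needed. On intervals of a fixed small length the
  forcing condition makes every perturbed problem solvable by a Neumann series, with a bound on how
  far the solution moves when the perturbation changes; uniqueness is inherited from that assumed
  for \<open>B\<close>. Comparing \<open>B\<close> with the zero perturbation, which is autonomous, shows that \<open>U\<^sub>B\<close> is
  bounded uniformly in the initial time on bounded time lengths, and comparing \<open>C\<close> with \<open>B\<close> gives
  \<open>U\<^sub>C\<close> together with \<open>\<parallel>U\<^sub>C(t,s) - U\<^sub>B(t,s)\<parallel> = O(\<epsilon>)\<close> for bounded \<open>t - s\<close>.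

  Sample at a step \<open>L\<close> so large that \<open>U\<^sub>B\<close> contracts by \<open>1/8\<close> forward on the stable and backward on
  the unstable subspaces. Bounded solutions on a grid \<open>\<theta> + L\<int>\<close> of the recursion driven by \<open>U\<^sub>C\<close> with
  a pulse \<open>z\<close> at time \<open>\<theta>\<close> are then fixed points of a contraction, in the sup norm and also in the
  norm with weight \<open>2\<^bsup>|n|\<^esup>\<close>. Hence the bounded response exists, is unique and decays geometrically.
  Its value at \<open>\<theta>\<close> defines the stable projection of \<open>U\<^sub>C\<close>, and all properties of the dichotomy follow
  from uniqueness.
\<close>

subsection \<open>Bounded operators on a subspace\<close>

text \<open>Two obstacles shape the argument. An exponential dichotomy bounds no forward growth on
  the unstable subspaces, and \<open>B\<close> depends on time, so a bound on \<open>UB\<close>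
  uniform in the initial time has to be earned; translation in time is available for
  \<open>A\<close> alone, whence the detour through the zero perturbation. Moreover the forcing
  condition supplies some solution with a bound and says nothing of other solutions, so uniqueness
  for \<open>C\<close> cannot be read off the series that gives existence.

  The pulse encodes both projections at once. If \<open>r\<close> is the bounded response to a pulse
  \<open>z\<close>, then \<open>r 0\<close> starts a decaying forward orbit, while
  \<open>r 0 - z\<close> is the endpoint of a decaying past. Thus \<open>z\<close> splits into a
  stable part \<open>r 0\<close> and an unstable part \<open>z - r 0\<close>, with no invariant
  subspace constructed beforehand. Grids with different origins are unrelated at the outset;
  uniqueness ties their responses together through the evolution family.\<close>

lemma linear_on_setD:
  assumes "linear_on_set S f"
  shows "subspace S"
    and "x \<in> S \<Longrightarrow> y \<in> S \<Longrightarrow> f (x + y) = f x + f y"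
    and "x \<in> S \<Longrightarrow> f (c *\<^sub>R x) = c *\<^sub>R f x"
    and "f 0 = 0"
    and "x \<in> S \<Longrightarrow> y \<in> S \<Longrightarrow> f (x - y) = f x - f y"
proof -
  show S: "subspace S" and add: "\<And>x y. x \<in> S \<Longrightarrow> y \<in> S \<Longrightarrow> f (x + y) = f x + f y"
    and scale: "\<And>x c. x \<in> S \<Longrightarrow> f (c *\<^sub>R x) = c *\<^sub>R f x"
    using assms unfolding linear_on_set_def by auto
  show "f 0 = 0"
    using scale[of 0 0] subspace_0[OF S] by simp
  show "f (x - y) = f x - f y" if "x \<in> S" "y \<in> S"
    using add[of x "(-1) *\<^sub>R y"] scale[of y "-1"] that subspace_neg[OF S] by simp
qed

lemma bounded_opsD:
  assumes "f \<in> bounded_ops S T"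
  shows "linear_on_set S f" and "x \<in> S \<Longrightarrow> f x \<in> T"
  using assms unfolding bounded_ops_def by auto

text \<open>An explicit constant can be composed and added without first knowing that a supremum is
  finite. A negative \<open>c\<close> forces \<open>S = {0}\<close>, so the sign of \<open>c\<close>
  has to be tracked separately.\<close>

definition bounded_by ::
  "'a::real_normed_vector set \<Rightarrow> real \<Rightarrow> ('a \<Rightarrow> 'b::real_normed_vector) \<Rightarrow> bool" where
  "bounded_by S c f \<longleftrightarrow> linear_on_set S f \<and> (\<forall>x\<in>S. norm (f x) \<le> c * norm x)"

lemma bounded_byD:
  assumes "bounded_by S c f"
  shows "linear_on_set S f" and "x \<in> S \<Longrightarrow> norm (f x) \<le> c * norm x"
  using assms unfolding bounded_by_def by auto

lemma bounded_by_mono: "bounded_by S c f \<Longrightarrow> c \<le> d \<Longrightarrow> bounded_by S d f"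
  unfolding bounded_by_def by (meson mult_right_mono norm_ge_zero order_trans)

text \<open>The quotient at \<open>x = 0\<close> is \<open>0 / 0 = 0\<close>, so the supremum is
  never negative, even on the zero space; this is where \<open>0 \<le> c\<close> matters. Membership
  in \<open>bounded_ops\<close> makes the supremum genuine.\<close>

lemma bounded_by_iff_onorm_on:
  assumes f: "f \<in> bounded_ops S T" and c: "0 \<le> c"
  shows "onorm_on S f \<le> c \<longleftrightarrow> bounded_by S c f"
proof -
  obtain K where K: "\<And>x. x \<in> S \<Longrightarrow> norm (f x) \<le> K * norm x"
    using f unfolding bounded_ops_def by auto
  have S: "subspace S" and f0: "f 0 = 0"
    using linear_on_setD[OF bounded_opsD(1)[OF f]] by auto
  have ne: "S \<noteq> {}"
    using subspace_0[OF S] by auto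
  have quot: "norm (f x) / norm x \<le> d" if "x \<in> S" "norm (f x) \<le> d * norm x" "0 \<le> d" for x d
    using that by (cases "x = 0") (auto simp: divide_le_eq)
  have bdd: "bdd_above ((\<lambda>x. norm (f x) / norm x) ` S)"
  proof (rule bdd_aboveI2)
    show "norm (f x) / norm x \<le> \<bar>K\<bar>" if "x \<in> S" for x
      using quot[OF that, of "\<bar>K\<bar>"] K[OF that]
      by (meson abs_ge_self abs_ge_zero mult_right_mono norm_ge_zero order_trans)
  qed
  have "bounded_by S c f" if le: "onorm_on S f \<le> c"
  proof -
    have "norm (f x) \<le> c * norm x" if x: "x \<in> S" for x
    proof (cases "x = 0")
      case False
      have "norm (f x) / norm x \<le> c"
        using cSUP_upper[OF x bdd] le unfolding onorm_on_def by simp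
      with False show ?thesis by (simp add: divide_le_eq)
    qed (simp add: f0)
    then show ?thesis
      using bounded_opsD(1)[OF f] unfolding bounded_by_def by auto
  qed
  moreover have "onorm_on S f \<le> c" if "bounded_by S c f"
    unfolding onorm_on_def
    by (rule cSUP_least[OF ne]) (use quot c bounded_byD(2)[OF that] in auto)
  ultimately show ?thesis by blast
qed

lemma bounded_by_imp_bounded_ops:
  "bounded_by S c f \<Longrightarrow> (\<And>x. x \<in> S \<Longrightarrow> f x \<in> T) \<Longrightarrow> f \<in> bounded_ops S T"
  unfolding bounded_by_def bounded_ops_def by auto

lemma bounded_ops_imp_bounded_by: "f \<in> bounded_ops S T \<Longrightarrow> \<exists>c. bounded_by S c f"
  unfolding bounded_by_def bounded_ops_def by auto

lemma bounded_by_cong: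
  assumes "bounded_by S c f" "\<And>x. x \<in> S \<Longrightarrow> f x = g x"
  shows "bounded_by S c g"
proof -
  have "subspace S" using linear_on_setD(1)[OF bounded_byD(1)[OF assms(1)]] .
  then show ?thesis
    using assms(1) unfolding bounded_by_def linear_on_set_def
    by (simp add: subspace_add subspace_scale assms(2)[symmetric])
qed

lemma bounded_by_comp:
  assumes f: "bounded_by S c f" and g: "bounded_by T d g"
    and im: "\<And>x. x \<in> S \<Longrightarrow> f x \<in> T" and d: "0 \<le> d"
  shows "bounded_by S (d * c) (\<lambda>x. g (f x))"
  unfolding bounded_by_def linear_on_set_def
proof (intro conjI ballI allI)
  note F = linear_on_setD[OF bounded_byD(1)[OF f]] and G = linear_on_setD[OF bounded_byD(1)[OF g]]
  show "subspace S" by (rule F(1))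
  show "g (f (x + y)) = g (f x) + g (f y)" if "x \<in> S" "y \<in> S" for x y
    using that F(2) G(2) im by simp
  show "g (f (a *\<^sub>R x)) = a *\<^sub>R g (f x)" if "x \<in> S" for x a
    using that F(3) G(3) im by simp
  show "norm (g (f x)) \<le> d * c * norm x" if "x \<in> S" for x
  proof -
    have "norm (g (f x)) \<le> d * norm (f x)"
      using bounded_byD(2)[OF g im[OF that]] .
    also have "\<dots> \<le> d * (c * norm x)"
      using bounded_byD(2)[OF f that] d by (rule mult_left_mono)
    finally show ?thesis by simp
  qed
qed

lemma bounded_by_diff:
  assumes f: "bounded_by S c f" and g: "bounded_by S d g"
  shows "bounded_by S (c + d) (\<lambda>x. f x - g x)"
  unfolding bounded_by_def linear_on_set_def
proof (intro conjI ballI allI)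
  note F = linear_on_setD[OF bounded_byD(1)[OF f]] and G = linear_on_setD[OF bounded_byD(1)[OF g]]
  show "subspace S" by (rule F(1))
  show "norm (f x - g x) \<le> (c + d) * norm x" if "x \<in> S" for x
    using norm_triangle_ineq4[of "f x" "g x"] bounded_byD(2)[OF f that] bounded_byD(2)[OF g that]
    by (simp add: distrib_right)
qed (use linear_on_setD[OF bounded_byD(1)[OF f]] linear_on_setD[OF bounded_byD(1)[OF g]]
    in \<open>auto simp: algebra_simps\<close>)

lemma bounded_by_minus:
  "bounded_by S c f \<Longrightarrow> bounded_by S c (\<lambda>x. - f x)"
  unfolding bounded_by_def linear_on_set_def by auto

text \<open>Equiboundedness upgrades strong convergence at the fixed point \<open>x\<close> to
  convergence along moving arguments: the error \<open>f t (u t) - f t x\<close> is at most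
  \<open>c * norm (u t - x)\<close>.\<close>

lemma bounded_by_tendsto:
  assumes bd: "eventually (\<lambda>t. bounded_by S c (f t)) F"
    and lim: "((\<lambda>t. f t x) \<longlongrightarrow> y) F"
    and u: "(u \<longlongrightarrow> x) F" "eventually (\<lambda>t. u t \<in> S) F" and x: "x \<in> S"
  shows "((\<lambda>t. f t (u t)) \<longlongrightarrow> y) F"
proof -
  have "((\<lambda>t. norm (u t - x)) \<longlongrightarrow> 0) F"
    using u(1) by (simp add: LIM_zero tendsto_norm_zero)
  then have lim0: "((\<lambda>t. c * norm (u t - x)) \<longlongrightarrow> 0) F"
    by (rule tendsto_mult_right_zero)
  have "eventually (\<lambda>t. norm (f t (u t) - f t x) \<le> c * norm (u t - x)) F"
    using bd u(2)
  proof eventually_elim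
    case (elim t)
    note L = linear_on_setD[OF bounded_byD(1)[OF elim(1)]]
    show ?case
      using bounded_byD(2)[OF elim(1), of "u t - x"] L(5) elim(2) x subspace_diff[OF L(1)] by simp
  qed
  then have "((\<lambda>t. f t (u t) - f t x) \<longlongrightarrow> 0) F"
    by (rule Lim_null_comparison) (rule lim0)
  from tendsto_add[OF this lim] show ?thesis by simp
qed

lemma bounded_by_tendsto_const:
  assumes "bounded_by S c f" "(u \<longlongrightarrow> x) F" "eventually (\<lambda>t. u t \<in> S) F" "x \<in> S"
  shows "((\<lambda>t. f (u t)) \<longlongrightarrow> f x) F"
  by (rule bounded_by_tendsto[where f = "\<lambda>_. f" and S = S and c = c]) (use assms in auto)

lemma continuous_on_bounded_by:
  assumes bd: "\<And>t. t \<in> T \<Longrightarrow> bounded_by S c (f t)"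
    and f: "\<And>x. x \<in> S \<Longrightarrow> continuous_on T (\<lambda>t. f t x)"
    and u: "continuous_on T u" "\<And>t. t \<in> T \<Longrightarrow> u t \<in> S"
  shows "continuous_on T (\<lambda>t. f t (u t))"
  unfolding continuous_on_def
proof
  fix t assume t: "t \<in> T"
  show "((\<lambda>t. f t (u t)) \<longlongrightarrow> f t (u t)) (at t within T)"
  proof (rule bounded_by_tendsto[where S = S and c = c and x = "u t"])
    show "\<forall>\<^sub>F t in at t within T. bounded_by S c (f t)" "\<forall>\<^sub>F t in at t within T. u t \<in> S"
      using bd u(2) by (auto simp: eventually_at_filter)
    show "((\<lambda>s. f s (u t)) \<longlongrightarrow> f t (u t)) (at t within T)" "(u \<longlongrightarrow> u t) (at t within T)"
      using f[OF u(2)[OF t]] u(1) t by (auto simp: continuous_on_def)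
  qed (use u t in auto)
qed

text \<open>The uniform boundedness principle for operators on a closed set that is not a type of
  its own. Baire's theorem in the subspace topology gives one of the closed sets \<open>E n\<close>
  a relative interior point, and linearity spreads the bound found there over all of
  \<open>S\<close>.\<close>

lemma uniform_bound_on_subspace:
  fixes f :: "'i \<Rightarrow> 'a::banach \<Rightarrow> 'b::real_normed_vector"
  assumes S: "closed S" and f: "\<And>i. i \<in> I \<Longrightarrow> f i \<in> bounded_ops S UNIV" and I: "I \<noteq> {}"
    and pw: "\<And>x. x \<in> S \<Longrightarrow> \<exists>K. \<forall>i\<in>I. norm (f i x) \<le> K"
  shows "\<exists>K. \<forall>i\<in>I. bounded_by S K (f i)"
proof -
  obtain i0 where i0: "i0 \<in> I" using I by auto
  have sub: "subspace S" by (rule linear_on_setD(1)[OF bounded_opsD(1)[OF f[OF i0]]])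
  define E where "E n = {x \<in> S. \<forall>i\<in>I. norm (f i x) \<le> real n}" for n :: nat
  have contf: "continuous_on S (f i)" if i: "i \<in> I" for i
  proof -
    obtain K where "bounded_by S K (f i)"
      using f[OF i] unfolding bounded_ops_def bounded_by_def by auto
    then show ?thesis
      by (intro continuous_on_bounded_by[where f = "\<lambda>_. f i" and u = "\<lambda>x. x", simplified])
         (auto intro: continuous_intros)
  qed
  have E_eq: "E n = S \<inter> (\<Inter>i\<in>I. S \<inter> f i -` cball 0 (real n))" for n
    unfolding E_def by auto
  have closedE: "closed (E n)" for n
    unfolding E_eq
    by (intro closed_Int S closed_INT ballI continuous_closed_preimage contf) auto
  have cm: "completely_metrizable_space (top_of_set S)"
    by (simp add: S completely_metrizable_space_closedin completely_metrizable_space_euclidean)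
  have "\<exists>n. (top_of_set S) interior_of (E n) \<noteq> {}"
  proof (rule ccontr)
    assume neg: "\<not> ?thesis"
    have "(top_of_set S) interior_of \<Union>(range E) = {}"
    proof (rule Baire_category_alt)
      show "countable (range E)" by simp
      show "closedin (top_of_set S) T \<and> top_of_set S interior_of T = {}" if "T \<in> range E" for T
        using that neg closedE by (auto intro!: closed_subset simp: E_def)
    qed (use cm in auto)
    moreover have "\<Union>(range E) = S"
    proof -
      have "x \<in> \<Union>(range E)" if "x \<in> S" for x
      proof -
        obtain K where K: "\<forall>i\<in>I. norm (f i x) \<le> K" using pw[OF \<open>x \<in> S\<close>] by auto
        obtain n where "K \<le> real n" using real_arch_simple by blast
        with K that have "x \<in> E n" unfolding E_def by (auto intro: order_trans)
        then show ?thesis by blast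
      qed
      then show ?thesis unfolding E_def by auto
    qed
    ultimately have "S = {}"
      using interior_of_topspace[of "top_of_set S"] by simp
    then show False using subspace_0[OF sub] by auto
  qed
  then obtain n x where "x \<in> (top_of_set S) interior_of (E n)" by auto
  then obtain V where "openin (top_of_set S) V" "x \<in> V" "V \<subseteq> E n"
    unfolding interior_of_def by auto
  then obtain e where xS: "x \<in> S" and e: "0 < e" "\<And>y. y \<in> S \<Longrightarrow> dist y x < e \<Longrightarrow> y \<in> E n"
    unfolding openin_euclidean_subtopology_iff by (metis subset_eq)
  have "norm (f i y) \<le> 4 * real n / e * norm y" if i: "i \<in> I" and y: "y \<in> S" for i y
  proof (cases "y = 0")
    case True
    then show ?thesis using linear_on_setD(4)[OF bounded_opsD(1)[OF f[OF i]]] by simp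
  next
    case False
    note L = linear_on_setD[OF bounded_opsD(1)[OF f[OF i]]]
    \<comment> \<open>Scaling by \<open>a\<close> brings \<open>y\<close> to length
      \<open>e / 2\<close>, so \<open>x\<close> moved by it stays in the ball. Two values of norm at
      most \<open>n\<close> differ by at most \<open>2 * n\<close>, and division by \<open>a\<close>
      gives \<open>4 * n / e\<close>.\<close>
    define a where "a = e / (2 * norm y)"
    have a: "a > 0" using e False unfolding a_def by simp
    have ay: "a *\<^sub>R y \<in> S" using y sub by (simp add: subspace_scale)
    then have xay: "x + a *\<^sub>R y \<in> S" using xS sub by (simp add: subspace_add)
    have "dist (x + a *\<^sub>R y) x < e"
      using a e False by (simp add: dist_norm) (simp add: a_def)
    then have 1: "norm (f i (x + a *\<^sub>R y)) \<le> real n"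
      using e(2)[OF xay] i unfolding E_def by auto
    have 2: "norm (f i x) \<le> real n"
      using e(2)[OF xS] e(1) i unfolding E_def by auto
    have "a *\<^sub>R f i y = f i (x + a *\<^sub>R y) - f i x"
      using L(2)[OF xS ay] L(3)[OF y] by simp
    then have "norm (a *\<^sub>R f i y) \<le> 2 * real n"
      using norm_triangle_ineq4[of "f i (x + a *\<^sub>R y)" "f i x"] 1 2 by simp
    then have "norm (f i y) \<le> 2 * real n / a"
      using a by (simp add: pos_le_divide_eq mult.commute)
    also have "\<dots> = 4 * real n / e * norm y"
      unfolding a_def by simp
    finally show ?thesis .
  qed
  then show ?thesis
    using bounded_opsD(1)[OF f] unfolding bounded_by_def
    by (intro exI[of _ "4 * real n / e"]) auto
qed

subsection \<open>Integrated solutions\<close>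

lemma subspace_closure:
  fixes S :: "'a::real_normed_vector set"
  assumes "subspace S"
  shows "subspace (closure S)"
  unfolding subspace_def
proof (intro conjI ballI allI)
  show "0 \<in> closure S"
    using subspace_0[OF assms] closure_subset by blast
  show "x + y \<in> closure S" if x: "x \<in> closure S" and y: "y \<in> closure S" for x y
  proof -
    obtain f g where "\<forall>n. f n \<in> S" "f \<longlonglongrightarrow> x" "\<forall>n. g n \<in> S" "g \<longlonglongrightarrow> y"
      using x y unfolding closure_sequential by auto
    then have "\<forall>n. f n + g n \<in> S" "(\<lambda>n. f n + g n) \<longlonglongrightarrow> x + y"
      using subspace_add[OF assms] tendsto_add by auto
    then show ?thesis unfolding closure_sequential by (intro exI[of _ "\<lambda>n. f n + g n"]) simp
  qed
  show "c *\<^sub>R x \<in> closure S" if x: "x \<in> closure S" for x c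
  proof -
    obtain f where "\<forall>n. f n \<in> S" "f \<longlonglongrightarrow> x"
      using x unfolding closure_sequential by auto
    then have "\<forall>n. c *\<^sub>R f n \<in> S" "(\<lambda>n. c *\<^sub>R f n) \<longlonglongrightarrow> c *\<^sub>R x"
      using subspace_scale[OF assms] by (auto intro: tendsto_intros)
    then show ?thesis unfolding closure_sequential by (intro exI[of _ "\<lambda>n. c *\<^sub>R f n"]) simp
  qed
qed

text \<open>The inhomogeneity \<open>g\<close> does not refer to \<open>u\<close>: a forced problem
  has \<open>x = 0\<close>, a perturbed one has \<open>g r = C r (u r)\<close>, and a Neumann series
  puts the previous term into \<open>g\<close>. On compact intervals solutions can be cut, glued and
  passed to uniform limits.\<close>

definition integrated_solution ::
  "'a::banach set \<Rightarrow> ('a \<Rightarrow> 'a) \<Rightarrow> real \<Rightarrow> real \<Rightarrow> 'a \<Rightarrow> (real \<Rightarrow> 'a) \<Rightarrow> (real \<Rightarrow> 'a) \<Rightarrow> bool" where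
  "integrated_solution D A t0 t1 x g u \<longleftrightarrow>
     continuous_on {t0..t1} u \<and>
     (\<forall>t\<in>{t0..t1}. u t \<in> closure D \<and> integral {t0..t} u \<in> D \<and>
        u t = x + A (integral {t0..t} u) + integral {t0..t} g)"

lemma integrated_solutionD:
  assumes "integrated_solution D A t0 t1 x g u"
  shows "continuous_on {t0..t1} u"
    and "t \<in> {t0..t1} \<Longrightarrow> u t \<in> closure D"
    and "t \<in> {t0..t1} \<Longrightarrow> integral {t0..t} u \<in> D"
    and "t \<in> {t0..t1} \<Longrightarrow> u t = x + A (integral {t0..t} u) + integral {t0..t} g"
  using assms unfolding integrated_solution_def by blast+

lemma integrable_on_initial_segment:
  fixes u :: "real \<Rightarrow> 'a::banach"
  assumes "continuous_on {t0..t1} u" "t \<in> {t0..t1}"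
  shows "u integrable_on {t0..t}"
  using assms by (intro integrable_continuous_real) (auto elim: continuous_on_subset)

lemma mild_solution_iff_integrated_solution:
  "mild_solution D A B t0 x u \<longleftrightarrow>
     (\<forall>t1\<ge>t0. integrated_solution D A t0 t1 x (\<lambda>r. B r (u r)) u)"
proof
  assume "mild_solution D A B t0 x u"
  then show "\<forall>t1\<ge>t0. integrated_solution D A t0 t1 x (\<lambda>r. B r (u r)) u"
    unfolding mild_solution_def integrated_solution_def
    by (auto elim: continuous_on_subset)
next
  assume sol: "\<forall>t1\<ge>t0. integrated_solution D A t0 t1 x (\<lambda>r. B r (u r)) u"
  have "continuous_on {t0..} u"
    unfolding continuous_on_eq_continuous_within
  proof
    fix t assume t: "t \<in> {t0..}"
    have "continuous_on {t0..t + 1} u"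
      using sol t by (intro integrated_solutionD(1)[of D A t0 "t + 1" x "\<lambda>r. B r (u r)" u]) auto
    then have "continuous (at t within {t0..t + 1}) u"
      using t by (simp add: continuous_on_eq_continuous_within)
    moreover have "at t within {t0..t + 1} = at t within {t0..}"
      using t by (intro at_within_nhd[of t "{..<t + 1}"]) auto
    ultimately show "continuous (at t within {t0..}) u" by simp
  qed
  then show "mild_solution D A B t0 x u"
    using sol unfolding mild_solution_def integrated_solution_def by fastforce
qed

lemma integrated_solution_cong:
  assumes "integrated_solution D A t0 t1 x g u"
    and u: "\<And>t. t \<in> {t0..t1} \<Longrightarrow> u t = u' t" and g: "\<And>t. t \<in> {t0..t1} \<Longrightarrow> g t = g' t"
  shows "integrated_solution D A t0 t1 x g' u'"
proof -
  have "integral {t0..t} u = integral {t0..t} u'" "integral {t0..t} g = integral {t0..t} g'"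
    if "t \<in> {t0..t1}" for t
    using that by (auto intro!: integral_cong u g)
  moreover have "continuous_on {t0..t1} u'"
    using continuous_on_eq[OF integrated_solutionD(1)[OF assms(1)] u] .
  ultimately show ?thesis
    using assms(1) u unfolding integrated_solution_def by auto
qed

lemma integrated_solution_subinterval:
  assumes "integrated_solution D A t0 t1 x g u" "t2 \<le> t1"
  shows "integrated_solution D A t0 t2 x g u"
  using integrated_solutionD[OF assms(1)] continuous_on_subset[of "{t0..t1}" u "{t0..t2}"] assms(2)
  unfolding integrated_solution_def by fastforce

text \<open>\<open>A\<close> is the same at all times, so its equation is invariant under
  translation. This carries the forcing condition, posed at time 0, to every initial time.\<close>

lemma integrated_solution_shift:
  assumes "integrated_solution D A a b x g u"
  shows "integrated_solution D A (a + c) (b + c) x (\<lambda>r. g (r - c)) (\<lambda>r. u (r - c))"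
proof -
  have shift: "integral {a + c..t} (\<lambda>r. f (r - c)) = integral {a..t - c} f" for f :: "real \<Rightarrow> 'a" and t
    using integral_shift_Icc_real[of a "t - c" "\<lambda>r. f (r - c)" c] by (simp add: comp_def)
  have "continuous_on {a + c..b + c} (\<lambda>r. u (r - c))"
    by (rule continuous_on_compose2[OF integrated_solutionD(1)[OF assms]])
       (auto intro!: continuous_intros)
  then show ?thesis
    using integrated_solutionD(2-4)[OF assms] unfolding integrated_solution_def shift by auto
qed

context
  fixes D :: "'a::banach set" and A :: "'a \<Rightarrow> 'a"
  assumes linear: "linear_on_set D A"
begin

lemmas A_linear = linear_on_setD[OF linear]

lemma closure_D_subspace: "subspace (closure D)"
  by (rule subspace_closure[OF A_linear(1)])

lemma integrated_solution_initial:
  assumes "integrated_solution D A t0 t1 x g u" "t0 \<le> t1"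
  shows "u t0 = x" "x \<in> closure D"
  using integrated_solutionD(2,4)[OF assms(1), of t0] assms(2) A_linear(4) by auto

lemma integrated_solution_add:
  assumes u: "integrated_solution D A t0 t1 x g u" and v: "integrated_solution D A t0 t1 y k v"
    and g: "continuous_on {t0..t1} g" and k: "continuous_on {t0..t1} k"
  shows "integrated_solution D A t0 t1 (x + y) (\<lambda>r. g r + k r) (\<lambda>r. u r + v r)"
  unfolding integrated_solution_def
proof (intro conjI ballI)
  note U = integrated_solutionD[OF u] and V = integrated_solutionD[OF v]
  show "continuous_on {t0..t1} (\<lambda>r. u r + v r)"
    by (intro continuous_intros U V)
  fix t assume t: "t \<in> {t0..t1}"
  show "u t + v t \<in> closure D"
    using U(2) V(2) t closure_D_subspace by (simp add: subspace_add)
  have eq: "integral {t0..t} (\<lambda>r. u r + v r) = integral {t0..t} u + integral {t0..t} v"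
    "integral {t0..t} (\<lambda>r. g r + k r) = integral {t0..t} g + integral {t0..t} k"
    by (intro integral_add integrable_on_initial_segment[OF _ t] U V g k)+
  show "integral {t0..t} (\<lambda>r. u r + v r) \<in> D"
    unfolding eq using U(3) V(3) t A_linear(1) by (simp add: subspace_add)
  show "u t + v t = x + y + A (integral {t0..t} (\<lambda>r. u r + v r)) + integral {t0..t} (\<lambda>r. g r + k r)"
    unfolding eq A_linear(2)[OF U(3)[OF t] V(3)[OF t]] U(4)[OF t] V(4)[OF t] by simp
qed

lemma integrated_solution_scale:
  assumes u: "integrated_solution D A t0 t1 x g u"
  shows "integrated_solution D A t0 t1 (c *\<^sub>R x) (\<lambda>r. c *\<^sub>R g r) (\<lambda>r. c *\<^sub>R u r)"
  unfolding integrated_solution_def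
proof (intro conjI ballI)
  note U = integrated_solutionD[OF u]
  show "continuous_on {t0..t1} (\<lambda>r. c *\<^sub>R u r)"
    by (intro continuous_intros U)
  fix t assume t: "t \<in> {t0..t1}"
  show "c *\<^sub>R u t \<in> closure D" "integral {t0..t} (\<lambda>r. c *\<^sub>R u r) \<in> D"
    using U(2,3) t closure_D_subspace A_linear(1) by (simp_all add: subspace_scale)
  show "c *\<^sub>R u t = c *\<^sub>R x + A (integral {t0..t} (\<lambda>r. c *\<^sub>R u r)) + integral {t0..t} (\<lambda>r. c *\<^sub>R g r)"
    by (simp add: A_linear(3)[OF U(3)[OF t]] U(4)[OF t] scaleR_add_right)
qed

lemma integrated_solution_diff:
  assumes u: "integrated_solution D A t0 t1 x g u" and v: "integrated_solution D A t0 t1 y k v"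
    and g: "continuous_on {t0..t1} g" and k: "continuous_on {t0..t1} k"
  shows "integrated_solution D A t0 t1 (x - y) (\<lambda>r. g r - k r) (\<lambda>r. u r - v r)"
  using integrated_solution_add[OF u integrated_solution_scale[OF v, of "-1"] g] k
  by (simp add: continuous_on_minus)

lemma integrated_solution_restart:
  assumes u: "integrated_solution D A t0 t1 x g u" and g: "continuous_on {t0..t1} g"
    and r: "t0 \<le> r" "r \<le> t1"
  shows "integrated_solution D A r t1 (u r) g u"
  unfolding integrated_solution_def
proof (intro conjI ballI)
  note U = integrated_solutionD[OF u]
  show "continuous_on {r..t1} u"
    using U(1) r by (auto elim: continuous_on_subset)
  fix t assume t: "t \<in> {r..t1}"
  have t': "t \<in> {t0..t1}" and r': "r \<in> {t0..t1}" using t r by auto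
  have eq: "integral {r..t} f = integral {t0..t} f - integral {t0..r} f"
    if "continuous_on {t0..t1} f" for f :: "real \<Rightarrow> 'a"
    using Henstock_Kurzweil_Integration.integral_combine[OF r(1) _ integrable_on_initial_segment[OF that t']] t
    by (simp add: algebra_simps)
  show "u t \<in> closure D" using U(2)[OF t'] .
  show "integral {r..t} u \<in> D"
    unfolding eq[OF U(1)] using U(3)[OF t'] U(3)[OF r'] A_linear(1) by (simp add: subspace_diff)
  show "u t = u r + A (integral {r..t} u) + integral {r..t} g"
    unfolding eq[OF U(1)] eq[OF g] A_linear(5)[OF U(3)[OF t'] U(3)[OF r']]
      U(4)[OF t'] U(4)[OF r'] by simp
qed

lemma integrated_solution_glue:
  assumes u: "integrated_solution D A t0 r x g u" and v: "integrated_solution D A r t1 (u r) g u"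
    and g: "continuous_on {t0..t1} g" and r: "t0 \<le> r" "r \<le> t1"
  shows "integrated_solution D A t0 t1 x g u"
  unfolding integrated_solution_def
proof (intro conjI ballI)
  note U = integrated_solutionD[OF u] and V = integrated_solutionD[OF v]
  have "{t0..t1} = {t0..r} \<union> {r..t1}" using r by auto
  then show cont: "continuous_on {t0..t1} u"
    using continuous_on_closed_Un[OF _ _ U(1) V(1)] by simp
  fix t assume t: "t \<in> {t0..t1}"
  have "u t \<in> closure D \<and> integral {t0..t} u \<in> D \<and> u t = x + A (integral {t0..t} u) + integral {t0..t} g"
  proof (cases "t \<le> r")
    case True
    then show ?thesis using U(2-4)[of t] t by auto
  next
    case False
    then have tr: "t \<in> {r..t1}" and r': "r \<in> {t0..r}" using t r by auto
    have eq: "integral {t0..t} f = integral {t0..r} f + integral {r..t} f"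
      if "continuous_on {t0..t1} f" for f :: "real \<Rightarrow> 'a"
      using Henstock_Kurzweil_Integration.integral_combine[OF r(1) _ integrable_on_initial_segment[OF that t]] tr by simp
    show ?thesis
      unfolding eq[OF cont] eq[OF g] A_linear(2)[OF U(3)[OF r'] V(3)[OF tr]] V(4)[OF tr]
      using V(2)[OF tr] U(4)[OF r'] U(3)[OF r'] V(3)[OF tr] A_linear(1) V(4)[OF tr]
      by (simp add: subspace_add)
  qed
  then show "u t \<in> closure D" "integral {t0..t} u \<in> D"
    "u t = x + A (integral {t0..t} u) + integral {t0..t} g" by auto
qed

end

text \<open>Uniform convergence passes through the integrals, and the equation itself then shows
  that \<open>A (integral {t0..t} (u n))\<close> converges. Closedness of the graph gives both
  membership in \<open>D\<close> and the limit equation.\<close>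

lemma integrated_solution_uniform_limit:
  assumes closed_graph: "\<And>X x y. (\<And>n::nat. X n \<in> D) \<Longrightarrow> X \<longlonglongrightarrow> x \<Longrightarrow> (\<lambda>n. A (X n)) \<longlonglongrightarrow> y \<Longrightarrow>
      x \<in> D \<and> A x = y"
    and sol: "\<And>n. integrated_solution D A t0 t1 x (g n) (u n)"
    and g: "\<And>n. continuous_on {t0..t1} (g n)"
    and ug: "uniform_limit {t0..t1} g g' sequentially"
    and uu: "uniform_limit {t0..t1} u u' sequentially"
  shows "integrated_solution D A t0 t1 x g' u'"
  unfolding integrated_solution_def
proof (intro conjI ballI)
  note U = integrated_solutionD[OF sol]
  show "continuous_on {t0..t1} u'"
    by (rule uniform_limit_theorem[OF _ uu]) (auto intro: always_eventually U)
  fix t assume t: "t \<in> {t0..t1}"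
  have lim: "(\<lambda>n. integral {t0..t} (f n)) \<longlonglongrightarrow> integral {t0..t} f'"
    if f: "\<And>n. continuous_on {t0..t1} (f n)" and ul: "uniform_limit {t0..t1} f f' sequentially"
    for f :: "nat \<Rightarrow> real \<Rightarrow> 'a" and f'
  proof -
    have sub: "{t0..t} \<subseteq> {t0..t1}" using t by auto
    obtain I J where I: "\<And>n. (f n has_integral I n) {t0..t}" and J: "(f' has_integral J) {t0..t}"
      and IJ: "I \<longlonglongrightarrow> J"
      using uniform_limit_integral[OF uniform_limit_on_subset[OF ul sub]
          continuous_on_subset[OF f sub] sequentially_bot] by blast
    have "(\<lambda>n. integral {t0..t} (f n)) = I" "integral {t0..t} f' = J"
      using integral_unique[OF I] integral_unique[OF J] by auto
    with IJ show ?thesis by simp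
  qed
  have ut: "(\<lambda>n. u n t) \<longlonglongrightarrow> u' t"
    by (rule tendsto_uniform_limitI[OF uu t])
  show "u' t \<in> closure D"
    by (rule closed_sequentially[OF closed_closure U(2)[OF t] ut])
  have "(\<lambda>n. u n t - x - integral {t0..t} (g n)) \<longlonglongrightarrow> u' t - x - integral {t0..t} g'"
    by (rule tendsto_diff[OF tendsto_diff[OF ut tendsto_const] lim[OF g ug]])
  moreover have "u n t - x - integral {t0..t} (g n) = A (integral {t0..t} (u n))" for n
    using U(4)[OF t, of n] by (simp add: algebra_simps)
  ultimately have "(\<lambda>n. A (integral {t0..t} (u n))) \<longlonglongrightarrow> u' t - x - integral {t0..t} g'"
    by simp
  from closed_graph[OF U(3)[OF t] lim[OF U(1) uu] this]
  show "integral {t0..t} u' \<in> D" "u' t = x + A (integral {t0..t} u') + integral {t0..t} g'"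
    by auto
qed

section \<open>Short-time solvability under bounded perturbations\<close>

definition bounded_family ::
  "'a::real_normed_vector set \<Rightarrow> real \<Rightarrow> (real \<Rightarrow> 'a \<Rightarrow> 'b::real_normed_vector) \<Rightarrow> bool" where
  "bounded_family S c C \<longleftrightarrow> 0 \<le> c \<and> (\<forall>t. bounded_by S c (C t)) \<and> strongly_continuous S C"

lemma bounded_familyD:
  assumes "bounded_family S c C"
  shows "0 \<le> c" "bounded_by S c (C t)" "linear_on_set S (C t)" "x \<in> S \<Longrightarrow> norm (C t x) \<le> c * norm x"
  using assms unfolding bounded_family_def bounded_by_def by auto

lemma bounded_family_continuous_on:
  assumes "bounded_family S c C" "continuous_on T u" "\<And>t. t \<in> T \<Longrightarrow> u t \<in> S"
  shows "continuous_on T (\<lambda>t. C t (u t))"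
proof (rule continuous_on_bounded_by[OF bounded_familyD(2)[OF assms(1)] _ assms(2,3)])
  show "continuous_on T (\<lambda>t. C t x)" if "x \<in> S" for x
    using assms(1) that unfolding bounded_family_def strongly_continuous_def
    by (blast intro: continuous_on_subset[of UNIV])
qed

locale forced_problem =
  fixes D :: "'a::banach set" and A :: "'a \<Rightarrow> 'a" and \<delta> :: "real \<Rightarrow> real"
  assumes linear: "linear_on_set D A"
    and closed_graph: "\<And>X x y. (\<And>n::nat. X n \<in> D) \<Longrightarrow> X \<longlonglongrightarrow> x \<Longrightarrow> (\<lambda>n. A (X n)) \<longlonglongrightarrow> y \<Longrightarrow>
      x \<in> D \<and> A x = y"
    and \<delta>_mono: "0 \<le> s \<Longrightarrow> s \<le> t \<Longrightarrow> \<delta> s \<le> \<delta> t"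
    and \<delta>_nonneg: "0 \<le> t \<Longrightarrow> 0 \<le> \<delta> t"
    and \<delta>_lim: "(\<delta> \<longlongrightarrow> 0) (at_right 0)"
    and forcing: "0 < h \<Longrightarrow> continuous_on {0..h} f \<Longrightarrow>
      \<exists>u. integrated_solution D A 0 h 0 f u \<and>
          (\<forall>t\<in>{0..h}. norm (u t) \<le> \<delta> t * (SUP s\<in>{0..t}. norm (f s)))"
begin

abbreviation "Z \<equiv> closure D"

lemma Z_subspace: "subspace Z"
  by (rule closure_D_subspace[OF linear])

lemma forced_solution_A:
  assumes h: "0 < h" and f: "continuous_on {t0..t0 + h} f"
    and M: "\<And>t. t \<in> {t0..t0 + h} \<Longrightarrow> norm (f t) \<le> M"
  obtains u where "integrated_solution D A t0 (t0 + h) 0 f u"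
    "\<And>t. t \<in> {t0..t0 + h} \<Longrightarrow> norm (u t) \<le> \<delta> h * M"
proof -
  have "continuous_on {0..h} (\<lambda>r. f (r + t0))"
    by (rule continuous_on_compose2[OF f]) (auto intro!: continuous_intros)
  from forcing[OF h this] obtain u where u: "integrated_solution D A 0 h 0 (\<lambda>r. f (r + t0)) u"
    and bd: "\<And>t. t \<in> {0..h} \<Longrightarrow> norm (u t) \<le> \<delta> t * (SUP s\<in>{0..t}. norm (f (s + t0)))"
    by blast
  have "norm (u t) \<le> \<delta> h * M" if t: "t \<in> {0..h}" for t
  proof -
    have S: "(SUP s\<in>{0..t}. norm (f (s + t0))) \<le> M"
      by (rule cSUP_least) (use t M in auto)
    have "norm (f t0) \<le> M" using M[of t0] h by simp
    then have M0: "0 \<le> M" by (meson norm_ge_zero order_trans)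
    have "\<delta> t * (SUP s\<in>{0..t}. norm (f (s + t0))) \<le> \<delta> t * M"
      by (rule mult_left_mono[OF S]) (use \<delta>_nonneg t in auto)
    also have "\<dots> \<le> \<delta> h * M"
      by (rule mult_right_mono[OF _ M0]) (use \<delta>_mono t in auto)
    finally show ?thesis using bd[OF t] by simp
  qed
  moreover have "integrated_solution D A t0 (t0 + h) 0 f (\<lambda>r. u (r - t0))"
    using integrated_solution_shift[OF u, of t0] by (simp add: add.commute)
  ultimately show ?thesis
    using that[of "\<lambda>r. u (r - t0)"] by auto
qed

text \<open>A Neumann series; since solutions of the forced problem for \<open>A\<close> are not known to be unique
  at this point, its terms are chosen one after the other.\<close>

lemma forced_solution:
  assumes h: "0 < h" and C: "bounded_family Z c C" and small: "\<delta> h * c \<le> 1/2"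
    and g: "continuous_on {t0..t0 + h} g"
    and M: "\<And>t. t \<in> {t0..t0 + h} \<Longrightarrow> norm (g t) \<le> M"
  obtains w where "integrated_solution D A t0 (t0 + h) 0 (\<lambda>r. C r (w r) + g r) w"
    "\<And>t. t \<in> {t0..t0 + h} \<Longrightarrow> norm (w t) \<le> 2 * \<delta> h * M"
proof -
  let ?I = "{t0..t0 + h}"
  note CD = bounded_familyD[OF C]
  \<comment> \<open>Dependent choice makes every term carry what its successor uses: continuity,
    values in \<open>Z\<close>, a geometric bound. The clause for \<open>n = 0\<close> keeps the
    equation of the initial term, which no predecessor supplies.\<close>
  define P where "P n w \<longleftrightarrow> continuous_on ?I w \<and>
    (\<forall>t\<in>?I. w t \<in> Z \<and> norm (w t) \<le> \<delta> h * M * (1/2) ^ n) \<and>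
    (n = 0 \<longrightarrow> integrated_solution D A t0 (t0 + h) 0 g w)" for n :: nat and w
  define R where "R n w w' \<longleftrightarrow> integrated_solution D A t0 (t0 + h) 0 (\<lambda>r. C r (w r)) w'"
    for n :: nat and w w'
  have "\<exists>w. \<forall>n. P n (w n) \<and> R n (w n) (w (Suc n))"
  proof (rule dependent_nat_choice)
    obtain u where u: "integrated_solution D A t0 (t0 + h) 0 g u"
      "\<And>t. t \<in> ?I \<Longrightarrow> norm (u t) \<le> \<delta> h * M"
      by (rule forced_solution_A[OF h g M]) auto
    have "P 0 u"
      unfolding P_def using u integrated_solutionD(1,2)[OF u(1)] by simp
    then show "\<exists>w. P 0 w" by (rule exI[of _ u])
    fix w n assume w: "P n w"
    have bd: "norm (C t (w t)) \<le> c * (\<delta> h * M * (1/2) ^ n)" if "t \<in> ?I" for t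
    proof -
      have "norm (C t (w t)) \<le> c * norm (w t)"
        using w that by (intro CD(4)) (auto simp: P_def)
      also have "\<dots> \<le> c * (\<delta> h * M * (1/2) ^ n)"
        using w that CD(1) by (intro mult_left_mono) (auto simp: P_def)
      finally show ?thesis .
    qed
    have cont: "continuous_on ?I (\<lambda>r. C r (w r))"
      by (rule bounded_family_continuous_on[OF C]) (use w in \<open>auto simp: P_def\<close>)
    obtain w' where w': "integrated_solution D A t0 (t0 + h) 0 (\<lambda>r. C r (w r)) w'"
      "\<And>t. t \<in> ?I \<Longrightarrow> norm (w' t) \<le> \<delta> h * (c * (\<delta> h * M * (1/2) ^ n))"
      by (rule forced_solution_A[OF h cont bd]) auto
    have "norm (g t0) \<le> M" using M[of t0] h by simp
    then have "0 \<le> M" by (meson norm_ge_zero order_trans)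
    \<comment> \<open>One application of the solution map costs the factor
      \<open>\<delta> h * c \<le> 1/2\<close>; hence the powers of \<open>1/2\<close> in
      \<open>P\<close> and the factor 2 in the final bound.\<close>
    then have "\<delta> h * c * (\<delta> h * M * (1/2) ^ n) \<le> 1/2 * (\<delta> h * M * (1/2) ^ n)"
      using \<delta>_nonneg[of h] h by (intro mult_right_mono small) auto
    then have "norm (w' t) \<le> \<delta> h * M * (1/2) ^ Suc n" if "t \<in> ?I" for t
      using w'(2)[OF that] by (simp add: mult_ac)
    then have "P (Suc n) w'"
      using integrated_solutionD(1,2)[OF w'(1)] unfolding P_def by simp
    then show "\<exists>w'. P (Suc n) w' \<and> R n w w'"
      using w' unfolding R_def by blast
  qed
  then obtain w where w: "\<And>n. continuous_on ?I (w n)" "\<And>n t. t \<in> ?I \<Longrightarrow> w n t \<in> Z"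
    "\<And>n t. t \<in> ?I \<Longrightarrow> norm (w n t) \<le> \<delta> h * M * (1/2) ^ n"
    and w0: "integrated_solution D A t0 (t0 + h) 0 g (w 0)"
    and wSuc: "\<And>n. integrated_solution D A t0 (t0 + h) 0 (\<lambda>r. C r (w n r)) (w (Suc n))"
    unfolding P_def R_def by blast
  define W where "W n t = (\<Sum>k<n. w k t)" for n t
  have WZ: "W n t \<in> Z" if "t \<in> ?I" for n t
    unfolding W_def by (rule subspace_sum[OF Z_subspace w(2)[OF that]])
  have Wcont: "continuous_on ?I (W n)" for n
    unfolding W_def by (intro continuous_intros w)
  have CWcont: "continuous_on ?I (\<lambda>r. C r (W n r) + g r)" for n
    by (intro continuous_intros g bounded_family_continuous_on[OF C Wcont] WZ)
  \<comment> \<open>The lag is that of successive approximation: the partial sum with one more term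
    is driven by the sum before it, and both have the same uniform limit.\<close>
  have Wsol: "integrated_solution D A t0 (t0 + h) 0 (\<lambda>r. C r (W n r) + g r) (W (Suc n))" for n
  proof (induction n)
    case 0
    show ?case
      by (rule integrated_solution_cong[OF w0]) (use linear_on_setD(4)[OF CD(3)] in \<open>auto simp: W_def\<close>)
  next
    case (Suc n)
    have "integrated_solution D A t0 (t0 + h) (0 + 0) (\<lambda>r. (C r (W n r) + g r) + C r (w n r))
        (\<lambda>r. W (Suc n) r + w (Suc n) r)"
      by (intro integrated_solution_add[OF linear Suc wSuc] CWcont
          bounded_family_continuous_on[OF C] w)
    then have "integrated_solution D A t0 (t0 + h) 0 (\<lambda>r. (C r (W n r) + g r) + C r (w n r))
        (W (Suc (Suc n)))"
      by (simp add: W_def[abs_def])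
    then show ?case
      by (rule integrated_solution_cong)
         (use linear_on_setD(2)[OF CD(3) WZ w(2)] in \<open>auto simp: W_def\<close>)
  qed
  define v where "v t = (\<Sum>k. w k t)" for t
  have geo: "summable (\<lambda>n. \<delta> h * M * (1/2) ^ n)"
    by (intro summable_mult summable_geometric) auto
  have Wv: "uniform_limit ?I W v sequentially"
    unfolding W_def[abs_def] v_def[abs_def] by (rule Weierstrass_m_test[OF w(3) geo])
  have vZ: "v t \<in> Z" if "t \<in> ?I" for t
    by (rule closed_sequentially[OF closed_closure WZ[OF that] tendsto_uniform_limitI[OF Wv that]])
  have "uniform_limit ?I (\<lambda>n. W (Suc n)) v sequentially"
    using Wv unfolding uniform_limit_sequentially_iff by (meson le_SucI)
  moreover have "uniform_limit ?I (\<lambda>n r. C r (W n r) + g r) (\<lambda>r. C r (v r) + g r) sequentially"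
    unfolding uniform_limit_sequentially_iff
  proof (intro allI impI)
    fix e :: real assume e: "e > 0"
    have "0 < e / (c + 1)" using e CD(1) by simp
    then obtain N where N: "\<And>n t. n \<ge> N \<Longrightarrow> t \<in> ?I \<Longrightarrow> norm (W n t - v t) < e / (c + 1)"
      using Wv unfolding uniform_limit_sequentially_iff dist_norm by blast
    have "norm (C t (W n t) - C t (v t)) < e" if "n \<ge> N" "t \<in> ?I" for n t
    proof -
      have "norm (C t (W n t) - C t (v t)) \<le> c * norm (W n t - v t)"
        using CD(4)[of "W n t - v t" t] linear_on_setD(5)[OF CD(3) WZ vZ] that WZ vZ Z_subspace
        by (simp add: subspace_diff)
      also have "\<dots> \<le> c * (e / (c + 1))"
        using N[OF that] CD(1) by (intro mult_left_mono) auto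
      also have "\<dots> < e" using e CD(1) by (simp add: field_simps)
      finally show ?thesis .
    qed
    then show "\<exists>N. \<forall>n\<ge>N. \<forall>t\<in>?I. dist (C t (W n t) + g t) (C t (v t) + g t) < e"
      by (intro exI[of _ N]) (auto simp: dist_norm)
  qed
  ultimately have "integrated_solution D A t0 (t0 + h) 0 (\<lambda>r. C r (v r) + g r) v"
    by (intro integrated_solution_uniform_limit[OF closed_graph Wsol CWcont])
  moreover have "norm (v t) \<le> 2 * \<delta> h * M" if "t \<in> ?I" for t
  proof -
    have "norm (v t) \<le> (\<Sum>n. \<delta> h * M * (1/2) ^ n)"
      unfolding v_def by (rule norm_suminf_le[OF w(3)[OF that] geo])
    also have "\<dots> = 2 * \<delta> h * M"
      by (simp add: suminf_mult suminf_geometric)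
    finally show ?thesis .
  qed
  ultimately show ?thesis by (rule that)
qed

text \<open>The correction \<open>w = u - v\<close> solves the \<open>C\<close>-problem with zero
  initial value and forcing \<open>C r (v r) - B r (v r)\<close>, so the bound involves the two
  perturbations only through their difference along the known solution.\<close>

lemma perturbed_solution:
  assumes h: "0 < h" and B: "bounded_family Z b B" and C: "bounded_family Z c C"
    and small: "\<delta> h * c \<le> 1/2"
    and v: "integrated_solution D A t0 (t0 + h) x (\<lambda>r. B r (v r)) v"
    and M: "\<And>t. t \<in> {t0..t0 + h} \<Longrightarrow> norm (C t (v t) - B t (v t)) \<le> M"
  obtains u where "integrated_solution D A t0 (t0 + h) x (\<lambda>r. C r (u r)) u"
    "\<And>t. t \<in> {t0..t0 + h} \<Longrightarrow> norm (u t - v t) \<le> 2 * \<delta> h * M"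
proof -
  note V = integrated_solutionD[OF v]
  note contB = bounded_family_continuous_on[OF B V(1) V(2)]
  note contC = bounded_family_continuous_on[OF C V(1) V(2)]
  obtain w where w: "integrated_solution D A t0 (t0 + h) 0 (\<lambda>r. C r (w r) + (C r (v r) - B r (v r))) w"
    and bd: "\<And>t. t \<in> {t0..t0 + h} \<Longrightarrow> norm (w t) \<le> 2 * \<delta> h * M"
    by (rule forced_solution[OF h C small continuous_on_diff[OF contC contB] M]) auto
  note Wd = integrated_solutionD[OF w]
  note contCw = bounded_family_continuous_on[OF C Wd(1) Wd(2)]
  have "integrated_solution D A t0 (t0 + h) (x + 0)
      (\<lambda>r. B r (v r) + (C r (w r) + (C r (v r) - B r (v r)))) (\<lambda>r. v r + w r)"
    by (intro integrated_solution_add[OF linear v w] contB contC contCw continuous_intros)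
  then have "integrated_solution D A t0 (t0 + h) x (\<lambda>r. C r (v r + w r)) (\<lambda>r. v r + w r)"
    using integrated_solution_cong[where g' = "\<lambda>r. C r (v r + w r)" and u' = "\<lambda>r. v r + w r"]
      linear_on_setD(2)[OF bounded_familyD(3)[OF C] V(2) Wd(2)]
    by (simp add: algebra_simps)
  then show ?thesis
    using that[of "\<lambda>r. v r + w r"] bd by simp
qed

end

text \<open>A bounded inverse of \<open>l - A\<close> on the whole space makes the graph of
  \<open>A\<close> closed: it maps \<open>l *\<^sub>R X n - A (X n)\<close> back to
  \<open>X n\<close>, so the limit of \<open>X\<close> lies in its range \<open>D\<close> and solves
  the limit equation.\<close>

lemma forced_problem_exists:
  fixes D :: "'a::banach set"
  assumes linear: "linear_on_set D A" and "resolvent_condition D A" and "forcing_condition D A"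
  shows "\<exists>\<delta>. forced_problem D A \<delta>"
proof -
  obtain \<delta> :: "real \<Rightarrow> real" where d: "mono_on {0..} \<delta>" "\<forall>t\<ge>0. \<delta> t \<ge> 0" "(\<delta> \<longlongrightarrow> 0) (at_right 0)"
    and f: "\<forall>\<tau>>0. \<forall>f. continuous_on {0..\<tau>} f \<longrightarrow>
           (\<exists>u. continuous_on {0..\<tau>} u \<and>
              (\<forall>t\<in>{0..\<tau>}. u t \<in> closure D \<and> integral {0..t} u \<in> D \<and>
                 u t = A (integral {0..t} u) + integral {0..t} f \<and>
                 norm (u t) \<le> \<delta> t * (SUP s\<in>{0..t}. norm (f s))))"
    using assms(3) unfolding forcing_condition_def by blast
  obtain \<omega> where "{\<omega><..} \<subseteq> resolvent_set D A"
    using assms(2) unfolding resolvent_condition_def by blast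
  then have "\<omega> + 1 \<in> resolvent_set D A" by auto
  then obtain l where bij: "bij_betw (\<lambda>x. l *\<^sub>R x - A x) D UNIV" and bl: "bounded_linear (resolvent D A l)"
    unfolding resolvent_set_def by blast
  have "forced_problem D A \<delta>"
  proof
    show "linear_on_set D A" by (rule linear)
    show "\<delta> s \<le> \<delta> t" if "0 \<le> s" "s \<le> t" for s t
      using mono_onD[OF d(1)] that by simp
    show "\<exists>u. integrated_solution D A 0 h 0 f u \<and>
          (\<forall>t\<in>{0..h}. norm (u t) \<le> \<delta> t * (SUP s\<in>{0..t}. norm (f s)))"
      if "0 < h" "continuous_on {0..h} f" for h f
    proof -
      from f that obtain u where "continuous_on {0..h} u"
        "\<forall>t\<in>{0..h}. u t \<in> closure D \<and> integral {0..t} u \<in> D \<and>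
           u t = A (integral {0..t} u) + integral {0..t} f \<and>
           norm (u t) \<le> \<delta> t * (SUP s\<in>{0..t}. norm (f s))" by metis
      then show ?thesis
        unfolding integrated_solution_def add_0_left by (intro exI[of _ u]) blast
    qed
    show "x \<in> D \<and> A x = y"
      if X: "\<And>n::nat. X n \<in> D" "X \<longlonglongrightarrow> x" "(\<lambda>n. A (X n)) \<longlonglongrightarrow> y" for X x y
    proof -
      have res: "resolvent D A l (l *\<^sub>R z - A z) = z" if "z \<in> D" for z
        unfolding resolvent_def using bij_betw_inv_into_left[OF bij that] .
      have "(\<lambda>n. resolvent D A l (l *\<^sub>R X n - A (X n))) \<longlonglongrightarrow> resolvent D A l (l *\<^sub>R x - y)"
        by (intro bounded_linear.tendsto[OF bl] tendsto_intros X)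
      then have "X \<longlonglongrightarrow> resolvent D A l (l *\<^sub>R x - y)"
        using res X(1) by simp
      then have x: "x = resolvent D A l (l *\<^sub>R x - y)"
        using X(2) LIMSEQ_unique by blast
      have "resolvent D A l (l *\<^sub>R x - y) \<in> D"
        unfolding resolvent_def using bij by (metis UNIV_I bij_betw_def inv_into_into)
      moreover have "l *\<^sub>R resolvent D A l (l *\<^sub>R x - y) - A (resolvent D A l (l *\<^sub>R x - y)) = l *\<^sub>R x - y"
        using bij_betw_inv_into_right[OF bij, of "l *\<^sub>R x - y"] unfolding resolvent_def by simp
      ultimately show ?thesis using x by simp
    qed
  qed (use d in \<open>simp_all only: simp_thms\<close>)
  then show ?thesis by blast
qed

subsection \<open>Construction of the perturbed evolution family\<close>

context forced_problem
begin

lemma family_solution_continuous_on: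
  assumes "bounded_family Z c C" "integrated_solution D A t0 t1 x g u"
  shows "continuous_on {t0..t1} (\<lambda>r. C r (u r))"
  by (rule bounded_family_continuous_on[OF assms(1) integrated_solutionD(1)[OF assms(2)]
        integrated_solutionD(2)[OF assms(2)]])

lemma family_solution_glue:
  assumes C: "bounded_family Z c C"
    and u: "integrated_solution D A t0 r x (\<lambda>r. C r (u r)) u"
    and v: "integrated_solution D A r t1 (u r) (\<lambda>r. C r (v r)) v"
    and r: "t0 \<le> r" "r \<le> t1" and w: "\<And>t. w t = (if t \<le> r then u t else v t)"
  shows "integrated_solution D A t0 t1 x (\<lambda>r. C r (w r)) w"
proof -
  have vr: "v r = u r"
    by (rule integrated_solution_initial(1)[OF linear v r(2)])
  have 1: "integrated_solution D A t0 r x (\<lambda>r. C r (w r)) w"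
    by (rule integrated_solution_cong[OF u]) (auto simp: w)
  have 2: "integrated_solution D A r t1 (w r) (\<lambda>r. C r (w r)) w"
  proof -
    have "w r = u r" by (simp add: w)
    moreover have "integrated_solution D A r t1 (u r) (\<lambda>r. C r (w r)) w"
      by (rule integrated_solution_cong[OF v]) (use vr in \<open>auto simp: w\<close>)
    ultimately show ?thesis by simp
  qed
  have "{t0..t1} = {t0..r} \<union> {r..t1}" using r by auto
  then have "continuous_on {t0..t1} (\<lambda>r. C r (w r))"
    using continuous_on_closed_Un[OF _ _ family_solution_continuous_on[OF C 1]
        family_solution_continuous_on[OF C 2]] by simp
  from integrated_solution_glue[OF linear 1 2 this r] show ?thesis .
qed

end

section \<open>Uniform bounds for the given evolution family\<close>

locale reference_problem = forced_problem D A \<delta>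
  for D :: "'a::banach set" and A :: "'a \<Rightarrow> 'a" and \<delta> :: "real \<Rightarrow> real" +
  fixes B :: "real \<Rightarrow> 'a \<Rightarrow> 'a" and b :: real and UB :: "real \<Rightarrow> real \<Rightarrow> 'a \<Rightarrow> 'a" and \<tau> :: real
  assumes B: "bounded_family Z b B"
    and UB: "generates_evolution_family D A B UB"
    and \<tau>: "0 < \<tau>" and \<delta>_small: "\<delta> \<tau> * (b + 1) \<le> 1/2"
begin

lemma b_nonneg: "0 \<le> b"
  using bounded_familyD(1)[OF B] .

text \<open>The condition on \<open>\<tau>\<close> is stated with \<open>b + 1\<close> so that it
  serves \<open>B\<close> and also every nearby \<open>C\<close>, whose bound may be as large as
  \<open>b + 1\<close>. As \<open>b\<close> is nonnegative, it gives
  \<open>\<delta> h \<le> 1/2\<close> as well.\<close>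

lemma \<delta>_bounds: 
  assumes "0 \<le> h" "h \<le> \<tau>"
  shows "0 \<le> \<delta> h" "\<delta> h \<le> 1/2" "\<delta> h * b \<le> 1/2" "\<delta> h * (b + 1) \<le> 1/2"
proof -
  show d: "0 \<le> \<delta> h" using \<delta>_nonneg assms by simp
  have "\<delta> h * (b + 1) \<le> \<delta> \<tau> * (b + 1)"
    using \<delta>_mono[OF assms] b_nonneg by (intro mult_right_mono) auto
  then show le: "\<delta> h * (b + 1) \<le> 1/2" using \<delta>_small by simp
  have "0 \<le> \<delta> h * b" using d b_nonneg by simp
  with le d show "\<delta> h \<le> 1/2" "\<delta> h * b \<le> 1/2" by (simp_all add: algebra_simps)
qed

lemma UB_props:
  assumes "s \<le> t"
  shows "UB t s \<in> bounded_ops Z Z" "x \<in> Z \<Longrightarrow> UB t s x \<in> Z" "x \<in> Z \<Longrightarrow> UB t t x = x"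
    "s \<le> r \<Longrightarrow> r \<le> t \<Longrightarrow> x \<in> Z \<Longrightarrow> UB t r (UB r s x) = UB t s x"
    "x \<in> Z \<Longrightarrow> integrated_solution D A s t x (\<lambda>r. B r (UB r s x)) (\<lambda>r. UB r s x)"
proof -
  have ev: "evolution_family Z UB"
    and mild: "\<And>t0 x. x \<in> Z \<Longrightarrow> mild_solution D A B t0 x (\<lambda>t. UB t t0 x)"
    using UB unfolding generates_evolution_family_def by auto
  show op: "UB t s \<in> bounded_ops Z Z" and "x \<in> Z \<Longrightarrow> UB t t x = x"
    "s \<le> r \<Longrightarrow> r \<le> t \<Longrightarrow> x \<in> Z \<Longrightarrow> UB t r (UB r s x) = UB t s x"
    using ev assms unfolding evolution_family_def by auto
  show "x \<in> Z \<Longrightarrow> UB t s x \<in> Z"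
    using bounded_opsD(2)[OF op] .
  show "x \<in> Z \<Longrightarrow> integrated_solution D A s t x (\<lambda>r. B r (UB r s x)) (\<lambda>r. UB r s x)"
    using mild assms unfolding mild_solution_iff_integrated_solution by simp
qed

text \<open>The assumed uniqueness concerns solutions on a whole half-line. A solution on
  \<open>{t0..t1}\<close> is therefore continued past \<open>t1\<close> by \<open>UB\<close> started
  at \<open>u t1\<close>, and the continuation is compared with \<open>UB\<close>.\<close>

lemma UB_unique:
  assumes u: "integrated_solution D A t0 t1 x (\<lambda>r. B r (u r)) u" and t: "t \<in> {t0..t1}"
  shows "u t = UB t t0 x"
proof -
  have t01: "t0 \<le> t1" using t by simp
  note x = integrated_solution_initial(2)[OF linear u t01]
  have ut1: "u t1 \<in> Z" using integrated_solutionD(2)[OF u] t01 by simp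
  define v where "v r = (if r \<le> t1 then u r else UB r t1 (u t1))" for r
  have v: "integrated_solution D A t0 (max t1 t2) x (\<lambda>r. B r (v r)) v" for t2
    by (rule family_solution_glue[OF B u UB_props(5)[OF _ ut1]]) (use t01 in \<open>auto simp: v_def\<close>)
  have "mild_solution D A B t0 x v"
    unfolding mild_solution_iff_integrated_solution
  proof (intro allI impI)
    show "integrated_solution D A t0 t2 x (\<lambda>r. B r (v r)) v" if "t0 \<le> t2" for t2
      by (rule integrated_solution_subinterval[OF v[of t2]]) simp
  qed
  then have "v t = UB t t0 x"
    using UB x t unfolding generates_evolution_family_def by auto
  then show ?thesis using t by (simp add: v_def)
qed

text \<open>From initial time 0, continuity on a compact interval and uniform boundedness give a
  bound. Three moves carry it to any \<open>s\<close>: from the \<open>B\<close>-solution to an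
  unperturbed one at 0, by translation to \<open>s\<close>, and back to the
  \<open>B\<close>-solution there.\<close>

lemma UB_bound: "\<exists>K\<ge>1. \<forall>s t. s \<le> t \<longrightarrow> t \<le> s + \<tau> \<longrightarrow> bounded_by Z K (UB t s)"
proof -
  have zero: "bounded_family Z 0 (\<lambda>_ _. 0 :: 'a)"
    unfolding bounded_family_def bounded_by_def linear_on_set_def strongly_continuous_def
    using Z_subspace by auto
  have "\<exists>K. \<forall>t\<in>{0..\<tau>}. bounded_by Z K (UB t 0)"
  proof (rule uniform_bound_on_subspace)
    show "\<And>t. t \<in> {0..\<tau>} \<Longrightarrow> UB t 0 \<in> bounded_ops Z UNIV"
      using UB_props(1) unfolding bounded_ops_def by fastforce
    fix x assume x: "x \<in> Z"
    have "continuous_on {0..\<tau>} (\<lambda>t. UB t 0 x)"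
      using integrated_solutionD(1)[OF UB_props(5)[of 0 \<tau> x]] x \<tau> by simp
    then have "bounded ((\<lambda>t. UB t 0 x) ` {0..\<tau>})"
      by (intro compact_imp_bounded compact_continuous_image) auto
    then show "\<exists>K. \<forall>t\<in>{0..\<tau>}. norm (UB t 0 x) \<le> K"
      unfolding bounded_iff by auto
  qed (use \<tau> in auto)
  then obtain K where K: "\<And>t. t \<in> {0..\<tau>} \<Longrightarrow> bounded_by Z K (UB t 0)" by blast
  define K0 where "K0 = max K 1"
  \<comment> \<open>Each comparison adds at most \<open>2 * \<delta> \<tau> * b\<close> times the
    current bound; since \<open>2 * \<delta> \<tau> \<le> 1\<close>, it multiplies the constant by
    at most \<open>1 + b\<close>.\<close>
  define K1 where "K1 = K0 + b * K0"
  define K2 where "K2 = K1 + b * K1"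
  have K0: "1 \<le> K0" "\<And>t x. t \<in> {0..\<tau>} \<Longrightarrow> x \<in> Z \<Longrightarrow> norm (UB t 0 x) \<le> K0 * norm x"
    using bounded_byD(2)[OF bounded_by_mono[OF K]] unfolding K0_def by auto
  have K1: "1 \<le> K1" unfolding K1_def using K0(1) b_nonneg by (simp add: add_increasing2)
  then have K2: "1 \<le> K2" unfolding K2_def using b_nonneg by (simp add: add_increasing2)
  have d1: "\<delta> \<tau> \<le> 1/2" "\<delta> \<tau> * b \<le> 1/2"
    using \<delta>_bounds[of \<tau>] \<tau> by auto
  have est: "2 * \<delta> \<tau> * (b * (k * n)) \<le> b * k * n" if "0 \<le> k" "0 \<le> n" for k n :: real
  proof -
    have "2 * \<delta> \<tau> * (b * (k * n)) \<le> 1 * (b * (k * n))"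
      using d1(1) \<tau> that b_nonneg by (intro mult_right_mono) auto
    then show ?thesis by (simp add: mult.assoc)
  qed
  have bound: "norm (UB t s x) \<le> K2 * norm x" if st: "s \<le> t" "t \<le> s + \<tau>" and x: "x \<in> Z" for s t x
  proof -
    have v: "integrated_solution D A 0 (0 + \<tau>) x (\<lambda>r. B r (UB r 0 x)) (\<lambda>r. UB r 0 x)"
      using UB_props(5)[of 0 \<tau> x] \<tau> x by simp
    have "norm (0 - B t (UB t 0 x)) \<le> b * (K0 * norm x)" if "t \<in> {0..0 + \<tau>}" for t
    proof -
      have "norm (B t (UB t 0 x)) \<le> b * norm (UB t 0 x)"
        using bounded_familyD(4)[OF B] UB_props(2)[OF _ x] that by simp
      also have "\<dots> \<le> b * (K0 * norm x)"
        using K0(2) that x b_nonneg by (intro mult_left_mono) auto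
      finally show ?thesis by simp
    qed
    from perturbed_solution[OF \<tau> B zero _ v this] obtain u where
      u: "integrated_solution D A 0 \<tau> x (\<lambda>r. 0) u"
      and ud: "\<And>t. t \<in> {0..\<tau>} \<Longrightarrow> norm (u t - UB t 0 x) \<le> 2 * \<delta> \<tau> * (b * (K0 * norm x))"
      by auto
    have ub: "norm (u t) \<le> K1 * norm x" if "t \<in> {0..\<tau>}" for t
    proof -
      have "norm (u t) \<le> norm (UB t 0 x) + norm (u t - UB t 0 x)" by (rule norm_triangle_sub)
      also have "\<dots> \<le> K0 * norm x + b * K0 * norm x"
        using order_trans[OF ud[OF that] est] K0(1) by (intro add_mono K0(2) that x) auto
      finally show ?thesis unfolding K1_def by (simp add: distrib_right)
    qed
    have u': "integrated_solution D A s (s + \<tau>) x (\<lambda>r. 0) (\<lambda>r. u (r - s))"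
      using integrated_solution_shift[OF u, of s] by (simp add: add.commute)
    have "norm (B r (u (r - s)) - 0) \<le> b * (K1 * norm x)" if "r \<in> {s..s + \<tau>}" for r
    proof -
      have "norm (B r (u (r - s))) \<le> b * norm (u (r - s))"
        using bounded_familyD(4)[OF B] integrated_solutionD(2)[OF u'] that by simp
      also have "\<dots> \<le> b * (K1 * norm x)"
        using ub[of "r - s"] that b_nonneg by (intro mult_left_mono) auto
      finally show ?thesis by simp
    qed
    from perturbed_solution[OF \<tau> zero B d1(2) u' this] obtain w where
      w: "integrated_solution D A s (s + \<tau>) x (\<lambda>r. B r (w r)) w"
      and wd: "\<And>t. t \<in> {s..s + \<tau>} \<Longrightarrow> norm (w t - u (t - s)) \<le> 2 * \<delta> \<tau> * (b * (K1 * norm x))"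
      by auto
    have "norm (w t) \<le> K2 * norm x"
    proof -
      have "norm (w t) \<le> norm (u (t - s)) + norm (w t - u (t - s))" by (rule norm_triangle_sub)
      also have "\<dots> \<le> K1 * norm x + b * K1 * norm x"
        using order_trans[OF wd est] K1 st by (intro add_mono ub) auto
      finally show ?thesis unfolding K2_def by (simp add: distrib_right)
    qed
    then show ?thesis
      using UB_unique[OF w] st by simp
  qed
  show ?thesis
  proof (intro exI[of _ K2] conjI allI impI K2)
    show "bounded_by Z K2 (UB t s)" if "s \<le> t" "t \<le> s + \<tau>" for s t
      using bound that bounded_opsD(1)[OF UB_props(1)[OF that(1)]] unfolding bounded_by_def by simp
  qed
qed

end

section \<open>The evolution family of a nearby perturbation\<close>

definition family_evolution ::
  "'a::banach set \<Rightarrow> ('a \<Rightarrow> 'a) \<Rightarrow> (real \<Rightarrow> 'a \<Rightarrow> 'a) \<Rightarrow> real \<Rightarrow> real \<Rightarrow> 'a \<Rightarrow> 'a" where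
  "family_evolution D A C t s x =
     (SOME u. integrated_solution D A s t x (\<lambda>r. C r (u r)) u) t"

locale close_problem = reference_problem D A \<delta> B b UB \<tau>
  for D :: "'a::banach set" and A :: "'a \<Rightarrow> 'a" and \<delta> :: "real \<Rightarrow> real"
    and B :: "real \<Rightarrow> 'a \<Rightarrow> 'a" and b :: real and UB :: "real \<Rightarrow> real \<Rightarrow> 'a \<Rightarrow> 'a" and \<tau> :: real +
  fixes C :: "real \<Rightarrow> 'a \<Rightarrow> 'a" and e K :: real
  assumes C: "bounded_family Z (b + 1) C"
    and e: "0 \<le> e" "e \<le> 1/2" and close: "\<And>t x. x \<in> Z \<Longrightarrow> norm (C t x - B t x) \<le> e * norm x"
    and K: "1 \<le> K" "\<And>s t. s \<le> t \<Longrightarrow> t \<le> s + \<tau> \<Longrightarrow> bounded_by Z K (UB t s)"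
begin

abbreviation "UC \<equiv> family_evolution D A C"

text \<open>A solution \<open>z\<close> need not be the one that the series produces, so it is
  compared with the constructed solution \<open>w\<close> of the \<open>B\<close>-problem forced by
  \<open>C r (z r) - B r (z r)\<close>. Their difference solves the homogeneous
  \<open>B\<close>-problem from 0, hence \<open>z = w\<close>, and the bound on \<open>w\<close>
  makes the maximum of \<open>norm (z r)\<close> at most half of itself.\<close>

lemma solution_zero:
  assumes z: "integrated_solution D A t0 t1 0 (\<lambda>r. C r (z r)) z" and t1: "t1 \<le> t0 + \<tau>"
    and t: "t \<in> {t0..t1}"
  shows "z t = 0"
proof (cases "t0 < t1")
  case False
  then have "t = t0" "t0 \<le> t1" using t by auto
  then show ?thesis
    using integrated_solution_initial(1)[OF linear z] by simp
next
  case True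
  define h where "h = t1 - t0"
  have h: "0 < h" "0 \<le> h" "h \<le> \<tau>" and t1h: "t1 = t0 + h" using True t1 unfolding h_def by auto
  note zD = integrated_solutionD[OF z]
  have "continuous_on {t0..t1} (\<lambda>r. norm (z r))" by (intro continuous_intros zD)
  then obtain m where m: "m \<in> {t0..t1}" and max: "\<And>r. r \<in> {t0..t1} \<Longrightarrow> norm (z r) \<le> norm (z m)"
    using continuous_attains_sup[of "{t0..t1}" "\<lambda>r. norm (z r)"] True by force
  have Bz: "continuous_on {t0..t1} (\<lambda>r. B r (z r))"
    by (rule family_solution_continuous_on[OF B z])
  have Cz: "continuous_on {t0..t1} (\<lambda>r. C r (z r))"
    by (rule family_solution_continuous_on[OF C z])
  have M: "norm (C r (z r) - B r (z r)) \<le> e * norm (z m)" if "r \<in> {t0..t1}" for r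
    using close[OF zD(2)[OF that], of r] mult_left_mono[OF max[OF that] e(1)] by simp
  obtain w where w: "integrated_solution D A t0 t1 0 (\<lambda>r. B r (w r) + (C r (z r) - B r (z r))) w"
    and wb: "\<And>r. r \<in> {t0..t1} \<Longrightarrow> norm (w r) \<le> 2 * \<delta> h * (e * norm (z m))"
    unfolding t1h
    by (rule forced_solution[OF h(1) B \<delta>_bounds(3)[OF h(2,3)] continuous_on_diff[OF Cz Bz, unfolded t1h]
          M[unfolded t1h]]) auto
  note wD = integrated_solutionD[OF w]
  have Bw: "continuous_on {t0..t1} (\<lambda>r. B r (w r))"
    by (rule family_solution_continuous_on[OF B w])
  have "integrated_solution D A t0 t1 (0 - 0)
      (\<lambda>r. C r (z r) - (B r (w r) + (C r (z r) - B r (z r)))) (\<lambda>r. z r - w r)"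
    by (intro integrated_solution_diff[OF linear z w] continuous_intros Bz Cz Bw)
  then have zw: "integrated_solution D A t0 t1 0 (\<lambda>r. B r (z r - w r)) (\<lambda>r. z r - w r)"
    using integrated_solution_cong[where g' = "\<lambda>r. B r (z r - w r)" and u' = "\<lambda>r. z r - w r"]
      linear_on_setD(5)[OF bounded_familyD(3)[OF B] zD(2) wD(2)]
    by simp
  have eq: "z r = w r" if "r \<in> {t0..t1}" for r
    using UB_unique[OF zw that] linear_on_setD(4)[OF bounded_opsD(1)[OF UB_props(1)]] that by simp
  have "norm (z m) \<le> 2 * \<delta> h * (e * norm (z m))"
    using wb[OF m] eq[OF m] by simp
  also have "\<dots> \<le> 1 * (1/2 * norm (z m))"
    using \<delta>_bounds(1,2)[OF h(2,3)] e by (intro mult_mono mult_right_mono) auto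
  finally have "norm (z m) \<le> 0" by simp
  then show ?thesis using max[OF t] by simp
qed

lemma solution_unique_steps:
  assumes "integrated_solution D A t0 t1 x (\<lambda>r. C r (u r)) u"
    and "integrated_solution D A t0 t1 x (\<lambda>r. C r (v r)) v"
    and "t1 \<le> t0 + real n * \<tau>" and "t \<in> {t0..t1}"
  shows "u t = v t"
  using assms
proof (induction n arbitrary: t0 x)
  case 0
  then have "t = t0" "t0 \<le> t1" by auto
  then show ?case
    using integrated_solution_initial(1)[OF linear 0(1)] integrated_solution_initial(1)[OF linear 0(2)]
    by simp
next
  case (Suc n)
  \<comment> \<open>The last step may be shorter than \<open>\<tau>\<close>. A time \<open>t\<close>
    beyond \<open>r\<close> occurs only after a full step, which is what lowers the count
    \<open>n\<close>.\<close>
  define r where "r = min t1 (t0 + \<tau>)"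
  have r: "t0 \<le> r" "r \<le> t1" "r \<le> t0 + \<tau>" using Suc.prems(4) \<tau> unfolding r_def by auto
  have sol: "integrated_solution D A t0 r x (\<lambda>r. C r (u r)) u"
    "integrated_solution D A t0 r x (\<lambda>r. C r (v r)) v"
    using integrated_solution_subinterval Suc.prems(1,2) r(2) by blast+
  note U = integrated_solutionD[OF sol(1)] and V = integrated_solutionD[OF sol(2)]
  have "integrated_solution D A t0 r (x - x) (\<lambda>r. C r (u r) - C r (v r)) (\<lambda>r. u r - v r)"
    by (intro integrated_solution_diff[OF linear sol] family_solution_continuous_on[OF C sol(1)]
        family_solution_continuous_on[OF C sol(2)])
  then have "integrated_solution D A t0 r 0 (\<lambda>r. C r (u r - v r)) (\<lambda>r. u r - v r)"
    using integrated_solution_cong[where g' = "\<lambda>r. C r (u r - v r)" and u' = "\<lambda>r. u r - v r"]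
      linear_on_setD(5)[OF bounded_familyD(3)[OF C] U(2) V(2)] by simp
  from solution_zero[OF this r(3)] have eq: "u s = v s" if "s \<in> {t0..r}" for s
    using that by simp
  show ?case
  proof (cases "t \<le> r")
    case True
    then show ?thesis using eq Suc.prems(4) by simp
  next
    case False
    then have rt: "r = t0 + \<tau>" using Suc.prems(4) unfolding r_def by auto
    have "integrated_solution D A r t1 (u r) (\<lambda>r. C r (u r)) u"
      "integrated_solution D A r t1 (v r) (\<lambda>r. C r (v r)) v"
      using integrated_solution_restart[OF linear Suc.prems(1) family_solution_continuous_on[OF C Suc.prems(1)] r(1,2)]
        integrated_solution_restart[OF linear Suc.prems(2) family_solution_continuous_on[OF C Suc.prems(2)] r(1,2)]
      by auto
    then show ?thesis
      using Suc.IH[of r "u r"] eq[of r] r(1) False Suc.prems(3,4) rt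
      by (auto simp: algebra_simps)
  qed
qed

lemma solution_unique:
  assumes "integrated_solution D A t0 t1 x (\<lambda>r. C r (u r)) u"
    and "integrated_solution D A t0 t1 x (\<lambda>r. C r (v r)) v" and "t \<in> {t0..t1}"
  shows "u t = v t"
proof -
  obtain n where "(t1 - t0) / \<tau> \<le> real n" using real_arch_simple by blast
  then have "t1 \<le> t0 + real n * \<tau>" using \<tau> by (simp add: field_simps)
  then show ?thesis using solution_unique_steps[OF assms(1,2) _ assms(3)] by simp
qed

lemma local_solution:
  assumes x: "x \<in> Z" and h: "0 < h" "h \<le> \<tau>"
  obtains u where "integrated_solution D A t0 (t0 + h) x (\<lambda>r. C r (u r)) u"
    "\<And>t. t \<in> {t0..t0 + h} \<Longrightarrow> norm (u t - UB t t0 x) \<le> 2 * \<delta> h * (e * (K * norm x))"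
proof -
  have v: "integrated_solution D A t0 (t0 + h) x (\<lambda>r. B r (UB r t0 x)) (\<lambda>r. UB r t0 x)"
    using UB_props(5)[OF _ x] h by simp
  have M: "norm (C t (UB t t0 x) - B t (UB t t0 x)) \<le> e * (K * norm x)" if "t \<in> {t0..t0 + h}" for t
  proof -
    have "norm (UB t t0 x) \<le> K * norm x"
      using bounded_byD(2)[OF K(2) x] that h by simp
    then show ?thesis
      using close[OF integrated_solutionD(2)[OF v that], of t] e(1)
      by (meson mult_left_mono order_trans)
  qed
  have "\<delta> h * (b + 1) \<le> 1/2" using \<delta>_bounds(4) h by simp
  from perturbed_solution[OF h(1) B C this v M] that show ?thesis by blast
qed

lemma solution_exists_steps:
  assumes x: "x \<in> Z"
  shows "\<exists>u. integrated_solution D A t0 (t0 + real (Suc n) * \<tau>) x (\<lambda>r. C r (u r)) u"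
proof (induction n)
  case 0
  show ?case using local_solution[OF x \<tau>, of t0] by auto
next
  case (Suc n)
  define r where "r = t0 + real (Suc n) * \<tau>"
  obtain u where u: "integrated_solution D A t0 r x (\<lambda>r. C r (u r)) u"
    using Suc unfolding r_def by blast
  have r: "t0 \<le> r" using \<tau> unfolding r_def by simp
  have ur: "u r \<in> Z" using integrated_solutionD(2)[OF u] r by simp
  obtain v where v: "integrated_solution D A r (r + \<tau>) (u r) (\<lambda>r. C r (v r)) v"
    using local_solution[OF ur \<tau>, of r] by auto
  have "integrated_solution D A t0 (r + \<tau>) x (\<lambda>s. C s (if s \<le> r then u s else v s))
      (\<lambda>s. if s \<le> r then u s else v s)"
    by (rule family_solution_glue[OF C u v]) (use r \<tau> in auto)
  moreover have "r + \<tau> = t0 + real (Suc (Suc n)) * \<tau>"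
    unfolding r_def by (simp add: algebra_simps)
  ultimately show ?case by auto
qed

lemma solution_exists:
  assumes x: "x \<in> Z"
  shows "\<exists>u. integrated_solution D A t0 t1 x (\<lambda>r. C r (u r)) u"
proof -
  obtain n where "(t1 - t0) / \<tau> \<le> real n" using real_arch_simple by blast
  then have "t1 \<le> t0 + real n * \<tau>" using \<tau> by (simp add: field_simps)
  also have "\<dots> \<le> t0 + real (Suc n) * \<tau>" using \<tau> by (simp add: algebra_simps)
  finally show ?thesis
    using solution_exists_steps[OF x, of t0 n] integrated_solution_subinterval by blast
qed

text \<open>Each pair of times has its own chosen solution on \<open>{s..t}\<close>, read off at the
  right end only. Uniqueness makes all these choices agree with any one solution on a longer
  interval.\<close>

lemma UC_eq:
  assumes u: "integrated_solution D A s t1 x (\<lambda>r. C r (u r)) u" and t: "t \<in> {s..t1}"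
  shows "UC t s x = u t"
proof -
  have ut: "integrated_solution D A s t x (\<lambda>r. C r (u r)) u"
    by (rule integrated_solution_subinterval[OF u]) (use t in simp)
  then have "integrated_solution D A s t x
      (\<lambda>r. C r ((SOME u. integrated_solution D A s t x (\<lambda>r. C r (u r)) u) r))
      (SOME u. integrated_solution D A s t x (\<lambda>r. C r (u r)) u)"
    by (rule someI[where P = "\<lambda>u. integrated_solution D A s t x (\<lambda>r. C r (u r)) u"])
  from solution_unique[OF this ut] show ?thesis
    using t unfolding family_evolution_def by simp
qed

lemma UC_solution:
  assumes x: "x \<in> Z"
  shows "integrated_solution D A s t1 x (\<lambda>r. C r (UC r s x)) (\<lambda>r. UC r s x)"
proof -
  obtain u where u: "integrated_solution D A s t1 x (\<lambda>r. C r (u r)) u"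
    using solution_exists[OF x] by blast
  show ?thesis
    by (rule integrated_solution_cong[OF u]) (use UC_eq[OF u] in auto)
qed

lemma UC_in_Z: "x \<in> Z \<Longrightarrow> s \<le> t \<Longrightarrow> UC t s x \<in> Z"
  using integrated_solutionD(2)[OF UC_solution, of x t s t] by simp

lemma UC_same: "x \<in> Z \<Longrightarrow> UC t t x = x"
  using integrated_solution_initial(1)[OF linear UC_solution, of x t t] by simp

lemma UC_comp:
  assumes "s \<le> r" "r \<le> t" and x: "x \<in> Z"
  shows "UC t r (UC r s x) = UC t s x"
  using UC_eq[OF integrated_solution_restart[OF linear UC_solution[OF x]
        family_solution_continuous_on[OF C UC_solution[OF x]] assms(1,2)], of t] assms(2)
  by simp

lemma UC_linear:
  assumes st: "s \<le> t"
  shows "linear_on_set Z (UC t s)"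
  unfolding linear_on_set_def
proof (intro conjI ballI allI)
  show "subspace Z" by (rule Z_subspace)
  note CL = linear_on_setD[OF bounded_familyD(3)[OF C]]
  show "UC t s (x + y) = UC t s x + UC t s y" if x: "x \<in> Z" and y: "y \<in> Z" for x y
  proof (rule UC_eq)
    have "integrated_solution D A s t (x + y) (\<lambda>r. C r (UC r s x) + C r (UC r s y))
        (\<lambda>r. UC r s x + UC r s y)"
      by (intro integrated_solution_add[OF linear] UC_solution x y
          family_solution_continuous_on[OF C UC_solution])
    then show "integrated_solution D A s t (x + y) (\<lambda>r. C r (UC r s x + UC r s y))
        (\<lambda>r. UC r s x + UC r s y)"
      by (rule integrated_solution_cong) (use CL(2) UC_in_Z x y in auto)
  qed (use st in auto)
  show "UC t s (c *\<^sub>R x) = c *\<^sub>R UC t s x" if x: "x \<in> Z" for x c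
  proof (rule UC_eq)
    show "integrated_solution D A s t (c *\<^sub>R x) (\<lambda>r. C r (c *\<^sub>R UC r s x)) (\<lambda>r. c *\<^sub>R UC r s x)"
      by (rule integrated_solution_cong[OF integrated_solution_scale[OF linear UC_solution[OF x]]])
         (use CL(3) UC_in_Z x in auto)
  qed (use st in auto)
qed

text \<open>The factor \<open>\<delta> (t - s)\<close> is kept because it vanishes as the times
  merge, which yields continuity at the diagonal; the factor \<open>e\<close> carries closeness to
  long times. Solutions are built on intervals of positive length, so \<open>t = s\<close> is a
  separate case.\<close>

lemma UC_close_local:
  assumes st: "s \<le> t" "t \<le> s + \<tau>" and x: "x \<in> Z"
  shows "norm (UC t s x - UB t s x) \<le> 2 * \<delta> (t - s) * (e * (K * norm x))"
proof (cases "s < t")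
  case True
  obtain u where u: "integrated_solution D A s (s + (t - s)) x (\<lambda>r. C r (u r)) u"
    and bd: "\<And>r. r \<in> {s..s + (t - s)} \<Longrightarrow> norm (u r - UB r s x) \<le> 2 * \<delta> (t - s) * (e * (K * norm x))"
    by (rule local_solution[OF x, of "t - s" s]) (use True st in auto)
  show ?thesis using UC_eq[OF u, of t] bd[of t] st by simp
next
  case False
  then have "t = s" using st by simp
  then show ?thesis
    using UC_same[OF x] UB_props(3)[OF order_refl x] \<delta>_nonneg[of 0] e K(1) by simp
qed

text \<open>On a step of length at most \<open>\<tau>\<close> the deviation from \<open>UB\<close>
  is at most \<open>K * norm x\<close>; together with the bound \<open>K\<close> for
  \<open>UB\<close> this makes \<open>2 * K\<close> per step.\<close>

lemma UC_bound: 
  assumes "s \<le> t" "t \<le> s + real n * \<tau>"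
  shows "bounded_by Z ((2 * K) ^ n) (UC t s)"
  using assms
proof (induction n arbitrary: s)
  case 0
  then have "t = s" by simp
  then show ?case
    unfolding bounded_by_def using UC_linear[of s s] UC_same by simp
next
  case (Suc n)
  have 1: "bounded_by Z (2 * K) (UC r s)" if r: "s \<le> r" "r \<le> s + \<tau>" for r
  proof -
    have "norm (UC r s x) \<le> 2 * K * norm x" if x: "x \<in> Z" for x
    proof -
      have "2 * \<delta> (r - s) * (e * (K * norm x)) \<le> 1 * (1 * (K * norm x))"
        using \<delta>_bounds(1,2)[of "r - s"] r e K(1) by (intro mult_mono mult_right_mono) auto
      moreover have "norm (UB r s x) \<le> K * norm x"
        using bounded_byD(2)[OF K(2)[OF r] x] .
      ultimately show ?thesis
        using UC_close_local[OF r x] norm_triangle_sub[of "UC r s x" "UB r s x"] by simp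
    qed
    then show ?thesis using UC_linear[OF r(1)] unfolding bounded_by_def by simp
  qed
  define r where "r = min t (s + \<tau>)"
  have r: "s \<le> r" "r \<le> s + \<tau>" "r \<le> t" "t \<le> r + real n * \<tau>"
    using Suc.prems \<tau> unfolding r_def by (auto simp: algebra_simps min_def)
  have "bounded_by Z ((2 * K) ^ n * (2 * K)) (\<lambda>x. UC t r (UC r s x))"
    by (rule bounded_by_comp[OF 1[OF r(1,2)] Suc.IH[OF r(3,4)]]) (use UC_in_Z r K in auto)
  moreover have "UC t r (UC r s x) = UC t s x" if "x \<in> Z" for x
    by (rule UC_comp[OF r(1,3) that])
  ultimately show ?case
    using UC_linear[OF Suc.prems(1)] unfolding bounded_by_def by (simp add: mult.commute)
qed

text \<open>The error splits at \<open>r\<close> into the error of the initial step, transported by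
  \<open>UC\<close>, and the error of the remaining steps along the \<open>UB\<close>-orbit. Each of
  the \<open>n\<close> steps adds at most \<open>e * K\<close> times the growth over the others, and
  \<open>2 * K\<close> dominates the one-step growth of both families.\<close>

lemma UC_close:
  assumes "s \<le> t" "t \<le> s + real n * \<tau>" "x \<in> Z"
  shows "norm (UC t s x - UB t s x) \<le> real n * (2 * K) ^ n * e * norm x"
  using assms
proof (induction n arbitrary: s x)
  case 0
  then have "t = s" by simp
  then show ?case using UC_same UB_props(3)[OF order_refl] 0 by simp
next
  case (Suc n)
  define r where "r = min t (s + \<tau>)"
  have r: "s \<le> r" "r \<le> s + \<tau>" "r \<le> t" "t \<le> r + real n * \<tau>"
    using Suc.prems \<tau> unfolding r_def by (auto simp: algebra_simps min_def)
  note x = Suc.prems(3)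
  have in_Z: "UC r s x \<in> Z" "UB r s x \<in> Z" using UC_in_Z UB_props(2) r x by auto
  then have dZ: "UC r s x - UB r s x \<in> Z" using Z_subspace by (simp add: subspace_diff)
  have K2n: "0 \<le> (2 * K) ^ n" using K(1) by simp
  have eq: "UC t s x - UB t s x
      = UC t r (UC r s x - UB r s x) + (UC t r (UB r s x) - UB t r (UB r s x))"
    using linear_on_setD(5)[OF UC_linear[OF r(3)] in_Z] UC_comp[OF r(1,3) x]
      UB_props(4)[OF _ r(1,3) x] Suc.prems(1) by simp
  have "norm (UC r s x - UB r s x) \<le> 2 * \<delta> (r - s) * (e * (K * norm x))"
    by (rule UC_close_local[OF r(1,2) x])
  also have "\<dots> \<le> 1 * (e * (K * norm x))"
    using \<delta>_bounds(1,2)[of "r - s"] r e K(1) by (intro mult_mono mult_right_mono) auto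
  finally have 1: "norm (UC r s x - UB r s x) \<le> e * (K * norm x)" by simp
  have "norm (UC t r (UC r s x - UB r s x)) \<le> (2 * K) ^ n * norm (UC r s x - UB r s x)"
    by (rule bounded_byD(2)[OF UC_bound[OF r(3,4)] dZ])
  also have "\<dots> \<le> (2 * K) ^ n * (e * (K * norm x))"
    by (rule mult_left_mono[OF 1 K2n])
  finally have a: "norm (UC t r (UC r s x - UB r s x)) \<le> (2 * K) ^ n * (e * (K * norm x))" .
  have "norm (UC t r (UB r s x) - UB t r (UB r s x)) \<le> real n * (2 * K) ^ n * e * norm (UB r s x)"
    by (rule Suc.IH[OF r(3,4) in_Z(2)])
  also have "\<dots> \<le> real n * (2 * K) ^ n * e * (K * norm x)"
    using bounded_byD(2)[OF K(2)[OF r(1,2)] x] K2n e by (intro mult_left_mono) auto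
  finally have "norm (UC t s x - UB t s x)
      \<le> (2 * K) ^ n * (e * (K * norm x)) + real n * (2 * K) ^ n * e * (K * norm x)"
    unfolding eq using a norm_triangle_mono by blast
  also have "\<dots> = (real (Suc n) * (2 * K) ^ n * e * norm x) * K"
    by (simp add: algebra_simps)
  also have "\<dots> \<le> (real (Suc n) * (2 * K) ^ n * e * norm x) * (2 * K)"
    using K K2n e by (intro mult_left_mono) auto
  also have "\<dots> = real (Suc n) * (2 * K) ^ Suc n * e * norm x"
    by simp
  finally show ?case .
qed

end

text \<open>Near \<open>(t0, s0)\<close> the value is compared with
  \<open>U (max t s0) s0 x\<close>, which is continuous in \<open>t\<close>. The composition law
  writes the difference as an evolution operator applied to a small difference near the diagonal at
  \<open>s0\<close>. The maximum covers \<open>t < s0\<close>, where \<open>U t s0\<close> has no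
  meaning but both times are close to \<open>s0\<close>.\<close>

lemma evolution_jointly_continuous:
  fixes U :: "real \<Rightarrow> real \<Rightarrow> 'a::real_normed_vector \<Rightarrow> 'a"
  assumes Z: "subspace Z" and same: "\<And>t x. x \<in> Z \<Longrightarrow> U t t x = x"
    and comp: "\<And>t r s x. s \<le> r \<Longrightarrow> r \<le> t \<Longrightarrow> x \<in> Z \<Longrightarrow> U t r (U r s x) = U t s x"
    and in_Z: "\<And>t s x. s \<le> t \<Longrightarrow> x \<in> Z \<Longrightarrow> U t s x \<in> Z"
    and bound: "\<And>T. \<exists>K\<ge>0. \<forall>s t. s \<le> t \<longrightarrow> t \<le> s + T \<longrightarrow> bounded_by Z K (U t s)"
    and cont: "\<And>s x. x \<in> Z \<Longrightarrow> continuous_on {s..} (\<lambda>t. U t s x)"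
    and diag: "\<And>s0 x \<eta>. x \<in> Z \<Longrightarrow> 0 < \<eta> \<Longrightarrow>
      \<exists>d>0. \<forall>s t. \<bar>s - s0\<bar> < d \<longrightarrow> \<bar>t - s0\<bar> < d \<longrightarrow> s \<le> t \<longrightarrow> norm (U t s x - x) < \<eta>"
    and x: "x \<in> Z"
  shows "continuous_on {(t, s). s \<le> t} (\<lambda>(t, s). U t s x)"
  unfolding continuous_on_iff
proof (intro ballI allI impI)
  fix p :: "real \<times> real" and \<eta> :: real assume p: "p \<in> {(t, s). s \<le> t}" and \<eta>: "0 < \<eta>"
  obtain t0 s0 where ts0: "p = (t0, s0)" "s0 \<le> t0" using p by auto
  obtain K where K: "0 \<le> K"
    and Kb: "\<And>s t. s \<le> t \<Longrightarrow> t \<le> s + (t0 - s0 + 1) \<Longrightarrow> bounded_by Z K (U t s)"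
    using bound[of "t0 - s0 + 1"] by blast
  \<comment> \<open>\<open>\<mu>\<close> must be small after transport by an operator of bound
    \<open>K\<close>, and also by itself for \<open>t < s0\<close>, where nothing is
    transported.\<close>
  define \<mu> where "\<mu> = \<eta> / (2 * (K + 1))"
  have \<mu>: "0 < \<mu>" "K * \<mu> < \<eta> / 2" "\<mu> \<le> \<eta> / 2"
    using \<eta> K unfolding \<mu>_def by (simp_all add: field_simps)
  obtain d1 where d1: "d1 > 0"
    "\<And>s t. \<bar>s - s0\<bar> < d1 \<Longrightarrow> \<bar>t - s0\<bar> < d1 \<Longrightarrow> s \<le> t \<Longrightarrow> norm (U t s x - x) < \<mu>"
    using diag[OF x \<mu>(1), of s0] by blast
  obtain d2 where d2: "d2 > 0" "\<And>r. s0 \<le> r \<Longrightarrow> \<bar>r - t0\<bar> < d2 \<Longrightarrow> norm (U r s0 x - U t0 s0 x) < \<eta> / 2"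
    using cont[OF x, of s0] \<eta> ts0(2) unfolding continuous_on_iff dist_norm real_norm_def
    by (metis atLeast_iff half_gt_zero)
  define d where "d = min 1 (min d1 d2)"
  have d: "0 < d" "d \<le> 1" "d \<le> d1" "d \<le> d2" using d1 d2 unfolding d_def by auto
  have "norm (U t s x - U t0 s0 x) < \<eta>" if ts: "s \<le> t" "\<bar>t - t0\<bar> < d" "\<bar>s - s0\<bar> < d" for t s
  proof -
    have a: "norm (U (max t s0) s0 x - U t0 s0 x) < \<eta> / 2"
      by (rule d2(2)) (use ts ts0(2) d in \<open>auto simp: max_def\<close>)
    have transported: "norm (U t r (y - z)) < \<eta> / 2"
      if r: "r \<le> t" "s0 \<le> r" and yz: "y \<in> Z" "z \<in> Z" and n: "norm (y - z) < \<mu>" for r y z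
    proof -
      have "t \<le> r + (t0 - s0 + 1)" using ts r d by linarith
      then have "norm (U t r (y - z)) \<le> K * norm (y - z)"
        using bounded_byD(2)[OF Kb[OF r(1)]] subspace_diff[OF Z yz] by simp
      also have "\<dots> \<le> K * \<mu>"
        using n K by (intro mult_left_mono) auto
      finally show ?thesis using \<mu>(2) by simp
    qed
    have diff: "U t r (y - z) = U t r y - U t r z" if "r \<le> t" "s0 \<le> r" "y \<in> Z" "z \<in> Z" for r y z
      using linear_on_setD(5)[OF bounded_byD(1)[OF Kb[OF that(1)]]] that ts d by force
    have b: "norm (U t s x - U (max t s0) s0 x) < \<eta> / 2"
    proof (cases "s0 \<le> t")
      case True
      show ?thesis
      proof (cases "s \<le> s0")
        case s: True
        have "U t s x - U t s0 x = U t s0 (U s0 s x - x)"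
          using diff[OF True order_refl in_Z[OF s x] x] comp[OF s True x] by simp
        moreover have "norm (U s0 s x - x) < \<mu>"
          by (rule d1(2)) (use ts d s in auto)
        ultimately show ?thesis
          using transported[OF True order_refl in_Z[OF s x] x] True by (simp add: max_def)
      next
        case False
        then have s: "s0 \<le> s" by simp
        have "U t s0 x - U t s x = U t s (U s s0 x - x)"
          using diff[OF ts(1) s in_Z[OF s x] x] comp[OF s ts(1) x] by simp
        moreover have "norm (U s s0 x - x) < \<mu>"
          by (rule d1(2)) (use ts d s in auto)
        ultimately show ?thesis
          using transported[OF ts(1) s in_Z[OF s x] x] True
          by (simp add: max_def norm_minus_commute)
      qed
    next
      case False
      have "norm (U t s x - x) < \<mu>"
        by (rule d1(2)) (use ts d ts0(2) False in auto)
      then show ?thesis using False \<mu>(3) same[OF x] by (simp add: max_def)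
    qed
    show ?thesis
      using norm_triangle_lt[of "U t s x - U (max t s0) s0 x" "U (max t s0) s0 x - U t0 s0 x" \<eta>] a b
      by simp
  qed
  note est = this
  show "\<exists>d>0. \<forall>q\<in>{(t, s). s \<le> t}. dist q p < d \<longrightarrow>
      dist (case q of (t, s) \<Rightarrow> U t s x) (case p of (t, s) \<Rightarrow> U t s x) < \<eta>"
  proof (intro exI[of _ d] conjI ballI impI d(1))
    fix q assume q: "q \<in> {(t, s). s \<le> t}" "dist q p < d"
    obtain t s where ts: "q = (t, s)" "s \<le> t" using q by auto
    have "\<bar>t - t0\<bar> < d" "\<bar>s - s0\<bar> < d"
      using q(2) dist_fst_le[of q p] dist_snd_le[of q p] unfolding ts ts0 by (auto simp: dist_real_def)
    from est[OF ts(2) this]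
    show "dist (case q of (t, s) \<Rightarrow> U t s x) (case p of (t, s) \<Rightarrow> U t s x) < \<eta>"
      unfolding ts ts0 by (simp add: dist_norm)
  qed
qed

context close_problem
begin

lemma UC_diagonal:
  assumes x: "x \<in> Z" and \<eta>: "0 < \<eta>"
  shows "\<exists>d>0. \<forall>s t. \<bar>s - s0\<bar> < d \<longrightarrow> \<bar>t - s0\<bar> < d \<longrightarrow> s \<le> t \<longrightarrow> norm (UC t s x - x) < \<eta>"
proof -
  \<comment> \<open>The summand 1 keeps the divisor \<open>c\<close> positive when \<open>e\<close>
    or \<open>x\<close> vanishes.\<close>
  define c where "c = 2 * (e * (K * norm x)) + 1"
  have c: "0 < c" "2 * (e * (K * norm x)) \<le> c" unfolding c_def using e K(1) by (simp_all add: add_nonneg_pos)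
  have "continuous_on {(t, s). s \<le> t} (\<lambda>(t, s). UB t s x)"
    using UB x unfolding generates_evolution_family_def evolution_family_def by blast
  moreover have "(s0, s0) \<in> {(t, s). s \<le> t}" by simp
  ultimately obtain d1 where d1: "d1 > 0"
    "\<And>q. q \<in> {(t, s). s \<le> t} \<Longrightarrow> dist q (s0, s0) < d1 \<Longrightarrow>
        dist (case q of (t, s) \<Rightarrow> UB t s x) (UB s0 s0 x) < \<eta> / 2"
    unfolding continuous_on_iff using half_gt_zero[OF \<eta>] by (metis (no_types, lifting) case_prod_conv)
  have "\<forall>\<^sub>F h in at_right 0. dist (\<delta> h) 0 < \<eta> / (2 * c)"
    using \<delta>_lim c(1) \<eta> by (intro tendstoD) auto
  then obtain d2 where d2: "d2 > 0" "\<And>h. 0 < h \<Longrightarrow> h < d2 \<Longrightarrow> \<bar>\<delta> h\<bar> < \<eta> / (2 * c)"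
    unfolding eventually_at_right_field by auto
  define d where "d = min (d1 / 2) (min (d2 / 2) (\<tau> / 2))"
  have d: "0 < d" "2 * d \<le> d1" "2 * d \<le> d2" "2 * d \<le> \<tau>"
    using d1(1) d2(1) \<tau> unfolding d_def by (auto simp: min_def)
  have "norm (UC t s x - x) < \<eta>" if st: "\<bar>s - s0\<bar> < d" "\<bar>t - s0\<bar> < d" "s \<le> t" for s t
  proof (cases "s < t")
    case True
    have "dist (t, s) (s0, s0) \<le> \<bar>t - s0\<bar> + \<bar>s - s0\<bar>"
      unfolding dist_Pair_Pair dist_real_def by (rule order_trans[OF sqrt_sum_squares_le_sum_abs]) simp
    then have "dist (t, s) (s0, s0) < d1" using st d by linarith
    then have 1: "norm (UB t s x - x) < \<eta> / 2"
      using d1(2)[of "(t, s)"] st UB_props(3)[OF order_refl x] by (simp add: dist_norm)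
    have t: "t \<le> s + \<tau>" using st d by linarith
    have "\<delta> (t - s) < \<eta> / (2 * c)"
      using d2(2)[of "t - s"] True st d by linarith
    then have "\<delta> (t - s) * c < \<eta> / 2"
      using c(1) by (simp add: field_simps)
    moreover have "2 * \<delta> (t - s) * (e * (K * norm x)) \<le> \<delta> (t - s) * c"
      using mult_left_mono[OF c(2) \<delta>_nonneg[of "t - s"]] True by simp
    ultimately have "norm (UC t s x - UB t s x) < \<eta> / 2"
      using UC_close_local[OF st(3) t x] by linarith
    then show ?thesis
      using norm_triangle_lt[of "UC t s x - UB t s x" "UB t s x - x" \<eta>] 1 by simp
  next
    case False
    then have "t = s" using st by simp
    then show ?thesis using UC_same[OF x] \<eta> by simp
  qed
  then show ?thesis using d(1) by blast
qed

lemma UC_bound_exists: "\<exists>K'\<ge>0. \<forall>s t. s \<le> t \<longrightarrow> t \<le> s + T \<longrightarrow> bounded_by Z K' (UC t s)"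
proof -
  obtain n where "T / \<tau> \<le> real n" using real_arch_simple by blast
  then have "T \<le> real n * \<tau>" using \<tau> by (simp add: field_simps)
  then show ?thesis
    using UC_bound[of _ _ n] K(1) by (intro exI[of _ "(2 * K) ^ n"]) auto
qed

lemma UC_generates: "generates_evolution_family D A C UC"
proof -
  have mild: "mild_solution D A C t0 x (\<lambda>t. UC t t0 x)" if "x \<in> Z" for t0 x
    unfolding mild_solution_iff_integrated_solution using UC_solution[OF that] by blast
  have "UC t s \<in> bounded_ops Z Z" if st: "s \<le> t" for t s
  proof -
    obtain K' where K': "\<forall>s' t'. s' \<le> t' \<longrightarrow> t' \<le> s' + (t - s) \<longrightarrow> bounded_by Z K' (UC t' s')"
      using UC_bound_exists[of "t - s"] by blast
    have "bounded_by Z K' (UC t s)" using K' st by simp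
    then show ?thesis
      by (rule bounded_by_imp_bounded_ops) (use UC_in_Z st in auto)
  qed
  moreover have "continuous_on {(t, s). s \<le> t} (\<lambda>(t, s). UC t s x)" if "x \<in> Z" for x
    by (rule evolution_jointly_continuous[OF Z_subspace UC_same UC_comp UC_in_Z UC_bound_exists _
          UC_diagonal that]) (use mild in \<open>auto simp: mild_solution_def\<close>)
  ultimately have "evolution_family Z UC"
    using UC_same UC_comp unfolding evolution_family_def by simp
  moreover have "v t = UC t t0 x" if "mild_solution D A C t0 x v" "t0 \<le> t" for t0 x v t
    using that UC_eq[of t0 t x v t] unfolding mild_solution_iff_integrated_solution by simp
  ultimately show ?thesis
    using mild unfolding generates_evolution_family_def by blast
qed

end

subsection \<open>Roughness of discrete dichotomies\<close>

text \<open>\<open>T\<close> is the unperturbed step and \<open>S\<close> the perturbed one.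
  \<open>R n\<close> is the backward step from \<open>n + 1\<close> to \<open>n\<close>: it inverts
  \<open>T n\<close> between the ranges of \<open>Q n\<close> and \<open>Q (n + 1)\<close>, and by
  \<open>RQ\<close> it annihilates the stable part. As \<open>\<kappa>\<close> bounds
  \<open>P\<close>, the product \<open>\<kappa> * \<eta>\<close> measures the perturbation after
  projection.\<close>

locale discrete_dichotomy =
  fixes Z :: "'a::banach set" and S T P Q R :: "int \<Rightarrow> 'a \<Rightarrow> 'a" and \<kappa> \<eta> :: real
  assumes closed_Z: "closed Z" and subspace_Z: "subspace Z"
    and PQ: "x \<in> Z \<Longrightarrow> P n x + Q n x = x"
    and P: "bounded_by Z \<kappa> (P n)" "x \<in> Z \<Longrightarrow> P n x \<in> Z" "x \<in> Z \<Longrightarrow> P n (P n x) = P n x"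
    and S: "S n \<in> bounded_ops Z Z" and T: "T n \<in> bounded_ops Z Z"
    and R: "bounded_by Z (1/8) (R n)" "x \<in> Z \<Longrightarrow> R n x \<in> Z"
    and TP: "x \<in> Z \<Longrightarrow> norm (T n (P n x)) \<le> 1/8 * norm x"
    and PT: "x \<in> Z \<Longrightarrow> P (n + 1) (T n x) = T n (P n x)"
    and RTQ: "x \<in> Z \<Longrightarrow> R n (T n (Q n x)) = Q n x"
    and TR: "x \<in> Z \<Longrightarrow> T n (R n x) = Q (n + 1) x"
    and QR: "x \<in> Z \<Longrightarrow> Q n (R n x) = R n x"
    and RQ: "x \<in> Z \<Longrightarrow> R n (Q (n + 1) x) = R n x"
    and close: "x \<in> Z \<Longrightarrow> norm (S n x - T n x) \<le> \<eta> * norm x"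
    and small: "1 \<le> \<kappa>" "0 \<le> \<eta>" "\<kappa> * \<eta> \<le> 1/16"
begin

lemma Q_eq: "x \<in> Z \<Longrightarrow> Q n x = x - P n x"
  using PQ by (metis add_diff_cancel_left')

lemma \<eta>_le: "\<eta> \<le> 1/16"
  using mult_right_mono[OF small(1,2)] small(3) by simp

definition E where "E n x = S n x - T n x"

text \<open>The recursion \<open>x (n + 1) = S n (x n) + y (n + 1)\<close> in fixed-point form: the stable component
  is propagated forward from \<open>n - 1\<close>, the unstable one backward from \<open>n + 1\<close>.\<close>

definition F where
  "F y x n = T (n - 1) (P (n - 1) (x (n - 1))) + P n (E (n - 1) (x (n - 1)) + y n)
     + R n (x (n + 1) - E n (x n) - y (n + 1))"

lemmas T_lin = linear_on_setD[OF bounded_opsD(1)[OF T]]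
lemmas lin = linear_on_setD[OF bounded_byD(1)]

lemma E_props: "bounded_by Z \<eta> (E n)" "x \<in> Z \<Longrightarrow> E n x \<in> Z"
proof -
  obtain c d where "bounded_by Z c (S n)" "bounded_by Z d (T n)"
    using bounded_ops_imp_bounded_by[OF S] bounded_ops_imp_bounded_by[OF T] by blast
  from bounded_byD(1)[OF bounded_by_diff[OF this]] have "linear_on_set Z (E n)"
    unfolding E_def[abs_def] .
  then show "bounded_by Z \<eta> (E n)"
    unfolding bounded_by_def using close by (simp add: E_def)
  show "x \<in> Z \<Longrightarrow> E n x \<in> Z"
    unfolding E_def using bounded_opsD(2)[OF S] bounded_opsD(2)[OF T] subspace_Z by (simp add: subspace_diff)
qed

lemmas in_Z = P(2) bounded_opsD(2)[OF S] bounded_opsD(2)[OF T] R(2) E_props(2) subspace_add[OF subspace_Z] subspace_diff[OF subspace_Z]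

lemma S_eq: "S n x = T n x + E n x"
  unfolding E_def by simp

lemma Q_add: "x \<in> Z \<Longrightarrow> y \<in> Z \<Longrightarrow> Q n (x + y) = Q n x + Q n y"
  by (simp add: Q_eq lin(2)[OF P(1)] in_Z)

lemma QT: "x \<in> Z \<Longrightarrow> Q (n + 1) (T n x) = T n (Q n x)"
  using Q_eq PT T_lin(5) in_Z by simp

lemma Q_in_Z: "x \<in> Z \<Longrightarrow> Q n x \<in> Z"
  using Q_eq in_Z by simp

lemma QQ: "x \<in> Z \<Longrightarrow> Q n (Q n x) = Q n x"
  using Q_eq Q_eq[of "x - P n x"] lin(5)[OF P(1)] P(3) in_Z by simp

lemma PQ0: "x \<in> Z \<Longrightarrow> P n (Q n x) = 0"
  using Q_eq lin(5)[OF P(1)] P(3) in_Z by simp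

text \<open>Applying \<open>P (n + 1)\<close> to the recursion gives its stable half, and
  \<open>R n\<close> solves the unstable half for \<open>Q n (x n)\<close>. Conversely,
  \<open>P\<close> fixes the first two summands of a fixed point and kills the last, so they are its
  components; \<open>T n\<close> applied to the unstable one restores that half of the
  recursion.\<close>

lemma F_eq_iff_recursion:
  assumes x: "\<And>n. x n \<in> Z" and y: "\<And>n. y n \<in> Z"
  shows "(\<forall>n. x n = F y x n) \<longleftrightarrow> (\<forall>n. x (n + 1) = S n (x n) + y (n + 1))"
proof
  assume rec: "\<forall>n. x (n + 1) = S n (x n) + y (n + 1)"
  show "\<forall>n. x n = F y x n"
  proof
    fix n
    have "x n = T (n - 1) (x (n - 1)) + (E (n - 1) (x (n - 1)) + y n)"
      using rec[rule_format, of "n - 1"] S_eq by simp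
    then have p: "P n (x n) = T (n - 1) (P (n - 1) (x (n - 1))) + P n (E (n - 1) (x (n - 1)) + y n)"
      using lin(2)[OF P(1)] PT[of "x (n - 1)" "n - 1"] x y in_Z by simp
    have "x (n + 1) - E n (x n) - y (n + 1) = T n (x n)"
      using rec S_eq by simp
    then have "R n (x (n + 1) - E n (x n) - y (n + 1)) = R n (Q (n + 1) (T n (x n)))"
      using RQ[of "T n (x n)"] in_Z x by simp
    also have "\<dots> = Q n (x n)"
      using QT RTQ x by simp
    finally show "x n = F y x n"
      unfolding F_def using p PQ[OF x] by metis
  qed
next
  assume fp: "\<forall>n. x n = F y x n"
  show "\<forall>n. x (n + 1) = S n (x n) + y (n + 1)"
  proof
    fix n
    define a where "a k = T (k - 1) (P (k - 1) (x (k - 1))) + P k (E (k - 1) (x (k - 1)) + y k)" for k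
    define r where "r k = R k (x (k + 1) - E k (x k) - y (k + 1))" for k
    have xk: "x k = a k + r k" for k
      using fp unfolding F_def a_def r_def by blast
    have aZ: "a k \<in> Z" and rZ: "r k \<in> Z" for k
      unfolding a_def r_def using x y in_Z by simp_all
    have Pa: "P k (a k) = a k" for k
      unfolding a_def
      using lin(2)[OF P(1)] PT[of "P (k - 1) (x (k - 1))" "k - 1"] P(3) x y in_Z by simp
    have Pr: "P k (r k) = 0" for k
    proof -
      have "Q k (r k) = r k" unfolding r_def by (rule QR) (use x y in_Z in simp)
      with PQ0[OF rZ, of k k] show ?thesis by simp
    qed
    have Sx: "S n (x n) = T n (x n) + E n (x n)" by (rule S_eq)
    have Px: "P k (x k) = a k" for k
      using xk lin(2)[OF P(1) aZ rZ] Pa Pr by simp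
    then have Qx: "Q k (x k) = r k" for k
      using Q_eq[OF x] xk by (metis add_diff_cancel_left')
    have "T n (Q n (x n)) = Q (n + 1) (x (n + 1) - E n (x n) - y (n + 1))"
      unfolding Qx unfolding r_def using TR x y in_Z by simp
    then have "Q (n + 1) (T n (x n)) = Q (n + 1) (x (n + 1) - E n (x n) - y (n + 1))"
      using QT x by simp
    then have "Q (n + 1) (T n (x n)) + Q (n + 1) (E n (x n)) + Q (n + 1) (y (n + 1)) = Q (n + 1) (x (n + 1))"
      using Q_add[of "x (n + 1) - E n (x n) - y (n + 1)" "E n (x n)" "n + 1"]
        Q_add[of "x (n + 1) - y (n + 1)" "y (n + 1)" "n + 1"] x y in_Z
      by (simp add: algebra_simps)
    then have q: "Q (n + 1) (S n (x n) + y (n + 1)) = Q (n + 1) (x (n + 1))"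
      using Q_add x y in_Z by (simp add: Sx)
    have "P (n + 1) (x (n + 1)) = P (n + 1) (S n (x n) + y (n + 1))"
      unfolding Px unfolding a_def using lin(2)[OF P(1)] PT x y in_Z by (simp add: Sx)
    with q show "x (n + 1) = S n (x n) + y (n + 1)"
      using PQ[of "x (n + 1)" "n + 1"] PQ[of "S n (x n) + y (n + 1)" "n + 1"] x y in_Z by metis
  qed
qed

lemma F_in_Z: "(\<And>n. x n \<in> Z) \<Longrightarrow> (\<And>n. y n \<in> Z) \<Longrightarrow> F y x n \<in> Z"
  unfolding F_def using in_Z by simp

text \<open>The left neighbour contributes \<open>1/8\<close> by contraction on the stable part and
  \<open>1/16\<close> from \<open>\<kappa> * \<eta>\<close>; the right one contributes
  \<open>1/8\<close> through \<open>R\<close>; at \<open>n\<close> itself the perturbation passes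
  through \<open>R\<close>, giving \<open>1/8 * 1/16\<close>. The sum \<open>41/128\<close> leaves
  room for doubling the two outer coefficients.\<close>

lemma F_lipschitz:
  assumes x: "\<And>n. x n \<in> Z" and x': "\<And>n. x' n \<in> Z" and y: "\<And>n. y n \<in> Z"
  shows "norm (F y x n - F y x' n) \<le> 3/16 * norm (x (n - 1) - x' (n - 1))
     + 1/8 * norm (x (n + 1) - x' (n + 1)) + 1/128 * norm (x n - x' n)"
proof -
  define d where "d k = x k - x' k" for k
  have d: "d k \<in> Z" for k unfolding d_def using x x' in_Z by simp
  have eq: "F y x n - F y x' n
      = T (n - 1) (P (n - 1) (d (n - 1))) + P n (E (n - 1) (d (n - 1))) + R n (d (n + 1)) - R n (E n (d n))"
    unfolding F_def d_def using x x' y in_Z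
    by (simp add: lin(2)[OF P(1)] lin(5)[OF P(1)] T_lin(5) lin(5)[OF E_props(1)] lin(5)[OF R(1)])
  have 1: "norm (T (n - 1) (P (n - 1) (d (n - 1)))) \<le> 1/8 * norm (d (n - 1))"
    using TP d by simp
  have "norm (P n (E (n - 1) (d (n - 1)))) \<le> \<kappa> * norm (E (n - 1) (d (n - 1)))"
    using bounded_byD(2)[OF P(1)] d in_Z by simp
  also have "\<dots> \<le> \<kappa> * (\<eta> * norm (d (n - 1)))"
    using bounded_byD(2)[OF E_props(1)] d small by (intro mult_left_mono) auto
  also have "\<dots> \<le> 1/16 * norm (d (n - 1))"
    using mult_right_mono[OF small(3), of "norm (d (n - 1))"] by (simp add: mult.assoc)
  finally have 2: "norm (P n (E (n - 1) (d (n - 1)))) \<le> 1/16 * norm (d (n - 1))" .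
  have 3: "norm (R n (d (n + 1))) \<le> 1/8 * norm (d (n + 1))"
    using bounded_byD(2)[OF R(1)] d by simp
  have "norm (R n (E n (d n))) \<le> 1/8 * norm (E n (d n))"
    using bounded_byD(2)[OF R(1)] d in_Z by simp
  also have "norm (E n (d n)) \<le> \<eta> * norm (d n)"
    using bounded_byD(2)[OF E_props(1)] d by simp
  also have "\<eta> * norm (d n) \<le> 1/16 * norm (d n)"
    by (intro mult_right_mono \<eta>_le) auto
  finally have 4: "norm (R n (E n (d n))) \<le> 1/128 * norm (d n)" by simp
  have "norm (F y x n - F y x' n) \<le> norm (T (n - 1) (P (n - 1) (d (n - 1))))
      + norm (P n (E (n - 1) (d (n - 1)))) + norm (R n (d (n + 1))) + norm (R n (E n (d n)))"
    unfolding eq by (meson add_mono norm_triangle_ineq norm_triangle_ineq4 order_refl order_trans)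
  then show ?thesis using 1 2 3 4 unfolding d_def by simp
qed

text \<open>The orbit and the zero sequence are both fixed points of \<open>F\<close> without a
  pulse, so every use of the Lipschitz estimate shrinks the common bound by a fixed factor.\<close>

lemma bounded_orbit_zero:
  assumes x: "\<And>n. x n \<in> Z" and rec: "\<And>n. x (n + 1) = S n (x n)" and M: "\<And>n. norm (x n) \<le> M"
  shows "x n = 0"
proof -
  have Z0: "0 \<in> Z" using subspace_0[OF subspace_Z] .
  have fp: "x n = F (\<lambda>_. 0) x n" for n
    using F_eq_iff_recursion[of x "\<lambda>_. 0"] x Z0 rec by simp
  have F0: "F (\<lambda>_. 0) (\<lambda>_. 0) n = 0" for n
    unfolding F_def by (simp add: lin(4)[OF P(1)] T_lin(4) lin(4)[OF E_props(1)] lin(4)[OF R(1)])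
  have "norm (x n) \<le> (3/4) ^ k * M" for k n
  proof (induction k arbitrary: n)
    case (Suc k)
    have "norm (x n) \<le> 3/16 * norm (x (n - 1)) + 1/8 * norm (x (n + 1)) + 1/128 * norm (x n)"
      using F_lipschitz[OF x Z0 Z0, of "\<lambda>n. n" n] fp[of n] F0 by simp
    also have "\<dots> \<le> 3/16 * ((3/4) ^ k * M) + 1/8 * ((3/4) ^ k * M) + 1/128 * ((3/4) ^ k * M)"
      by (intro add_mono mult_left_mono Suc.IH) auto
    also have "\<dots> = (41/128) * ((3/4) ^ k * M)" by simp
    also have "\<dots> \<le> (3/4) * ((3/4) ^ k * M)"
      using order_trans[OF norm_ge_zero M] by (intro mult_right_mono) auto
    finally show ?case by simp
  qed (use M in simp)
  moreover have "(\<lambda>k. (3/4) ^ k * M) \<longlonglongrightarrow> 0"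
    by (intro tendsto_mult_left_zero LIMSEQ_power_zero) auto
  ultimately have "norm (x n) \<le> 0"
    by (intro LIMSEQ_le_const[where X = "\<lambda>k. (3/4) ^ k * M" and x = 0]) auto
  then show ?thesis by simp
qed

text \<open>Picard iteration from the zero sequence, measured against weights \<open>w n\<close>
  that at most double between neighbours. The contraction factor becomes
  \<open>2 * (3/16 + 1/8) + 1/128 = 81/128\<close>, below \<open>3/4\<close>, and the limit inherits
  the decay away from the pulse.\<close>

lemma pulse_response:
  assumes z: "z \<in> Z"
  obtains x where "\<And>n. x n \<in> Z" "\<And>n. x n = S (n - 1) (x (n - 1)) + (if n = 0 then z else 0)"
    "\<And>n. norm (x n) \<le> 8 * \<kappa> * (1/2) ^ nat \<bar>n\<bar> * norm z"
proof -
  have Z0: "0 \<in> Z" using subspace_0[OF subspace_Z] .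
  define y where "y n = (if n = 0 then z else 0)" for n :: int
  define w where "w n = (1/2 :: real) ^ nat \<bar>n\<bar>" for n :: int
  have yZ: "y n \<in> Z" for n unfolding y_def using z Z0 by simp
  have w: "0 \<le> w n" "w (n - 1) \<le> 2 * w n" "w (n + 1) \<le> 2 * w n" for n
  proof -
    show "0 \<le> w n" unfolding w_def by simp
    have le: "w m \<le> 2 * w n" if "\<bar>n\<bar> \<le> \<bar>m\<bar> + 1" for m n
    proof -
      have "(1/2 :: real) ^ Suc (nat \<bar>m\<bar>) \<le> (1/2) ^ nat \<bar>n\<bar>"
        by (rule power_decreasing) (use that in auto)
      then show ?thesis unfolding w_def by simp
    qed
    show "w (n - 1) \<le> 2 * w n" "w (n + 1) \<le> 2 * w n" by (rule le; simp)+
  qed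
  \<comment> \<open>The initial iterate lives at 0 and -1 only. At -1 the weight is
    \<open>1/2\<close>, so the factor 2 leaves \<open>\<kappa> * norm z\<close> there.\<close>
  define c where "c = 2 * \<kappa> * norm z"
  have c: "0 \<le> c" unfolding c_def using small by simp
  define X where "X k = (F y ^^ k) (\<lambda>_. 0)" for k
  have X0: "X 0 = (\<lambda>_. 0)" and XS: "X (Suc k) = F y (X k)" for k
    unfolding X_def by auto
  have XZ: "X k n \<in> Z" for k n
    by (induction k arbitrary: n) (simp_all add: X0 XS Z0 F_in_Z yZ)
  have diff: "norm (X (Suc k) n - X k n) \<le> c * w n * (3/4) ^ k" for k n
  proof (induction k arbitrary: n)
    case 0
    have eq: "X (Suc 0) n = P n (y n) + R n (- y (n + 1))"
      unfolding XS X0 F_def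
      by (simp add: lin(4)[OF P(1)] T_lin(4) lin(4)[OF E_props(1)])
    consider "n = 0" | "n = -1" | "n \<noteq> 0" "n \<noteq> -1" by blast
    then show ?case
    proof cases
      case 1
      have "norm (P 0 z) \<le> \<kappa> * norm z" using bounded_byD(2)[OF P(1) z] .
      also have "\<dots> \<le> c" unfolding c_def using small by simp
      finally show ?thesis
        using 1 unfolding eq X0 by (simp add: y_def w_def lin(4)[OF R(1)])
    next
      case 2
      have "norm (R (-1) (- z)) \<le> 1/8 * norm z"
        using bounded_byD(2)[OF R(1), of "- z"] subspace_neg[OF subspace_Z z] by simp
      also have "\<dots> \<le> \<kappa> * norm z" using small by (intro mult_right_mono) auto
      finally show ?thesis
        using 2 unfolding eq X0 by (simp add: y_def w_def c_def lin(4)[OF P(1)])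
    next
      case 3
      then have "n + 1 \<noteq> 0" by simp
      with 3 show ?thesis
        unfolding eq X0 using c w(1) by (simp add: y_def lin(4)[OF P(1)] lin(4)[OF R(1)])
    qed
  next
    case (Suc k)
    let ?D = "\<lambda>n. norm (X (Suc k) n - X k n)"
    have IH: "?D m \<le> c * (3/4) ^ k * w m" for m
      using Suc.IH[of m] by (simp add: mult_ac)
    have ck: "0 \<le> c * (3/4) ^ k" using c by simp
    have IH2: "?D m \<le> c * (3/4) ^ k * (2 * w n)" if "w m \<le> 2 * w n" for m
      using order_trans[OF IH mult_left_mono[OF that ck]] .
    have "norm (X (Suc (Suc k)) n - X (Suc k) n) \<le> 3/16 * ?D (n - 1) + 1/8 * ?D (n + 1) + 1/128 * ?D n"
      unfolding XS[of "Suc k"] unfolding XS[of k, symmetric] by (subst (2) XS) (rule F_lipschitz[OF XZ XZ yZ])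
    also have "\<dots> \<le> 3/16 * (c * (3/4) ^ k * (2 * w n)) + 1/8 * (c * (3/4) ^ k * (2 * w n))
        + 1/128 * (c * (3/4) ^ k * w n)"
      by (intro add_mono mult_left_mono IH IH2 w) auto
    also have "\<dots> = (81/128) * (c * (3/4) ^ k * w n)" by simp
    also have "\<dots> \<le> (3/4) * (c * (3/4) ^ k * w n)"
      using ck w(1) by (intro mult_right_mono) auto
    finally show ?case by (simp add: mult_ac)
  qed
  define x where "x n = (\<Sum>k. X (Suc k) n - X k n)" for n
  have geo: "summable (\<lambda>k. c * w n * (3/4) ^ k)" for n
    by (intro summable_mult summable_geometric) auto
  have lim: "(\<lambda>k. X k n) \<longlonglongrightarrow> x n" for n
  proof -
    have "summable (\<lambda>k. X (Suc k) n - X k n)"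
      by (rule summable_comparison_test[OF _ geo[of n]]) (use diff in auto)
    then have "(\<lambda>k. \<Sum>j<k. X (Suc j) n - X j n) \<longlonglongrightarrow> x n"
      unfolding x_def by (rule summable_LIMSEQ)
    then show ?thesis
      using sum_lessThan_telescope[of "\<lambda>k. X k n"] X0 by simp
  qed
  have xZ: "x n \<in> Z" for n
    by (rule closed_sequentially[OF closed_Z XZ lim])
  have "x n = F y x n" for n
  proof (rule LIMSEQ_unique)
    show "(\<lambda>k. X (Suc k) n) \<longlonglongrightarrow> x n" by (rule LIMSEQ_Suc[OF lim])
    have op: "(\<lambda>k. f (g k)) \<longlonglongrightarrow> f l"
      if "bounded_by Z a f" "g \<longlonglongrightarrow> l" "\<And>k. g k \<in> Z" "l \<in> Z" for a g l and f :: "'a \<Rightarrow> 'a"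
      by (rule bounded_by_tendsto_const[OF that(1,2)]) (use that in auto)
    obtain c where c: "bounded_by Z c (T (n - 1))"
      using bounded_ops_imp_bounded_by[OF T] by blast
    show "(\<lambda>k. X (Suc k) n) \<longlonglongrightarrow> F y x n"
      unfolding XS F_def
      by (intro tendsto_add op[OF c] op[OF P(1)] op[OF R(1)] op[OF E_props(1)] tendsto_diff lim
          tendsto_const) (use XZ xZ yZ in_Z in simp_all)
  qed
  then have "\<forall>n. x (n + 1) = S n (x n) + y (n + 1)"
    using F_eq_iff_recursion[of x y] xZ yZ by simp
  then have rec: "x n = S (n - 1) (x (n - 1)) + (if n = 0 then z else 0)" for n
    unfolding y_def by (metis diff_add_cancel)
  have "norm (x n) \<le> 8 * \<kappa> * (1/2) ^ nat \<bar>n\<bar> * norm z" for n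
  proof -
    have "norm (x n) \<le> (\<Sum>k. c * w n * (3/4) ^ k)"
      unfolding x_def by (rule norm_suminf_le[OF diff geo])
    \<comment> \<open>The geometric series of ratio \<open>3/4\<close> sums to 4, which turns
      \<open>2 * \<kappa>\<close> into \<open>8 * \<kappa>\<close>.\<close>
    also have "\<dots> = 8 * \<kappa> * (1/2) ^ nat \<bar>n\<bar> * norm z"
      by (simp add: suminf_mult suminf_geometric c_def w_def)
    finally show ?thesis .
  qed
  with xZ rec show ?thesis by (rule that)
qed

end

subsection \<open>Dichotomy from bounded responses to pulses\<close>

locale pulse_family =
  fixes Z :: "'a::banach set" and V :: "real \<Rightarrow> real \<Rightarrow> 'a \<Rightarrow> 'a" and L G K :: real
  assumes subspace_Z: "subspace Z" and V: "evolution_family Z V"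
    and L: "0 < L" and G: "1 \<le> G" and K: "1 \<le> K"
    and bound: "\<And>s t. s \<le> t \<Longrightarrow> t \<le> s + L \<Longrightarrow> bounded_by Z K (V t s)"
    and pulse: "\<And>\<theta> z. z \<in> Z \<Longrightarrow> \<exists>x :: int \<Rightarrow> 'a. (\<forall>n. x n \<in> Z) \<and>
      (\<forall>n. x n = V (\<theta> + of_int n * L) (\<theta> + of_int (n - 1) * L) (x (n - 1)) + (if n = 0 then z else 0)) \<and>
      (\<forall>n. norm (x n) \<le> G * (1/2) ^ nat \<bar>n\<bar> * norm z)"
    and orbit_zero: "\<And>\<theta> (x :: int \<Rightarrow> 'a) M n. (\<And>n. x n \<in> Z) \<Longrightarrow>
      (\<And>n. x n = V (\<theta> + of_int n * L) (\<theta> + of_int (n - 1) * L) (x (n - 1))) \<Longrightarrow>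
      (\<And>n. norm (x n) \<le> M) \<Longrightarrow> x n = 0"
begin

definition g :: "real \<Rightarrow> int \<Rightarrow> real" where "g \<theta> n = \<theta> + of_int n * L"

lemma g_0 [simp]: "g \<theta> 0 = \<theta>"
  unfolding g_def by simp

lemma g_mono: "m \<le> n \<Longrightarrow> g \<theta> m \<le> g \<theta> n"
  unfolding g_def using L by simp

lemma Z0: "0 \<in> Z"
  by (rule subspace_0[OF subspace_Z])

lemma V_props:
  assumes "s \<le> t"
  shows "linear_on_set Z (V t s)" "x \<in> Z \<Longrightarrow> V t s x \<in> Z" "x \<in> Z \<Longrightarrow> V t t x = x"
    "s \<le> r \<Longrightarrow> r \<le> t \<Longrightarrow> x \<in> Z \<Longrightarrow> V t r (V r s x) = V t s x"
proof -
  have op: "V t s \<in> bounded_ops Z Z"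
    using V assms unfolding evolution_family_def by blast
  show "linear_on_set Z (V t s)" "x \<in> Z \<Longrightarrow> V t s x \<in> Z"
    using bounded_opsD[OF op] by auto
  show "x \<in> Z \<Longrightarrow> V t t x = x"
    "s \<le> r \<Longrightarrow> r \<le> t \<Longrightarrow> x \<in> Z \<Longrightarrow> V t r (V r s x) = V t s x"
    using V unfolding evolution_family_def by auto
qed

lemmas V_lin = linear_on_setD[OF V_props(1)]

lemma V_bound_steps:
  assumes "s \<le> t" "t \<le> s + real n * L"
  shows "bounded_by Z (K ^ n) (V t s)"
  using assms
proof (induction n arbitrary: s)
  case 0
  then have "t = s" by simp
  then show ?case
    using V_props(1,3)[of t t] unfolding bounded_by_def by simp
next
  case (Suc n)
  define r where "r = min t (s + L)"
  have r: "s \<le> r" "r \<le> s + L" "r \<le> t" "t \<le> r + real n * L"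
    using Suc.prems L unfolding r_def by (auto simp: algebra_simps min_def)
  have "bounded_by Z (K ^ n * K) (\<lambda>x. V t r (V r s x))"
    by (rule bounded_by_comp[OF bound[OF r(1,2)] Suc.IH[OF r(3,4)]]) (use V_props(2) r K in auto)
  then show ?case
    unfolding power_Suc2 by (rule bounded_by_cong) (rule V_props(4)[OF Suc.prems(1) r(1,3)])
qed

lemma V_bound_exists: "\<exists>K'\<ge>0. \<forall>s t. s \<le> t \<longrightarrow> t \<le> s + T \<longrightarrow> bounded_by Z K' (V t s)"
proof -
  obtain n where "T / L \<le> real n" using real_arch_simple by blast
  then have "T \<le> real n * L" using L by (simp add: field_simps)
  then show ?thesis
    using V_bound_steps[of _ _ n] K by (intro exI[of _ "K ^ n"]) auto
qed

text \<open>Boundedness alone already gives uniqueness and is simple to verify for sequences built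
  by linear combination, cutting off or transport; the geometric decay is recovered from
  \<open>pulse\<close>.\<close>

definition response :: "real \<Rightarrow> 'a \<Rightarrow> (int \<Rightarrow> 'a) \<Rightarrow> bool" where
  "response \<theta> z x \<longleftrightarrow> (\<forall>n. x n \<in> Z) \<and>
     (\<forall>n. x n = V (g \<theta> n) (g \<theta> (n - 1)) (x (n - 1)) + (if n = 0 then z else 0)) \<and>
     (\<exists>M. \<forall>n. norm (x n) \<le> M)"

lemma responseI:
  assumes "\<And>n. x n \<in> Z"
    and "\<And>n. x n = V (g \<theta> n) (g \<theta> (n - 1)) (x (n - 1)) + (if n = 0 then z else 0)"
    and "\<And>n. norm (x n) \<le> M"
  shows "response \<theta> z x"
  using assms unfolding response_def by blast

lemma responseD:
  assumes "response \<theta> z x"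
  shows "x n \<in> Z"
    and "x n = V (g \<theta> n) (g \<theta> (n - 1)) (x (n - 1)) + (if n = 0 then z else 0)"
    and "\<exists>M. \<forall>n. norm (x n) \<le> M"
  using assms unfolding response_def by blast+

lemma g_pred: "g \<theta> (n - 1) \<le> g \<theta> n"
  by (rule g_mono) simp

lemma response_zero:
  assumes "response \<theta> 0 x" shows "x n = 0"
proof -
  note x = responseD[OF assms]
  obtain M where M: "\<And>n. norm (x n) \<le> M" using x(3) by blast
  show ?thesis
  proof (rule orbit_zero[OF x(1) _ M])
    show "x n = V (\<theta> + of_int n * L) (\<theta> + of_int (n - 1) * L) (x (n - 1))" for n
      using x(2)[of n] unfolding g_def by simp
  qed
qed

lemma response_add:
  assumes x: "response \<theta> z x" and y: "response \<theta> w y"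
  shows "response \<theta> (z + w) (\<lambda>n. x n + y n)"
proof -
  obtain M N where MN: "\<And>n. norm (x n) \<le> M" "\<And>n. norm (y n) \<le> N"
    using responseD(3)[OF x] responseD(3)[OF y] by blast
  show ?thesis
  proof (rule responseI)
    show "x n + y n \<in> Z" for n
      using responseD(1)[OF x] responseD(1)[OF y] subspace_add[OF subspace_Z] by blast
    show "x n + y n = V (g \<theta> n) (g \<theta> (n - 1)) (x (n - 1) + y (n - 1)) + (if n = 0 then z + w else 0)" for n
      using responseD(2)[OF x, of n] responseD(2)[OF y, of n]
        V_lin(2)[OF g_pred responseD(1)[OF x] responseD(1)[OF y], of \<theta> n "n - 1" "n - 1"]
      by (simp split: if_splits)
    show "norm (x n + y n) \<le> M + N" for n
      by (rule norm_triangle_mono[OF MN])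
  qed
qed

lemma response_scale:
  assumes x: "response \<theta> z x"
  shows "response \<theta> (c *\<^sub>R z) (\<lambda>n. c *\<^sub>R x n)"
proof -
  obtain M where M: "\<And>n. norm (x n) \<le> M" using responseD(3)[OF x] by blast
  show ?thesis
  proof (rule responseI)
    show "c *\<^sub>R x n \<in> Z" for n
      using responseD(1)[OF x] subspace_scale[OF subspace_Z] by blast
    show "c *\<^sub>R x n = V (g \<theta> n) (g \<theta> (n - 1)) (c *\<^sub>R x (n - 1)) + (if n = 0 then c *\<^sub>R z else 0)" for n
      using arg_cong[OF responseD(2)[OF x, of n], of "scaleR c"]
        V_lin(3)[OF g_pred responseD(1)[OF x], of \<theta> n c "n - 1"]
      by (simp add: scaleR_add_right split: if_splits)
    show "norm (c *\<^sub>R x n) \<le> \<bar>c\<bar> * M" for n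
      using M by (simp add: mult_left_mono)
  qed
qed

lemma response_unique:
  assumes "response \<theta> z x" "response \<theta> z y"
  shows "x n = y n"
  using response_zero[of \<theta> "\<lambda>n. x n + (-1) *\<^sub>R y n" n]
    response_add[OF assms(1) response_scale[OF assms(2), of "-1"]] by simp

section \<open>Projections and backward orbits read off from the response\<close>

definition res :: "real \<Rightarrow> 'a \<Rightarrow> int \<Rightarrow> 'a" where
  "res \<theta> z = (SOME x. response \<theta> z x)"

definition P :: "real \<Rightarrow> 'a \<Rightarrow> 'a" where "P \<theta> z = res \<theta> z 0"

definition Q :: "real \<Rightarrow> 'a \<Rightarrow> 'a" where "Q \<theta> z = z - P \<theta> z"

lemma res_eq:
  assumes "response \<theta> z x"
  shows "res \<theta> z n = x n"
  unfolding res_def using response_unique[OF someI[of "response \<theta> z", OF assms] assms] .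

lemma res_response_bound:
  assumes z: "z \<in> Z"
  shows "response \<theta> z (res \<theta> z)" "norm (res \<theta> z n) \<le> G * (1/2) ^ nat \<bar>n\<bar> * norm z"
proof -
  obtain x where x: "\<And>n. x n \<in> Z"
      "\<And>n. x n = V (g \<theta> n) (g \<theta> (n - 1)) (x (n - 1)) + (if n = 0 then z else 0)"
      "\<And>n. norm (x n) \<le> G * (1/2) ^ nat \<bar>n\<bar> * norm z"
    using pulse[OF z, of \<theta>] unfolding g_def by blast
  have le: "G * (1/2) ^ nat \<bar>n\<bar> * norm z \<le> G * norm z" for n
    using G power_le_one[of "1/2 :: real" "nat \<bar>n\<bar>"]
    by (intro mult_right_mono) (auto simp: mult_left_le)
  have r: "response \<theta> z x"
    by (rule responseI[OF x(1,2)]) (rule order_trans[OF x(3) le])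
  then show "response \<theta> z (res \<theta> z)"
    unfolding res_def by (rule someI[where P = "response \<theta> z"])
  show "norm (res \<theta> z n) \<le> G * (1/2) ^ nat \<bar>n\<bar> * norm z"
    unfolding res_eq[OF r] by (rule x(3))
qed

lemmas res_response = res_response_bound(1)
lemmas res_in_Z = responseD(1)[OF res_response]
lemmas res_rec = responseD(2)[OF res_response]

lemma res_bounded_by: "bounded_by Z (G * (1/2) ^ nat \<bar>n\<bar>) (\<lambda>z. res \<theta> z n)"
  unfolding bounded_by_def linear_on_set_def
proof (intro conjI ballI allI)
  show "res \<theta> (x + y) n = res \<theta> x n + res \<theta> y n" if "x \<in> Z" "y \<in> Z" for x y
    by (rule res_eq[OF response_add[OF res_response[OF that(1)] res_response[OF that(2)]]])
  show "res \<theta> (c *\<^sub>R x) n = c *\<^sub>R res \<theta> x n" if "x \<in> Z" for x c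
    by (rule res_eq[OF response_scale[OF res_response[OF that]]])
qed (use subspace_Z res_response_bound(2) in auto)

lemma P_bounded_by: "bounded_by Z G (P \<theta>)"
  using res_bounded_by[of 0 \<theta>] unfolding P_def[abs_def] by simp

lemma P_in_Z: "z \<in> Z \<Longrightarrow> P \<theta> z \<in> Z"
  unfolding P_def by (rule res_in_Z)

lemma Q_bounded_by: "bounded_by Z (1 + G) (Q \<theta>)"
proof -
  have "bounded_by Z 1 (\<lambda>z. z)"
    unfolding bounded_by_def linear_on_set_def using subspace_Z by simp
  then show ?thesis
    unfolding Q_def[abs_def] by (rule bounded_by_diff[OF _ P_bounded_by])
qed

lemma Q_in_Z: "z \<in> Z \<Longrightarrow> Q \<theta> z \<in> Z"
  unfolding Q_def using P_in_Z subspace_Z by (simp add: subspace_diff)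

text \<open>Propagating the bounded response on the grid of \<open>s\<close> to the grid of \<open>t\<close> gives the bounded
  response to \<open>V t s z\<close>; this is where invariance at non-integer time differences comes from.\<close>

lemma res_transport:
  assumes st: "s \<le> t" and z: "z \<in> Z"
  shows "res t (V t s z) n = V (g t n) (g s n) (res s z n)"
proof (rule res_eq)
  have le: "g s n \<le> g t n" for n unfolding g_def using st by simp
  note r = res_in_Z[OF z, of s]
  obtain K' where K': "0 \<le> K'" "\<And>s' t'. s' \<le> t' \<Longrightarrow> t' \<le> s' + (t - s) \<Longrightarrow> bounded_by Z K' (V t' s')"
    using V_bound_exists[of "t - s"] by blast
  obtain M where M: "\<And>n. norm (res s z n) \<le> M"
    using responseD(3)[OF res_response[OF z]] by blast
  show "response t (V t s z) (\<lambda>n. V (g t n) (g s n) (res s z n))"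
  proof (rule responseI)
    show "V (g t n) (g s n) (res s z n) \<in> Z" for n
      by (rule V_props(2)[OF le r])
    show "norm (V (g t n) (g s n) (res s z n)) \<le> K' * M" for n
    proof -
      have "norm (V (g t n) (g s n) (res s z n)) \<le> K' * norm (res s z n)"
        by (rule bounded_byD(2)[OF K'(2)[OF le] r]) (simp add: g_def)
      also have "\<dots> \<le> K' * M" by (rule mult_left_mono[OF M K'(1)])
      finally show ?thesis .
    qed
    fix n
    let ?x = "res s z (n - 1)" and ?p = "if n = 0 then z else 0"
    have p: "?p \<in> Z" using z Z0 by simp
    have "V (g t n) (g s n) (res s z n) = V (g t n) (g s n) (V (g s n) (g s (n - 1)) ?x + ?p)"
      using res_rec[OF z, of s n] by simp
    also have "\<dots> = V (g t n) (g s n) (V (g s n) (g s (n - 1)) ?x) + V (g t n) (g s n) ?p"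
      by (rule V_lin(2)[OF le V_props(2)[OF g_pred r] p])
    also have "V (g t n) (g s n) ?p = (if n = 0 then V t s z else 0)"
      using V_lin(4)[OF le[of n]] by simp
    also have "V (g t n) (g s n) (V (g s n) (g s (n - 1)) ?x) = V (g t n) (g s (n - 1)) ?x"
      by (rule V_props(4)[OF order_trans[OF g_pred le] g_pred le r])
    also have "\<dots> = V (g t n) (g t (n - 1)) (V (g t (n - 1)) (g s (n - 1)) ?x)"
      by (rule V_props(4)[OF order_trans[OF g_pred le] le g_pred r, symmetric])
    finally show "V (g t n) (g s n) (res s z n)
        = V (g t n) (g t (n - 1)) (V (g t (n - 1)) (g s (n - 1)) ?x) + (if n = 0 then V t s z else 0)" .
  qed
qed

lemma P_V: "s \<le> t \<Longrightarrow> z \<in> Z \<Longrightarrow> P t (V t s z) = V t s (P s z)"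
  unfolding P_def using res_transport[of s t z 0] by simp

lemma Q_V: "s \<le> t \<Longrightarrow> z \<in> Z \<Longrightarrow> Q t (V t s z) = V t s (Q s z)"
  unfolding Q_def using P_V V_lin(5) P_in_Z by simp

lemma res_forward:
  assumes z: "z \<in> Z"
  shows "res s z (int n) = V (g s (int n)) s (P s z)"
proof (induction n)
  case 0
  then show ?case using V_props(3)[OF order_refl P_in_Z[OF z]] by (simp add: P_def)
next
  case (Suc n)
  have "res s z (int (Suc n)) = V (g s (int (Suc n))) (g s (int n)) (res s z (int n))"
    using res_rec[OF z, of s "int (Suc n)"] by simp
  also have "\<dots> = V (g s (int (Suc n))) s (P s z)"
    unfolding Suc.IH
    by (rule V_props(4)[OF _ _ _ P_in_Z[OF z]]) (use g_mono[of 0 "int n" s] g_mono[of 0 "int (Suc n)" s]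
        g_mono[of "int n" "int (Suc n)" s] in auto)
  finally show ?case .
qed

text \<open>Cutting the response to \<open>z\<close> off before index 0 leaves a bounded response to
  the pulse \<open>P s z\<close>, with the same value at 0.\<close>

lemma P_idem:
  assumes z: "z \<in> Z"
  shows "P s (P s z) = P s z"
proof -
  obtain M where M: "\<And>n. norm (res s z n) \<le> M"
    using responseD(3)[OF res_response[OF z]] by blast
  have "response s (P s z) (\<lambda>n. if 0 \<le> n then res s z n else 0)"
  proof (rule responseI)
    show "(if 0 \<le> n then res s z n else 0) \<in> Z" for n using res_in_Z[OF z] Z0 by simp
    show "norm (if 0 \<le> n then res s z n else 0) \<le> M" for n
      using M order_trans[OF norm_ge_zero M] by simp
    show "(if 0 \<le> n then res s z n else 0)
        = V (g s n) (g s (n - 1)) (if 0 \<le> n - 1 then res s z (n - 1) else 0) + (if n = 0 then P s z else 0)" for n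
      using res_rec[OF z, of s n] V_lin(4)[OF g_pred[of s n]]
      by (cases "n = 0") (auto simp: P_def)
  qed
  from res_eq[OF this, of 0] show ?thesis by (simp add: P_def)
qed

lemma P_Q:
  assumes "z \<in> Z" shows "P s (Q s z) = 0"
  unfolding Q_def
  using linear_on_setD(5)[OF bounded_byD(1)[OF P_bounded_by] assms P_in_Z[OF assms]] P_idem[OF assms]
  by simp

lemma Q_idem: "z \<in> Z \<Longrightarrow> Q s (Q s z) = Q s z"
  using P_Q by (simp add: Q_def)

lemma Q_range_iff: "w \<in> Q s ` Z \<longleftrightarrow> w \<in> Z \<and> P s w = 0"
proof
  show "w \<in> Q s ` Z \<Longrightarrow> w \<in> Z \<and> P s w = 0" using P_Q Q_in_Z by auto
  show "w \<in> Z \<and> P s w = 0 \<Longrightarrow> w \<in> Q s ` Z"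
    by (intro image_eqI[of _ _ w]) (auto simp: Q_def)
qed

text \<open>Before the pulse the response is an orbit that arrives at \<open>s\<close> as
  \<open>P s z - z\<close>, so its negative is a past of \<open>Q s z\<close>. At least one step
  back is taken, since the value at 0 already contains the pulse.\<close>

lemma Q_backward:
  assumes z: "z \<in> Z"
  shows "V s (g s (- int (Suc n))) (- res s z (- int (Suc n))) = Q s z"
proof (induction n)
  case 0
  have "P s z = V s (g s (- 1)) (res s z (- 1)) + z"
    using res_rec[OF z, of s 0] by (simp add: P_def)
  moreover have "V s (g s (- 1)) (- res s z (- 1)) = - V s (g s (- 1)) (res s z (- 1))"
    using V_lin(3)[OF g_pred[of s 0] res_in_Z[OF z, of s "-1"], of "-1"] by simp
  ultimately show ?case by (simp add: Q_def)
next
  case (Suc n)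
  let ?m = "- int (Suc n)"
  have eq: "res s z ?m = V (g s ?m) (g s (?m - 1)) (res s z (?m - 1))"
    using res_rec[OF z, of s ?m] by simp
  have neg: "- res s z (?m - 1) \<in> Z"
    using subspace_neg[OF subspace_Z res_in_Z[OF z]] .
  have "V s (g s (?m - 1)) (- res s z (?m - 1))
      = V s (g s ?m) (V (g s ?m) (g s (?m - 1)) (- res s z (?m - 1)))"
    by (rule V_props(4)[OF _ _ _ neg, symmetric])
       (use g_pred[of s ?m] g_mono[of "?m - 1" 0 s] g_mono[of ?m 0 s] in auto)
  also have "V (g s ?m) (g s (?m - 1)) (- res s z (?m - 1)) = - res s z ?m"
    unfolding eq using V_lin(3)[OF g_pred[of s ?m] res_in_Z[OF z, of s "?m - 1"], of "-1"] by simp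
  finally have "V s (g s (?m - 1)) (- res s z (?m - 1)) = Q s z"
    using Suc.IH by simp
  moreover have "?m - 1 = - int (Suc (Suc n))" by simp
  ultimately show ?case by simp
qed

text \<open>As \<open>P s w = 0\<close>, the negated response before 0 is a bounded past of
  \<open>w\<close>, while the forward orbit vanishes from \<open>t\<close> on. Joined, they form a
  bounded orbit on the whole grid, which must be zero; its value at 0 is \<open>w\<close>.\<close>

lemma V_injective:
  assumes st: "s \<le> t" and w: "w \<in> Z" "P s w = 0" and 0: "V t s w = 0"
  shows "w = 0"
proof -
  define x where "x n = (if n < 0 then - res s w n else V (g s n) s w)" for n :: int
  have ge: "s \<le> g s n" if "0 \<le> n" for n using g_mono[OF that, of s] by simp
  obtain M where M: "\<And>n. norm (res s w n) \<le> M"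
    using responseD(3)[OF res_response[OF w(1)]] by blast
  obtain K' where K': "0 \<le> K'" "\<And>s' t'. s' \<le> t' \<Longrightarrow> t' \<le> s' + (t - s) \<Longrightarrow> bounded_by Z K' (V t' s')"
    using V_bound_exists[of "t - s"] by blast
  have "x 0 = 0"
  proof (rule orbit_zero[of x s "max M (K' * norm w)"])
    show "x n \<in> Z" for n
      unfolding x_def using subspace_neg[OF subspace_Z res_in_Z[OF w(1)]] V_props(2)[OF ge w(1)] by simp
    \<comment> \<open>\<open>M\<close> covers the past. The forward part needs a bound only up to
      \<open>t\<close>, where it becomes zero, and \<open>K'\<close> bounds \<open>V\<close> over
      that length.\<close>
    show "norm (x n) \<le> max M (K' * norm w)" for n
    proof (cases "n < 0")
      case True
      then show ?thesis using M[of n] unfolding x_def by (simp add: le_max_iff_disj)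
    next
      case n: False
      show ?thesis
      proof (cases "g s n \<le> t")
        case True
        then have "norm (V (g s n) s w) \<le> K' * norm w"
          using n by (intro bounded_byD(2)[OF K'(2)[OF ge] w(1)]) auto
        then show ?thesis using n unfolding x_def by (simp add: le_max_iff_disj)
      next
        case False
        then have "V (g s n) s w = V (g s n) t (V t s w)"
          using V_props(4)[OF ge st _ w(1), of n] n by simp
        then have "V (g s n) s w = 0" using 0 V_lin(4)[of t "g s n"] False by simp
        then show ?thesis using n K'(1) unfolding x_def by (simp add: le_max_iff_disj)
      qed
    qed
    fix n :: int
    have "x n = V (g s n) (g s (n - 1)) (x (n - 1))"
    proof -
      consider "n < 0" | "n = 0" | "0 < n" by linarith
      then show ?thesis
      proof cases
        case 1
        then show ?thesis
          using res_rec[OF w(1), of s n] V_lin(3)[OF g_pred[of s n] res_in_Z[OF w(1), of s "n - 1"], of "-1"]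
          unfolding x_def by simp
      next
        case 2
        then show ?thesis
          using Q_backward[where n = 0 and s = s, OF w(1)] w V_props(3)[OF order_refl w(1)] unfolding x_def Q_def by simp
      next
        case 3
        then show ?thesis
          using V_props(4)[OF ge[of n] ge[of "n - 1"] g_pred[of s n] w(1)] unfolding x_def by simp
      qed
    qed
    then show "x n = V (s + real_of_int n * L) (s + real_of_int (n - 1) * L) (x (n - 1))"
      unfolding g_def .
  qed
  then show ?thesis using V_props(3)[OF order_refl w(1)] unfolding x_def by simp
qed

lemma V_inj_on: "s \<le> t \<Longrightarrow> inj_on (V t s) (Q s ` Z)"
proof (rule inj_onI)
  fix v w assume st: "s \<le> t" and vw: "v \<in> Q s ` Z" "w \<in> Q s ` Z" "V t s v = V t s w"
  then have Z: "v \<in> Z" "w \<in> Z" "P s v = 0" "P s w = 0" by (auto simp: Q_range_iff)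
  have "V t s (v - w) = 0" "P s (v - w) = 0"
    using vw(3) V_lin(5)[OF st Z(1,2)] linear_on_setD(5)[OF bounded_byD(1)[OF P_bounded_by] Z(1,2)] Z
    by simp_all
  from V_injective[OF st _ this(2,1)] show "v = w"
    using subspace_diff[OF subspace_Z Z(1,2)] by simp
qed

text \<open>An explicit preimage of \<open>Q t z\<close>: the negated response for \<open>t\<close>,
  taken at a grid point not after \<open>s\<close> and run forward to \<open>s\<close>. Applying
  \<open>Q s\<close> places it in the right range, and invariance of \<open>Q\<close> together with
  idempotence keeps its image at \<open>t\<close>.\<close>

lemma backward_formula:
  assumes st: "s \<le> t" and z: "z \<in> Z" and n: "t \<le> s + real (Suc n) * L"
  defines "v \<equiv> Q s (V s (g t (- int (Suc n))) (- res t z (- int (Suc n))))"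
  shows "v \<in> Q s ` Z" "V t s v = Q t z" "backward_evolution Z V Q s t z = v"
proof -
  let ?r = "g t (- int (Suc n))" and ?y = "- res t z (- int (Suc n))"
  have r: "?r \<le> s" using n unfolding g_def by (simp add: algebra_simps)
  have y: "?y \<in> Z" using subspace_neg[OF subspace_Z res_in_Z[OF z]] .
  have Vy: "V s ?r ?y \<in> Z" by (rule V_props(2)[OF r y])
  show v: "v \<in> Q s ` Z" unfolding v_def using Vy by blast
  have "V t s v = Q t (V t s (V s ?r ?y))"
    unfolding v_def by (rule Q_V[OF st Vy, symmetric])
  also have "\<dots> = Q t (Q t z)"
    unfolding V_props(4)[OF order_trans[OF r st] r st y] Q_backward[OF z] ..
  finally show Vv: "V t s v = Q t z" using Q_idem[OF z] by simp
  show "backward_evolution Z V Q s t z = v"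
    unfolding backward_evolution_def Vv[symmetric] by (rule inv_into_f_f[OF V_inj_on[OF st] v])
qed

text \<open>One halving per length \<open>L\<close> is the exponential rate \<open>ln 2 / L\<close>.
  Forward, only the \<open>n\<close> full steps inside \<open>t - s\<close> count, which costs the
  factor 2; backward, the response is used one step beyond, with \<open>Suc n\<close>
  halvings.\<close>

lemma exists_steps:
  assumes "s \<le> t"
  obtains n where "s + real n * L \<le> t" "t \<le> s + real (Suc n) * L"
    "(1/2) ^ Suc n \<le> exp (- (ln 2 / L) * (t - s))" "(1/2) ^ n \<le> 2 * exp (- (ln 2 / L) * (t - s))"
proof -
  define n where "n = nat \<lfloor>(t - s) / L\<rfloor>"
  have "0 \<le> (t - s) / L" using assms L by simp
  then have n: "real n \<le> (t - s) / L" "(t - s) / L \<le> real (Suc n)"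
    unfolding n_def by linarith+
  have "ln (2::real) * ((t - s) / L) \<le> ln 2 * real (Suc n)"
    using n(2) by (intro mult_left_mono) auto
  then have "exp (- (ln 2 * real (Suc n))) \<le> exp (- (ln 2 / L) * (t - s))"
    by simp
  moreover have eq: "exp (- (ln 2 * real (Suc n))) = (1/2) ^ Suc n"
  proof -
    have "exp (- (ln 2 * real (Suc n))) = exp (real (Suc n) * - ln 2)" by (simp add: mult.commute)
    also have "\<dots> = exp (- ln 2) ^ Suc n" by (rule exp_of_nat_mult)
    also have "exp (- ln 2) = (1/2 :: real)" by (simp add: exp_minus inverse_eq_divide)
    finally show ?thesis .
  qed
  ultimately have 1: "(1/2) ^ Suc n \<le> exp (- (ln 2 / L) * (t - s))" unfolding eq by simp
  have 2: "(1/2) ^ n \<le> 2 * exp (- (ln 2 / L) * (t - s))"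
    using mult_left_mono[OF 1, of 2] by simp
  have "s + real n * L \<le> t" "t \<le> s + real (Suc n) * L"
    using n L by (simp_all add: pos_le_divide_eq pos_divide_le_eq)
  from that[OF this 1 2] show ?thesis .
qed

text \<open>The decay of the response governs the full steps, and \<open>K\<close> pays for the
  incomplete last one. The factor 2 from rounding is absorbed in \<open>1 + G\<close>, so that both
  directions share one constant.\<close>

lemma forward_bound:
  assumes st: "s \<le> t"
  shows "bounded_by Z ((1 + G) * K * G * exp (- (ln 2 / L) * (t - s))) (\<lambda>x. V t s (P s x))"
proof -
  obtain n where n: "s + real n * L \<le> t" "t \<le> s + real (Suc n) * L"
    "(1/2) ^ n \<le> 2 * exp (- (ln 2 / L) * (t - s))"
    using exists_steps[OF st] by blast
  let ?r = "g s (int n)"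
  have r: "s \<le> ?r" "?r \<le> t" "t \<le> ?r + L" using n L by (auto simp: g_def algebra_simps)
  have "bounded_by Z (K * (G * (1/2) ^ n)) (\<lambda>x. V t ?r (res s x (int n)))"
    by (rule bounded_by_comp[OF _ bound[OF r(2,3)] res_in_Z]) (use res_bounded_by[of "int n" s] K in auto)
  moreover have "V t ?r (res s x (int n)) = V t s (P s x)" if "x \<in> Z" for x
    unfolding res_forward[OF that] by (rule V_props(4)[OF st r(1,2) P_in_Z[OF that]])
  ultimately have "bounded_by Z (K * (G * (1/2) ^ n)) (\<lambda>x. V t s (P s x))"
    by (rule bounded_by_cong)
  moreover have "K * (G * (1/2) ^ n) \<le> (1 + G) * K * G * exp (- (ln 2 / L) * (t - s))"
  proof -
    have "(1/2) ^ n \<le> (1 + G) * exp (- (ln 2 / L) * (t - s))"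
      by (rule order_trans[OF n(3) mult_right_mono]) (use G in auto)
    then have "(K * G) * (1/2) ^ n \<le> (K * G) * ((1 + G) * exp (- (ln 2 / L) * (t - s)))"
      using G K by (intro mult_left_mono) auto
    then show ?thesis by (simp add: mult_ac)
  qed
  ultimately show ?thesis by (rule bounded_by_mono)
qed

text \<open>In the preimage formula \<open>G\<close> comes from the response, \<open>K\<close> from
  the run of length at most \<open>L\<close> up to \<open>s\<close>, and \<open>1 + G\<close> from
  \<open>Q s\<close>.\<close>

lemma backward_bound:
  assumes st: "s \<le> t"
  shows "bounded_by Z ((1 + G) * K * G * exp (- (ln 2 / L) * (t - s))) (backward_evolution Z V Q s t)"
proof -
  obtain n where n: "s + real n * L \<le> t" "t \<le> s + real (Suc n) * L"
    "(1/2) ^ Suc n \<le> exp (- (ln 2 / L) * (t - s))"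
    using exists_steps[OF st] by blast
  let ?m = "- int (Suc n)"
  let ?r = "g t ?m"
  have r: "?r \<le> s" "s \<le> ?r + L" using n L by (auto simp: g_def algebra_simps)
  have neg: "- res t x ?m \<in> Z" if "x \<in> Z" for x
    using subspace_neg[OF subspace_Z res_in_Z[OF that]] .
  have "nat \<bar>?m\<bar> = Suc n" by simp
  then have 1: "bounded_by Z (G * (1/2) ^ Suc n) (\<lambda>x. - res t x ?m)"
    using bounded_by_minus[OF res_bounded_by[of ?m t]] by metis
  have 2: "bounded_by Z (K * (G * (1/2) ^ Suc n)) (\<lambda>x. V s ?r (- res t x ?m))"
    by (rule bounded_by_comp[OF 1 bound[OF r]]) (use neg K in auto)
  have "bounded_by Z ((1 + G) * (K * (G * (1/2) ^ Suc n))) (\<lambda>x. Q s (V s ?r (- res t x ?m)))"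
    by (rule bounded_by_comp[OF 2 Q_bounded_by]) (use V_props(2)[OF r(1) neg] G in auto)
  then have "bounded_by Z ((1 + G) * (K * (G * (1/2) ^ Suc n))) (backward_evolution Z V Q s t)"
    by (rule bounded_by_cong) (use backward_formula(3)[OF st _ n(2)] in simp)
  moreover have "((1 + G) * K * G) * (1/2) ^ Suc n \<le> ((1 + G) * K * G) * exp (- (ln 2 / L) * (t - s))"
    using n(3) G K by (intro mult_left_mono) auto
  moreover have "(1 + G) * (K * (G * (1/2) ^ Suc n)) = ((1 + G) * K * G) * (1/2) ^ Suc n"
    by (simp only: mult.assoc)
  ultimately show ?thesis
    by (metis bounded_by_mono)
qed

lemma backward_evolution_props:
  assumes st: "s \<le> t" and z: "z \<in> Z"
  shows "backward_evolution Z V Q s t z \<in> Q s ` Z" "V t s (backward_evolution Z V Q s t z) = Q t z"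
    "backward_evolution Z V Q s t z \<in> Z"
proof -
  obtain n where "t \<le> s + real (Suc n) * L" using exists_steps[OF st] by blast
  from backward_formula[OF st z this]
  show "backward_evolution Z V Q s t z \<in> Q s ` Z" "V t s (backward_evolution Z V Q s t z) = Q t z"
    by auto
  then show "backward_evolution Z V Q s t z \<in> Z" by (simp add: Q_range_iff)
qed

lemma V_bij_betw:
  assumes st: "s \<le> t"
  shows "bij_betw (V t s) (Q s ` Z) (Q t ` Z)"
  unfolding bij_betw_def
proof (intro conjI V_inj_on st equalityI subsetI)
  show "w \<in> Q t ` Z" if "w \<in> V t s ` (Q s ` Z)" for w
  proof -
    obtain z where z: "z \<in> Z" "w = V t s (Q s z)" using \<open>w \<in> _\<close> by blast
    then have "w = Q t (V t s z)" using Q_V[OF st] by simp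
    then show ?thesis using V_props(2)[OF st z(1)] by blast
  qed
  show "w \<in> V t s ` (Q s ` Z)" if "w \<in> Q t ` Z" for w
  proof -
    obtain z where z: "z \<in> Z" "w = Q t z" using \<open>w \<in> _\<close> by blast
    show ?thesis
      unfolding z(2) backward_evolution_props(2)[OF st z(1), symmetric]
      by (rule imageI[OF backward_evolution_props(1)[OF st z(1)]])
  qed
qed

text \<open>On \<open>[s0, t1]\<close> the projection factors through the backward evolution from \<open>t1\<close> to \<open>s0\<close>, so
  its continuity reduces to that of the evolution family.\<close>

lemma Q_factor:
  assumes s: "s0 \<le> s" "s \<le> t1" and z: "z \<in> Z"
  shows "Q s z = V s s0 (backward_evolution Z V Q s0 t1 (V t1 s z))"
proof (rule inj_onD[OF V_inj_on[OF s(2)]])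
  have st: "s0 \<le> t1" using s by simp
  have y: "V t1 s z \<in> Z" by (rule V_props(2)[OF s(2) z])
  note b = backward_evolution_props[OF st y]
  show "V s s0 (backward_evolution Z V Q s0 t1 (V t1 s z)) \<in> Q s ` Z"
    using V_bij_betw[OF s(1)] b(1) unfolding bij_betw_def by blast
  show "V t1 s (Q s z) = V t1 s (V s s0 (backward_evolution Z V Q s0 t1 (V t1 s z)))"
    unfolding V_props(4)[OF st s b(3)] b(2) by (rule Q_V[OF s(2) z, symmetric])
qed (use z in blast)

lemma Q_continuous:
  assumes z: "z \<in> Z"
  shows "continuous_on UNIV (\<lambda>t. Q t z)"
proof -
  have joint: "continuous_on {(t, s). s \<le> t} (\<lambda>(t, s). V t s x)" if "x \<in> Z" for x
    using V that unfolding evolution_family_def by blast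
  have joint': "continuous_on T (\<lambda>s. V (p s) (q s) x)"
    if x: "x \<in> Z" and T: "continuous_on T p" "continuous_on T q" "\<And>s. s \<in> T \<Longrightarrow> q s \<le> p s"
    for x T and p q :: "real \<Rightarrow> real"
    using continuous_on_compose2[OF joint[OF x] continuous_on_Pair[OF T(1,2)]] T(3) by auto
  have seg: "continuous_on {s0..t1} (\<lambda>s. Q s z)" if st: "s0 \<le> t1" for s0 t1
  proof -
    let ?R = "backward_evolution Z V Q s0 t1"
    \<comment> \<open>The evolution operator and its argument both vary with \<open>s\<close>; a
      bound uniform over the segment lets strong continuity pass to the moving argument.\<close>
    obtain K' where K': "\<And>s' t'. s' \<le> t' \<Longrightarrow> t' \<le> s' + (t1 - s0) \<Longrightarrow> bounded_by Z K' (V t' s')"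
      using V_bound_exists[of "t1 - s0"] by blast
    have RZ: "?R y \<in> Z" if "y \<in> Z" for y
      by (rule backward_evolution_props(3)[OF st that])
    have "continuous_on {s0..t1} (\<lambda>s. V t1 s z)"
      by (rule joint'[OF z]) (auto intro: continuous_intros)
    then have "continuous_on {s0..t1} (\<lambda>s. ?R (V t1 s z))"
      by (rule continuous_on_bounded_by[where f = "\<lambda>_. ?R", OF backward_bound[OF st] continuous_on_const])
         (use V_props(2) z in auto)
    then have "continuous_on {s0..t1} (\<lambda>s. V s s0 (?R (V t1 s z)))"
    proof (rule continuous_on_bounded_by[where f = "\<lambda>s. V s s0" and S = Z and c = K', rotated 2])
      show "?R (V t1 s z) \<in> Z" if "s \<in> {s0..t1}" for s
        using RZ V_props(2) that z by simp
      show "bounded_by Z K' (V s s0)" if "s \<in> {s0..t1}" for s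
        using K' that by simp
      show "continuous_on {s0..t1} (\<lambda>s. V s s0 x)" if "x \<in> Z" for x
        by (rule joint'[OF that]) (auto intro: continuous_intros)
    qed
    then show ?thesis
      by (rule continuous_on_eq) (use Q_factor z in auto)
  qed
  have "isCont (\<lambda>t. Q t z) t" for t
    by (rule continuous_on_interior[OF seg[of "t - 1" "t + 1"]]) (auto simp: interior_atLeastAtMost_real)
  then show ?thesis by (simp add: continuous_at_imp_continuous_on)
qed

lemma dichotomy: "exponential_dichotomy Z V"
proof -
  let ?\<kappa> = "(1 + G) * K * G" and ?\<beta> = "ln 2 / L"
  have KG: "1 \<le> K * G" using mult_mono[OF K G] K by simp
  have \<kappa>: "1 \<le> ?\<kappa>"
    using mult_mono[of 1 "1 + G" 1 "K * G"] KG G by (simp add: mult.assoc)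
  have pos: "0 \<le> ?\<kappa> * exp (- ?\<beta> * (t - s))" for s t
    using \<kappa> by simp
  have "exponential_dichotomy_with Z V ?\<kappa> ?\<beta>"
    unfolding exponential_dichotomy_with_def
  proof (rule exI[of _ P], rule exI[of _ Q], intro conjI allI impI ballI)
    show "bounded_projection Z (P t)" "bounded_projection Z (Q t)" for t
      unfolding bounded_projection_def
      using bounded_by_imp_bounded_ops[OF P_bounded_by P_in_Z] bounded_by_imp_bounded_ops[OF Q_bounded_by Q_in_Z]
        P_idem Q_idem by auto
    show "strongly_continuous Z Q"
      unfolding strongly_continuous_def using Q_continuous by blast
    show "strongly_continuous Z P"
      unfolding strongly_continuous_def
    proof
      fix z assume z: "z \<in> Z"
      have "continuous_on UNIV (\<lambda>t. z - Q t z)"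
        by (intro continuous_intros Q_continuous z)
      then show "continuous_on UNIV (\<lambda>t. P t z)" by (simp add: Q_def)
    qed
    show "P t z + Q t z = z" for t z unfolding Q_def by simp
    fix t s :: real assume st: "s \<le> t"
    show "P t (V t s z) = V t s (P s z)" if "z \<in> Z" for z by (rule P_V[OF st that])
    show "bij_betw (V t s) (Q s ` Z) (Q t ` Z)" by (rule V_bij_betw[OF st])
    have bop: "backward_evolution Z V Q s t \<in> bounded_ops Z Z"
      by (rule bounded_by_imp_bounded_ops[OF backward_bound[OF st]])
         (rule backward_evolution_props(3)[OF st])
    show "backward_evolution Z V Q s t \<in> bounded_ops Z Z" by (rule bop)
    show "onorm_on Z (backward_evolution Z V Q s t) \<le> ?\<kappa> * exp (- ?\<beta> * (t - s))"
      using bounded_by_iff_onorm_on[OF bop pos] backward_bound[OF st] by blast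
    have fop: "(\<lambda>x. V t s (P s x)) \<in> bounded_ops Z Z"
      by (rule bounded_by_imp_bounded_ops[OF forward_bound[OF st]])
         (use V_props(2)[OF st] P_in_Z in auto)
    show "onorm_on Z (\<lambda>x. V t s (P s x)) \<le> ?\<kappa> * exp (- ?\<beta> * (t - s))"
      using bounded_by_iff_onorm_on[OF fop pos] forward_bound[OF st] by blast
  qed
  then show ?thesis
    unfolding exponential_dichotomy_def using \<kappa> L by (intro exI[of _ ?\<kappa>] exI[of _ ?\<beta>] conjI) auto
qed

end

subsection \<open>Roughness of exponential dichotomies\<close>

lemma backward_evolution_inverse:
  assumes bij: "bij_betw (U t s) (Q s ` Z) (Q t ` Z)" and x: "x \<in> Z"
  shows "backward_evolution Z U Q s t x \<in> Q s ` Z"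
    and "U t s (backward_evolution Z U Q s t x) = Q t x"
proof -
  have "Q t x \<in> U t s ` (Q s ` Z)" using bij x unfolding bij_betw_def by blast
  then show "backward_evolution Z U Q s t x \<in> Q s ` Z"
    "U t s (backward_evolution Z U Q s t x) = Q t x"
    unfolding backward_evolution_def by (rule inv_into_into, rule f_inv_into_f)
qed

lemma backward_evolution_left_inverse:
  assumes bij: "bij_betw (U t s) (Q s ` Z) (Q t ` Z)" and y: "y \<in> Q s ` Z"
    and x: "Q t x = U t s y"
  shows "backward_evolution Z U Q s t x = y"
  unfolding backward_evolution_def x using bij y by (simp add: bij_betw_def inv_into_f_f)

text \<open>An estimate on \<open>onorm_on\<close> is informative only for members of
  \<open>bounded_ops\<close>, so the composed forward operator is shown to be bounded beforehand.
  The uniform bound \<open>\<kappa>\<close> on \<open>P\<close> is the forward estimate at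
  \<open>t = s\<close>.\<close>

lemma exponential_dichotomyE:
  assumes U: "evolution_family Z U" and dich: "exponential_dichotomy Z U"
  obtains \<kappa> \<beta> P Q where "1 \<le> \<kappa>" "0 < \<beta>"
    "\<And>t x. x \<in> Z \<Longrightarrow> P t x + Q t x = x"
    "\<And>t. bounded_by Z \<kappa> (P t)" "\<And>t x. x \<in> Z \<Longrightarrow> P t x \<in> Z" "\<And>t x. x \<in> Z \<Longrightarrow> P t (P t x) = P t x"
    "\<And>t x. x \<in> Z \<Longrightarrow> Q t x \<in> Z" "\<And>t x. x \<in> Z \<Longrightarrow> Q t (Q t x) = Q t x"
    "\<And>s t x. s \<le> t \<Longrightarrow> x \<in> Z \<Longrightarrow> P t (U t s x) = U t s (P s x)"
    "\<And>s t x. s \<le> t \<Longrightarrow> x \<in> Z \<Longrightarrow> norm (U t s (P s x)) \<le> \<kappa> * exp (- \<beta> * (t - s)) * norm x"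
    "\<And>s t. s \<le> t \<Longrightarrow> bij_betw (U t s) (Q s ` Z) (Q t ` Z)"
    "\<And>s t. s \<le> t \<Longrightarrow>
       bounded_by Z (\<kappa> * exp (- \<beta> * (t - s))) (backward_evolution Z U Q s t)"
proof -
  obtain \<kappa> \<beta> where \<kappa>\<beta>: "1 \<le> \<kappa>" "0 < \<beta>" and dw: "exponential_dichotomy_with Z U \<kappa> \<beta>"
    using dich unfolding exponential_dichotomy_def by blast
  obtain P Q where proj: "\<forall>t. bounded_projection Z (P t) \<and> bounded_projection Z (Q t)"
    and PQ: "\<forall>t. \<forall>x\<in>Z. P t x + Q t x = x"
    and evol: "\<forall>t s. s \<le> t \<longrightarrow>
           (\<forall>x\<in>Z. P t (U t s x) = U t s (P s x)) \<and>
           bij_betw (U t s) (Q s ` Z) (Q t ` Z) \<and>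
           backward_evolution Z U Q s t \<in> bounded_ops Z Z \<and>
           onorm_on Z (\<lambda>x. U t s (P s x)) \<le> \<kappa> * exp (- \<beta> * (t - s)) \<and>
           onorm_on Z (backward_evolution Z U Q s t) \<le> \<kappa> * exp (- \<beta> * (t - s))"
    using dw unfolding exponential_dichotomy_with_def by blast
  have PU: "P t (U t s x) = U t s (P s x)" if "s \<le> t" "x \<in> Z" for s t x
    using evol that by simp
  have bij: "bij_betw (U t s) (Q s ` Z) (Q t ` Z)"
    and bwd: "backward_evolution Z U Q s t \<in> bounded_ops Z Z"
    and fwd_le: "onorm_on Z (\<lambda>x. U t s (P s x)) \<le> \<kappa> * exp (- \<beta> * (t - s))"
    and bwd_le: "onorm_on Z (backward_evolution Z U Q s t) \<le> \<kappa> * exp (- \<beta> * (t - s))"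
    if "s \<le> t" for s t
    using evol[rule_format, OF that] by simp_all
  have Pop: "P t \<in> bounded_ops Z Z" and PP: "x \<in> Z \<Longrightarrow> P t (P t x) = P t x" for t x
    using proj unfolding bounded_projection_def by simp_all
  have Qop: "Q t \<in> bounded_ops Z Z" and QQ: "x \<in> Z \<Longrightarrow> Q t (Q t x) = Q t x" for t x
    using proj unfolding bounded_projection_def by simp_all
  have Uop: "U t s \<in> bounded_ops Z Z" if "s \<le> t" for s t
    using U that unfolding evolution_family_def by blast
  have pos: "0 \<le> \<kappa> * exp (- \<beta> * (t - s))" for s t using \<kappa>\<beta>(1) by simp
  have fwd: "bounded_by Z (\<kappa> * exp (- \<beta> * (t - s))) (\<lambda>x. U t s (P s x))" if st: "s \<le> t" for s t
  proof -
    obtain c d where c: "bounded_by Z c (P s)" and d: "bounded_by Z d (U t s)"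
      using bounded_ops_imp_bounded_by[OF Pop] bounded_ops_imp_bounded_by[OF Uop[OF st]] by blast
    \<comment> \<open>On the zero space the constant \<open>d\<close> may be negative, so its
      absolute value is used.\<close>
    have "bounded_by Z (\<bar>d\<bar> * c) (\<lambda>x. U t s (P s x))"
      by (rule bounded_by_comp[OF c bounded_by_mono[OF d] bounded_opsD(2)[OF Pop]]) auto
    then have "(\<lambda>x. U t s (P s x)) \<in> bounded_ops Z Z"
      by (rule bounded_by_imp_bounded_ops) (use bounded_opsD(2)[OF Pop] bounded_opsD(2)[OF Uop[OF st]] in blast)
    from bounded_by_iff_onorm_on[OF this pos] show ?thesis using fwd_le[OF st] by blast
  qed
  have "bounded_by Z \<kappa> (P t)" for t
  proof (rule bounded_by_cong)
    show "bounded_by Z \<kappa> (\<lambda>x. U t t (P t x))" using fwd[of t t] by simp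
    show "U t t (P t x) = P t x" if "x \<in> Z" for x
      using U bounded_opsD(2)[OF Pop that] unfolding evolution_family_def by blast
  qed
  note P_bound = this
  show ?thesis
  proof (rule that[of \<kappa> \<beta> P Q])
    show "P t x + Q t x = x" if "x \<in> Z" for t x using PQ that by simp
    show "bounded_by Z (\<kappa> * exp (- \<beta> * (t - s))) (backward_evolution Z U Q s t)" if "s \<le> t" for s t
      using bounded_by_iff_onorm_on[OF bwd[OF that] pos] bwd_le[OF that] by simp
    show "norm (U t s (P s x)) \<le> \<kappa> * exp (- \<beta> * (t - s)) * norm x" if "s \<le> t" "x \<in> Z" for s t x
      by (rule bounded_byD(2)[OF fwd[OF that(1)] that(2)])
  qed (fact \<kappa>\<beta> P_bound bounded_opsD(2)[OF Pop] PP bounded_opsD(2)[OF Qop] QQ PU bij)+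
qed

text \<open>\<open>1/8\<close> and \<open>1 / (16 * \<kappa>)\<close> are the thresholds of the
  discrete theory. They hold for all \<open>s\<close>, so every grid origin meets them with the same
  constants, and \<open>8 * \<kappa>\<close> bounds every response.\<close>

lemma close_evolution_dichotomy:
  fixes Z :: "'a::banach set"
  assumes Z: "closed Z" "subspace Z" and U: "evolution_family Z U" and V: "evolution_family Z V"
    and L: "0 < L" and K: "1 \<le> K" and bound: "\<And>s t. s \<le> t \<Longrightarrow> t \<le> s + L \<Longrightarrow> bounded_by Z K (V t s)"
    and \<kappa>: "1 \<le> \<kappa>"
    and PQ: "\<And>t x. x \<in> Z \<Longrightarrow> P t x + Q t x = x"
    and P: "\<And>t. bounded_by Z \<kappa> (P t)" "\<And>t x. x \<in> Z \<Longrightarrow> P t x \<in> Z" "\<And>t x. x \<in> Z \<Longrightarrow> P t (P t x) = P t x"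
    and Q: "\<And>t x. x \<in> Z \<Longrightarrow> Q t x \<in> Z" "\<And>t x. x \<in> Z \<Longrightarrow> Q t (Q t x) = Q t x"
    and PU: "\<And>s t x. s \<le> t \<Longrightarrow> x \<in> Z \<Longrightarrow> P t (U t s x) = U t s (P s x)"
    and UP: "\<And>s t x. t = s + L \<Longrightarrow> x \<in> Z \<Longrightarrow> norm (U t s (P s x)) \<le> 1/8 * norm x"
    and bij: "\<And>s t. s \<le> t \<Longrightarrow> bij_betw (U t s) (Q s ` Z) (Q t ` Z)"
    and bwd: "\<And>s t. t = s + L \<Longrightarrow> bounded_by Z (1/8) (backward_evolution Z U Q s t)"
    and close: "\<And>s t x. t = s + L \<Longrightarrow> x \<in> Z \<Longrightarrow> norm (V t s x - U t s x) \<le> 1 / (16 * \<kappa>) * norm x"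
  shows "exponential_dichotomy Z V"
proof -
  define g where "g \<theta> n = \<theta> + of_int n * L" for \<theta> and n :: int
  have g_Suc: "g \<theta> (n + 1) = g \<theta> n + L" and g_le: "g \<theta> n \<le> g \<theta> (n + 1)" for \<theta> n
    using L unfolding g_def by (simp_all add: algebra_simps)
  have Uop: "U t s \<in> bounded_ops Z Z" and Vop: "V t s \<in> bounded_ops Z Z" if "s \<le> t" for s t
    using U V that unfolding evolution_family_def by simp_all
  have QU: "Q t (U t s x) = U t s (Q s x)" if st: "s \<le> t" and x: "x \<in> Z" for s t x
  proof -
    note Uop = Uop[OF st]
    have "P t (U t s x) + Q t (U t s x) = U t s x"
      by (rule PQ[OF bounded_opsD(2)[OF Uop x]])
    moreover have "U t s x = U t s (P s x) + U t s (Q s x)"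
      using linear_on_setD(2)[OF bounded_opsD(1)[OF Uop] P(2)[OF x] Q(1)[OF x], of s s] PQ[OF x] by simp
    ultimately show ?thesis using PU[OF st x] by simp
  qed
  have inverse: "backward_evolution Z U Q s t x \<in> Q s ` Z"
    "U t s (backward_evolution Z U Q s t x) = Q t x" if "s \<le> t" "x \<in> Z" for s t x
    by (rule backward_evolution_inverse[where U = U and Q = Q, OF bij[OF that(1)] that(2)])+
  have discrete: "discrete_dichotomy Z (\<lambda>n. V (g \<theta> (n + 1)) (g \<theta> n)) (\<lambda>n. U (g \<theta> (n + 1)) (g \<theta> n))
      (\<lambda>n. P (g \<theta> n)) (\<lambda>n. Q (g \<theta> n)) (\<lambda>n. backward_evolution Z U Q (g \<theta> n) (g \<theta> (n + 1)))
      \<kappa> (1 / (16 * \<kappa>))" for \<theta>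
  proof
    fix n x
    show "V (g \<theta> (n + 1)) (g \<theta> n) \<in> bounded_ops Z Z" "U (g \<theta> (n + 1)) (g \<theta> n) \<in> bounded_ops Z Z"
      by (rule Vop[OF g_le], rule Uop[OF g_le])
    show "bounded_by Z (1/8) (backward_evolution Z U Q (g \<theta> n) (g \<theta> (n + 1)))"
      by (rule bwd[OF g_Suc])
    show "1 \<le> \<kappa>" "0 \<le> 1 / (16 * \<kappa>)" "\<kappa> * (1 / (16 * \<kappa>)) \<le> 1/16" using \<kappa> by simp_all
    assume x: "x \<in> Z"
    let ?R = "backward_evolution Z U Q (g \<theta> n) (g \<theta> (n + 1)) x"
    obtain y where y: "y \<in> Z" "?R = Q (g \<theta> n) y" using inverse(1)[OF g_le x] by blast
    then show "?R \<in> Z" "Q (g \<theta> n) ?R = ?R" using Q by simp_all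
    show "U (g \<theta> (n + 1)) (g \<theta> n) ?R = Q (g \<theta> (n + 1)) x" by (rule inverse(2)[OF g_le x])
    show "backward_evolution Z U Q (g \<theta> n) (g \<theta> (n + 1)) (Q (g \<theta> (n + 1)) x) = ?R"
      unfolding backward_evolution_def Q(2)[OF x] ..
    show "backward_evolution Z U Q (g \<theta> n) (g \<theta> (n + 1)) (U (g \<theta> (n + 1)) (g \<theta> n) (Q (g \<theta> n) x))
        = Q (g \<theta> n) x"
      by (rule backward_evolution_left_inverse[where U = U and Q = Q, OF bij[OF g_le]])
         (use x QU[OF g_le Q(1)[OF x]] Q(2)[OF x] in auto)
    show "P (g \<theta> (n + 1)) (U (g \<theta> (n + 1)) (g \<theta> n) x) = U (g \<theta> (n + 1)) (g \<theta> n) (P (g \<theta> n) x)"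
      by (rule PU[OF g_le x])
    show "norm (U (g \<theta> (n + 1)) (g \<theta> n) (P (g \<theta> n) x)) \<le> 1/8 * norm x"
      by (rule UP[OF g_Suc x])
    show "norm (V (g \<theta> (n + 1)) (g \<theta> n) x - U (g \<theta> (n + 1)) (g \<theta> n) x) \<le> 1 / (16 * \<kappa>) * norm x"
      by (rule close[OF g_Suc x])
  qed (use Z PQ P in auto)
  interpret pulse_family Z V L "8 * \<kappa>" K
  proof
    show "subspace Z" "evolution_family Z V" "0 < L" "1 \<le> K" "1 \<le> 8 * \<kappa>"
      using Z V L K \<kappa> by auto
    show "bounded_by Z K (V t s)" if "s \<le> t" "t \<le> s + L" for s t by (rule bound[OF that])
    show "\<exists>x. (\<forall>n. x n \<in> Z) \<and>
      (\<forall>n. x n = V (\<theta> + of_int n * L) (\<theta> + of_int (n - 1) * L) (x (n - 1)) + (if n = 0 then z else 0)) \<and>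
      (\<forall>n. norm (x n) \<le> 8 * \<kappa> * (1/2) ^ nat \<bar>n\<bar> * norm z)" if z: "z \<in> Z" for \<theta> z
    proof -
      obtain x where x: "\<And>n. x n \<in> Z"
        "\<And>n. x n = V (g \<theta> (n - 1 + 1)) (g \<theta> (n - 1)) (x (n - 1)) + (if n = 0 then z else 0)"
        "\<And>n. norm (x n) \<le> 8 * \<kappa> * (1/2) ^ nat \<bar>n\<bar> * norm z"
        using discrete_dichotomy.pulse_response[OF discrete z, of \<theta>] by blast
      show ?thesis
        using x(1,3) x(2)[unfolded diff_add_cancel, unfolded g_def] by (intro exI[of _ x]) blast
    qed
    show "x n = 0" if x: "\<And>n. x n \<in> Z"
      "\<And>n. x n = V (\<theta> + of_int n * L) (\<theta> + of_int (n - 1) * L) (x (n - 1))"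
      "\<And>n. norm (x n) \<le> M" for \<theta> and x :: "int \<Rightarrow> 'a" and M n
    proof (rule discrete_dichotomy.bounded_orbit_zero[OF discrete x(1) _ x(3)])
      show "x (n + 1) = V (g \<theta> (n + 1)) (g \<theta> n) (x n)" for n
        using x(2)[of "n + 1"] unfolding g_def by simp
    qed
  qed
  show ?thesis by (rule dichotomy)
qed

theorem theorem5p14:
  fixes A :: "'a::banach \<Rightarrow> 'a" and D :: "'a set"
    and B :: "real \<Rightarrow> 'a \<Rightarrow> 'a" and b :: "real \<Rightarrow> real"
    and UB :: "real \<Rightarrow> real \<Rightarrow> 'a \<Rightarrow> 'a"
  assumes "linear_on_set D A"
    and "resolvent_condition D A"
    and "forcing_condition D A"
    and "perturbation_condition (closure D) B b"
    and "bdd_above (range b)"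
    and "generates_evolution_family D A B UB"
    and "exponential_dichotomy (closure D) UB"
  shows "\<exists>\<epsilon>>0. \<forall>C :: real \<Rightarrow> 'a \<Rightarrow> 'a.
           (\<forall>t. C t \<in> bounded_ops (closure D) UNIV) \<longrightarrow>
           strongly_continuous (closure D) C \<longrightarrow>
           (\<forall>t. onorm_on (closure D) (\<lambda>x. B t x - C t x) \<le> \<epsilon>) \<longrightarrow>
           (\<exists>UC. generates_evolution_family D A C UC \<and> exponential_dichotomy (closure D) UC)"
proof -
  let ?Z = "closure D"
  obtain \<delta> where fp: "forced_problem D A \<delta>"
    using forced_problem_exists[OF assms(1-3)] by blast
  have Z: "subspace ?Z" by (rule closure_D_subspace[OF assms(1)])
  have UBev: "evolution_family ?Z UB"
    using assms(6) unfolding generates_evolution_family_def by blast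
  obtain b0 where b0: "\<And>t. b t \<le> b0" using assms(5) unfolding bdd_above_def by auto
  have Bc: "B t \<in> bounded_ops ?Z UNIV" "0 \<le> b t" "onorm_on ?Z (B t) \<le> b t" for t
    using assms(4) unfolding perturbation_condition_def by auto
  have b0_nonneg: "0 \<le> b0" using Bc(2) b0 order_trans by blast
  have B: "bounded_family ?Z b0 B"
    unfolding bounded_family_def
  proof (intro conjI allI b0_nonneg)
    show "bounded_by ?Z b0 (B t)" for t
      using bounded_by_iff_onorm_on[OF Bc(1) b0_nonneg] order_trans[OF Bc(3) b0] by blast
    show "strongly_continuous ?Z B"
      using assms(4) unfolding perturbation_condition_def by blast
  qed
  obtain \<tau> where \<tau>: "0 < \<tau>" "\<delta> \<tau> * (b0 + 1) \<le> 1/2"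
  proof -
    have "\<forall>\<^sub>F h in at_right 0. dist (\<delta> h) 0 < 1 / (2 * (b0 + 1))"
      using forced_problem.\<delta>_lim[OF fp] b0_nonneg by (intro tendstoD) auto
    then obtain h where h: "0 < h" "\<And>r. 0 < r \<Longrightarrow> r < h \<Longrightarrow> dist (\<delta> r) 0 < 1 / (2 * (b0 + 1))"
      unfolding eventually_at_right_field by blast
    have "\<delta> (h / 2) < 1 / (2 * (b0 + 1))" using h(2)[of "h / 2"] h(1) by simp
    then have "\<delta> (h / 2) * (b0 + 1) \<le> 1/2" using b0_nonneg by (simp add: field_simps)
    then show ?thesis using that[of "h / 2"] h(1) by simp
  qed
  interpret reference_problem D A \<delta> B b0 UB \<tau>
    by (rule reference_problem.intro[OF fp]) (unfold_locales; fact B assms(6) \<tau>)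
  obtain K where K: "1 \<le> K" "\<And>s t. s \<le> t \<Longrightarrow> t \<le> s + \<tau> \<Longrightarrow> bounded_by ?Z K (UB t s)"
    using UB_bound by blast
  obtain \<kappa> \<beta> P Q where \<kappa>: "1 \<le> \<kappa>" and \<beta>: "0 < \<beta>"
    and PQ: "\<And>t x. x \<in> ?Z \<Longrightarrow> P t x + Q t x = x"
    and P: "\<And>t. bounded_by ?Z \<kappa> (P t)" "\<And>t x. x \<in> ?Z \<Longrightarrow> P t x \<in> ?Z"
      "\<And>t x. x \<in> ?Z \<Longrightarrow> P t (P t x) = P t x"
    and Q: "\<And>t x. x \<in> ?Z \<Longrightarrow> Q t x \<in> ?Z" "\<And>t x. x \<in> ?Z \<Longrightarrow> Q t (Q t x) = Q t x"
    and PU: "\<And>s t x. s \<le> t \<Longrightarrow> x \<in> ?Z \<Longrightarrow> P t (UB t s x) = UB t s (P s x)"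
    and UP: "\<And>s t x. s \<le> t \<Longrightarrow> x \<in> ?Z \<Longrightarrow> norm (UB t s (P s x)) \<le> \<kappa> * exp (- \<beta> * (t - s)) * norm x"
    and bij: "\<And>s t. s \<le> t \<Longrightarrow> bij_betw (UB t s) (Q s ` ?Z) (Q t ` ?Z)"
    and bwd: "\<And>s t. s \<le> t \<Longrightarrow>
       bounded_by ?Z (\<kappa> * exp (- \<beta> * (t - s))) (backward_evolution ?Z UB Q s t)"
    by (rule exponential_dichotomyE[OF UBev assms(7)]) (rule that)
  \<comment> \<open>\<open>m\<close> is chosen so that
    \<open>exp (\<beta> * (m * \<tau>)) \<ge> 8 * \<kappa>\<close>, which yields the contraction
    \<open>1/8\<close>. \<open>L\<close> is a multiple of \<open>\<tau>\<close> to suit the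
    step-counting estimates, and \<open>Suc\<close> makes it positive at once.\<close>
  obtain m where m: "ln (8 * \<kappa>) / (\<beta> * \<tau>) \<le> real m" using real_arch_simple by blast
  define n where "n = Suc m"
  define L where "L = real n * \<tau>"
  have L: "0 < L" using \<tau> unfolding L_def n_def by simp
  have decay: "\<kappa> * exp (- \<beta> * L) \<le> 1/8"
  proof -
    have "ln (8 * \<kappa>) \<le> real m * (\<beta> * \<tau>)" using m \<beta> \<tau> by (simp add: pos_divide_le_eq)
    also have "\<dots> \<le> \<beta> * L" unfolding L_def n_def using \<beta> \<tau> by (simp add: algebra_simps)
    finally have "exp (ln (8 * \<kappa>)) \<le> exp (\<beta> * L)" by simp
    then show ?thesis using \<kappa> by (simp add: exp_minus field_simps)
  qed
  \<comment> \<open>The constant of \<open>UC_close\<close> for times at most \<open>L\<close>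
    apart; it does not depend on \<open>C\<close>, hence neither does
    \<open>\<epsilon>\<close>.\<close>
  define c where "c = real n * (2 * K) ^ n"
  have c: "0 < c" unfolding c_def n_def using K(1) by simp
  \<comment> \<open>\<open>1/2\<close> meets the requirement of \<open>close_problem\<close> and
    keeps the bound of \<open>C\<close> below \<open>b0 + 1\<close>; the other term makes the error
    over one step \<open>L\<close> at most \<open>1 / (16 * \<kappa>)\<close>.\<close>
  define \<epsilon> where "\<epsilon> = min (1/2) (1 / (16 * \<kappa> * c))"
  have \<epsilon>: "0 < \<epsilon>" "\<epsilon> \<le> 1/2" "c * \<epsilon> \<le> 1 / (16 * \<kappa>)"
  proof -
    show "0 < \<epsilon>" "\<epsilon> \<le> 1/2" unfolding \<epsilon>_def using \<kappa> c by auto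
    have "c * \<epsilon> \<le> c * (1 / (16 * \<kappa> * c))" unfolding \<epsilon>_def using c by (intro mult_left_mono) auto
    then show "c * \<epsilon> \<le> 1 / (16 * \<kappa>)" using c by simp
  qed
  have "\<exists>UC. generates_evolution_family D A C UC \<and> exponential_dichotomy ?Z UC"
    if C: "\<And>t. C t \<in> bounded_ops ?Z UNIV" "strongly_continuous ?Z C"
      "\<And>t. onorm_on ?Z (\<lambda>x. B t x - C t x) \<le> \<epsilon>" for C :: "real \<Rightarrow> 'a \<Rightarrow> 'a"
  proof -
    have BC: "bounded_by ?Z \<epsilon> (\<lambda>x. B t x - C t x)" for t
    proof -
      obtain d where "bounded_by ?Z d (C t)" using bounded_ops_imp_bounded_by[OF C(1)] by blast
      from bounded_by_diff[OF bounded_familyD(2)[OF B] this]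
      have "(\<lambda>x. B t x - C t x) \<in> bounded_ops ?Z UNIV" by (rule bounded_by_imp_bounded_ops) simp
      from bounded_by_iff_onorm_on[OF this, of \<epsilon>] show ?thesis using C(3) \<epsilon>(1) by simp
    qed
    have close: "norm (C t x - B t x) \<le> \<epsilon> * norm x" if "x \<in> ?Z" for t x
      using bounded_byD(2)[OF BC that, of t] by (simp add: norm_minus_commute)
    have "bounded_by ?Z (b0 + 1) (C t)" for t
    proof -
      have "bounded_by ?Z (b0 + \<epsilon>) (\<lambda>x. B t x - (B t x - C t x))"
        by (rule bounded_by_diff[OF bounded_familyD(2)[OF B] BC])
      then have "bounded_by ?Z (b0 + \<epsilon>) (C t)" by simp
      then show ?thesis by (rule bounded_by_mono) (use \<epsilon>(2) in simp)
    qed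
    then have Cf: "bounded_family ?Z (b0 + 1) C"
      unfolding bounded_family_def using C(2) b0_nonneg by simp
    interpret close_problem D A \<delta> B b0 UB \<tau> C \<epsilon> K
      by unfold_locales (use Cf \<epsilon> close K in auto)
    have "evolution_family ?Z UC"
      using UC_generates unfolding generates_evolution_family_def by blast
    moreover have "bounded_by ?Z ((2 * K) ^ n) (UC t s)" if "s \<le> t" "t \<le> s + L" for s t
      using UC_bound[of s t n] that unfolding L_def by blast
    moreover have "1 \<le> (2 * K) ^ n" using K(1) by (intro one_le_power) simp
    moreover have "norm (UB t s (P s x)) \<le> 1/8 * norm x" if "t = s + L" "x \<in> ?Z" for s t x
      using UP[of s t x] that L mult_right_mono[OF decay norm_ge_zero[of x]] by simp
    moreover have "bounded_by ?Z (1/8) (backward_evolution ?Z UB Q s t)" if "t = s + L" for s t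
      using bounded_by_mono[OF bwd[of s t]] that L decay by simp
    moreover have "norm (UC t s x - UB t s x) \<le> 1 / (16 * \<kappa>) * norm x" if "t = s + L" "x \<in> ?Z" for s t x
    proof -
      have "norm (UC t s x - UB t s x) \<le> c * \<epsilon> * norm x"
        unfolding c_def by (rule UC_close) (use that L in \<open>auto simp: L_def\<close>)
      also have "\<dots> \<le> 1 / (16 * \<kappa>) * norm x" by (rule mult_right_mono[OF \<epsilon>(3) norm_ge_zero])
      finally show ?thesis .
    qed
    ultimately have "exponential_dichotomy ?Z UC"
      by (intro close_evolution_dichotomy[OF closed_closure Z UBev _ L _ _ \<kappa> PQ P Q PU _ bij])
    then show ?thesis using UC_generates by blast
  qed
  with \<epsilon>(1) show ?thesis by blast
qed

end
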